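(* Let $\mathbf W$ be a general channel with input alphabet $\mathcal X=\mathbb R$, general cost function $\mathbf c$ and $\Gamma\in\mathbb R$, satisfying assumptions (A1) and (A2) below. Then for all $\varepsilon,\delta,\mu,\lambda\ge0$ with $\varepsilon\le\mu$, $\varepsilon\le\lambda$, $\delta<1-\mu-\lambda$, $$\sup_{\mathbf X\in\mathcal S_\Gamma}\underline I(\mathbf X;\mathbf Y)\le C_s(\varepsilon,\Gamma|\mathbf W)\le D(\mu,\lambda,\Gamma|\mathbf W)\le S(\delta,\Gamma|\mathbf W)\le\sup_{\mathbf X\in\mathcal S_\Gamma}\overline I(\mathbf X;\mathbf Y).$$
   Context: A general channel $\mathbf W=\{W^n\}$ with input alphabet $\mathcal X$ and output alphabet $\mathcal Y$ is a sequence of transition probabilities: for each $n$ and $\mathbf x\in\mathcal X^n$, $W^n(\cdot|\mathbf x)$ is a probability measure on $\mathcal Y^n$, measurable in $\mathbf x$. A general cost function is a sequence of functions $c_n:\mathcal X^n\to\mathbb R$; put $\mathcal X^n(\Gamma)=\{\mathbf x:\frac1n c_n(\mathbf x)\le\Gamma\}$. $\mathcal S_\Gamma$ is the set of input processes $\mathbf X=\{X^n\}$ with $\Pr\{X^n\in\mathcal X^n(\Gamma)\}=1$ for all $n$; $\mathbf Y=\{Y^n\}$ is the output process, $Y^n$ the output of $W^n$ for input $X^n$. For real random variables $Z_n$: $\text{p-}\liminf Z_n=\sup\{\alpha:\lim_n\Pr\{Z_n<\alpha\}=0\}$, $\text{p-}\limsup Z_n=\inf\{\beta:\lim_n\Pr\{Z_n>\beta\}=0\}$.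 $\underline I(\mathbf X;\mathbf Y)$ (resp. $\overline I$) is the p-liminf (resp. p-limsup) of $\frac1n\log\frac{W^n(Y^n|X^n)}{P_{Y^n}(Y^n)}$, the ratio meaning the Radon–Nikodym derivative $\frac{dP_{X^nY^n}}{d(P_{X^n}\times P_{Y^n})}(X^n,Y^n)$. For a distribution $Q$ on $\mathcal X^n$, $QW^n(B)=\int W^n(B|\mathbf x)Q(d\mathbf x)$. Transmission codes: an $(n,M_n,\varepsilon_n,\Gamma)$ code is an encoder $\varphi_n:\{1,\dots,M_n\}\to\mathcal X^n$ with $\frac1nc_n(\varphi_n(i))\le\Gamma$ for all $i$, and a decoder $\psi_n:\mathcal Y^n\to\{1,\dots,M_n\}$, with $\varepsilon_n=\frac1{M_n}\sum_iW^n(\mathcal D_i^c|\varphi_n(i))$, $\mathcal D_i=\psi_n^{-1}(i)$. $R$ is $(\varepsilon,\Gamma)$-achievable if such codes exist with $\limsup\varepsilon_n\le\varepsilon$, $\liminf\frac1n\log M_n\ge R$; $C_s(\varepsilon,\Gamma|\mathbf W)$ is the supremum of such $R$. Identification codes: an $(n,N_n,\mu_n,\lambda_n,\Gamma)$ code consists of distributions $Q_1,\dots,Q_{N_n}$ on $\mathcal X^n$ with $Q_i(\mathcal X^n(\Gamma))=1$ and (not necessarily disjoint) sets $\mathcal D_1,\dots,\mathcal D_{N_n}\subset\mathcal Y^n$, with $\mu_n=\max_iQ_iW^n(\mathcal D_i^c)$, $\lambda_n=\max_{i\ne j}Q_jW^n(\mathcal D_i)$. $R$ is $(\mu,\lambda,\Gamma)$-achievable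 if such codes exist with $\limsup\mu_n\le\mu$, $\limsup\lambda_n\le\lambda$, $\liminf\frac1n\log\log N_n\ge R$; $D(\mu,\lambda,\Gamma|\mathbf W)$ is the supremum of such $R$. Resolvability: $d(P,P')=2\sup_B|P(B)-P'(B)|$; $U_M$ is uniform on $\{1,\dots,M\}$. For $\mathbf X\in\mathcal S_\Gamma$, $R$ is $(\delta,\Gamma)$-achievable for $\mathbf X$ if there are $M_n$ and maps $\varphi_n:\{1,\dots,M_n\}\to\mathcal X^n(\Gamma)$ such that, with $\tilde Y^n$ the output of $W^n$ for input $\varphi_n(U_{M_n})$, $\limsup d(P_{Y^n},P_{\tilde Y^n})\le\delta$ and $\limsup\frac1n\log M_n\le R$. $R$ is $(\delta,\Gamma)$-achievable if so for all $\mathbf X\in\mathcal S_\Gamma$; $S(\delta,\Gamma|\mathbf W)$ is the infimum of such $R$. (A1): there exist $n$-dimensional cubes $V_n(\Gamma)\subset\mathbb R^n$ of edge length $l_n(\Gamma)\ge2$ with $\limsup_n\frac1n\log\log l_n(\Gamma)=0$ and $\mathcal X^n(\Gamma)\subset V_n(\Gamma)$ for all $n$. (A2): letting $F_n(\mathbf x)=\left[\frac{\partial^2}{\partial v_i\partial v_j}D(W^n(\cdot|\mathbf v)\|W^n(\cdot|\mathbf x))\right]_{\mathbf v=\mathbf x}$ ($D$ the Kullback–Leibler divergence, twice differentiable in $\mathbf v$) and $\|F_n(\mathbf x)\|=\sup_{\mathbf v\ne\mathbf 0}\frac{\mathbf vF_n(\mathbf x)\mathbf v^T}{\mathbf v\mathbf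 v^T}$, one has $\limsup_n\frac1n\log\max\{1,\log\sup_{\mathbf x\in V_n(\Gamma)}\|F_n(\mathbf x)\|\}=0$.
   Formalization: For identification codes with N_n = 1, log log N_n is read as 0, so D ≥ 0 whenever admissible inputs exist; read as −∞, the bound C_s ≤ D would fail for a channel whose output does not depend on its input. *)

theory Defs
  imports "HOL-Probability.Probability"
begin

text \<open>Points of R^n (resp. Y^n) are functions on indices {..<n}, extensional (PiE).\<close>

definition Xsp :: "nat \<Rightarrow> (nat \<Rightarrow> real) measure" where
  "Xsp n = PiM {..<n} (\<lambda>_. borel)"

definition Ysp :: "'b measure \<Rightarrow> nat \<Rightarrow> (nat \<Rightarrow> 'b) measure" where
  "Ysp MY n = PiM {..<n} (\<lambda>_. MY)"

definition general_channel ::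
  "'b measure \<Rightarrow> (nat \<Rightarrow> (nat \<Rightarrow> real) \<Rightarrow> (nat \<Rightarrow> 'b) measure) \<Rightarrow> bool" where
  "general_channel MY W \<longleftrightarrow> (\<forall>n>0. W n \<in> Xsp n \<rightarrow>\<^sub>M prob_algebra (Ysp MY n))"

definition XG :: "(nat \<Rightarrow> (nat \<Rightarrow> real) \<Rightarrow> real) \<Rightarrow> real \<Rightarrow> nat \<Rightarrow> (nat \<Rightarrow> real) set" where
  "XG c \<Gamma> n = {x \<in> space (Xsp n). c n x / real n \<le> \<Gamma>}"

text \<open>Input processes (given by their distributions P n = P_{X^n}) in S_Gamma.\<close>
definition S_Gamma :: "(nat \<Rightarrow> (nat \<Rightarrow> real) \<Rightarrow> real) \<Rightarrow> real \<Rightarrow> (nat \<Rightarrow> (nat \<Rightarrow> real) measure) set" where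
  "S_Gamma c \<Gamma> = {P. \<forall>n>0. P n \<in> space (prob_algebra (Xsp n)) \<and> (AE x in P n. x \<in> XG c \<Gamma> n)}"

definition out_dist :: "(nat \<Rightarrow> (nat \<Rightarrow> real) \<Rightarrow> (nat \<Rightarrow> 'b) measure) \<Rightarrow> (nat \<Rightarrow> (nat \<Rightarrow> real) measure)
    \<Rightarrow> nat \<Rightarrow> (nat \<Rightarrow> 'b) measure" where
  "out_dist W P n = P n \<bind> W n"

definition joint :: "'b measure \<Rightarrow> (nat \<Rightarrow> (nat \<Rightarrow> real) \<Rightarrow> (nat \<Rightarrow> 'b) measure) \<Rightarrow> (nat \<Rightarrow> (nat \<Rightarrow> real) measure)
    \<Rightarrow> nat \<Rightarrow> ((nat \<Rightarrow> real) \<times> (nat \<Rightarrow> 'b)) measure" where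
  "joint MY W P n = P n \<bind> (\<lambda>x. distr (W n x) (Xsp n \<Otimes>\<^sub>M Ysp MY n) (\<lambda>y. (x, y)))"

definition idens :: "'b measure \<Rightarrow> (nat \<Rightarrow> (nat \<Rightarrow> real) \<Rightarrow> (nat \<Rightarrow> 'b) measure) \<Rightarrow> (nat \<Rightarrow> (nat \<Rightarrow> real) measure)
    \<Rightarrow> nat \<Rightarrow> (nat \<Rightarrow> real) \<times> (nat \<Rightarrow> 'b) \<Rightarrow> real" where
  "idens MY W P n z =
     ln (enn2real (RN_deriv (P n \<Otimes>\<^sub>M out_dist W P n) (joint MY W P n) z)) / real n"

definition p_liminf :: "(nat \<Rightarrow> 'a measure) \<Rightarrow> (nat \<Rightarrow> 'a \<Rightarrow> real) \<Rightarrow> ereal" where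
  "p_liminf M Z = Sup (ereal ` {\<alpha>. (\<lambda>n. measure (M n) {z \<in> space (M n). Z n z < \<alpha>}) \<longlonglongrightarrow> 0})"

definition p_limsup :: "(nat \<Rightarrow> 'a measure) \<Rightarrow> (nat \<Rightarrow> 'a \<Rightarrow> real) \<Rightarrow> ereal" where
  "p_limsup M Z = Inf (ereal ` {\<beta>. (\<lambda>n. measure (M n) {z \<in> space (M n). Z n z > \<beta>}) \<longlonglongrightarrow> 0})"

definition I_under where "I_under MY W P = p_liminf (joint MY W P) (idens MY W P)"
definition I_over where "I_over MY W P = p_limsup (joint MY W P) (idens MY W P)"

definition tcode :: "'b measure \<Rightarrow> (nat \<Rightarrow> (nat \<Rightarrow> real) \<Rightarrow> real) \<Rightarrow> real \<Rightarrow> nat \<Rightarrow> nat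
    \<Rightarrow> (nat \<Rightarrow> nat \<Rightarrow> real) \<Rightarrow> ((nat \<Rightarrow> 'b) \<Rightarrow> nat) \<Rightarrow> bool" where
  "tcode MY c \<Gamma> n M enc dec \<longleftrightarrow> M \<ge> 1 \<and> (\<forall>i\<in>{1..M}. enc i \<in> XG c \<Gamma> n)
     \<and> (\<forall>y\<in>space (Ysp MY n). dec y \<in> {1..M})
     \<and> (\<forall>i\<in>{1..M}. {y \<in> space (Ysp MY n). dec y = i} \<in> sets (Ysp MY n))"

definition terr :: "'b measure \<Rightarrow> (nat \<Rightarrow> (nat \<Rightarrow> real) \<Rightarrow> (nat \<Rightarrow> 'b) measure) \<Rightarrow> nat \<Rightarrow> nat
    \<Rightarrow> (nat \<Rightarrow> nat \<Rightarrow> real) \<Rightarrow> ((nat \<Rightarrow> 'b) \<Rightarrow> nat) \<Rightarrow> real" where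
  "terr MY W n M enc dec =
     (\<Sum>i=1..M. measure (W n (enc i)) (space (Ysp MY n) - {y \<in> space (Ysp MY n). dec y = i})) / real M"

definition t_achievable where
  "t_achievable MY W c \<Gamma> \<epsilon> R \<longleftrightarrow>
     (\<exists>(M :: nat \<Rightarrow> nat) enc dec.
        (\<forall>n>0. tcode MY c \<Gamma> n (M n) (enc n) (dec n))
      \<and> limsup (\<lambda>n. ereal (terr MY W n (M n) (enc n) (dec n))) \<le> ereal \<epsilon>
      \<and> liminf (\<lambda>n. ereal (ln (real (M n)) / real n)) \<ge> ereal R)"

definition C_s where
  "C_s MY W c \<Gamma> \<epsilon> = Sup (ereal ` {R. t_achievable MY W c \<Gamma> \<epsilon> R})"

definition idcode :: "'b measure \<Rightarrow> (nat \<Rightarrow> (nat \<Rightarrow> real) \<Rightarrow> real) \<Rightarrow> real \<Rightarrow> nat \<Rightarrow> nat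
    \<Rightarrow> (nat \<Rightarrow> (nat \<Rightarrow> real) measure) \<Rightarrow> (nat \<Rightarrow> (nat \<Rightarrow> 'b) set) \<Rightarrow> bool" where
  "idcode MY c \<Gamma> n N Q D \<longleftrightarrow> N \<ge> 1 \<and>
     (\<forall>i\<in>{1..N}. Q i \<in> space (prob_algebra (Xsp n)) \<and> (AE x in Q i. x \<in> XG c \<Gamma> n)
                  \<and> D i \<in> sets (Ysp MY n))"

definition id_mu where
  "id_mu MY W n N Q D = Max ((\<lambda>i. measure (Q i \<bind> W n) (space (Ysp MY n) - D i)) ` {1..N})"

definition id_lam where
  "id_lam W n N Q D = Max ({0} \<union> {measure (Q j \<bind> W n) (D i) | i j. i \<in> {1..N} \<and> j \<in> {1..N} \<and> i \<noteq> j})"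

definition id_achievable where
  "id_achievable MY W c \<Gamma> \<mu> lam R \<longleftrightarrow>
     (\<exists>(N :: nat \<Rightarrow> nat) Q D.
        (\<forall>n>0. idcode MY c \<Gamma> n (N n) (Q n) (D n))
      \<and> limsup (\<lambda>n. ereal (id_mu MY W n (N n) (Q n) (D n))) \<le> ereal \<mu>
      \<and> limsup (\<lambda>n. ereal (id_lam W n (N n) (Q n) (D n))) \<le> ereal lam
      \<and> liminf (\<lambda>n. ereal (ln (ln (real (N n))) / real n)) \<ge> ereal R)"

definition D_id where
  "D_id MY W c \<Gamma> \<mu> lam = Sup (ereal ` {R. id_achievable MY W c \<Gamma> \<mu> lam R})"

definition vdist :: "'a measure \<Rightarrow> 'a measure \<Rightarrow> real" where
  "vdist P P' = 2 * (SUP B\<in>sets P. \<bar>measure P B - measure P' B\<bar>)"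

definition res_output where
  "res_output W n M \<phi> = uniform_count_measure {1..M} \<bind> (\<lambda>i. W n (\<phi> i))"

definition r_achievable_for where
  "r_achievable_for W c \<Gamma> \<delta> P R \<longleftrightarrow>
     (\<exists>(M :: nat \<Rightarrow> nat) \<phi>.
        (\<forall>n>0. M n \<ge> 1 \<and> (\<forall>i\<in>{1..M n}. \<phi> n i \<in> XG c \<Gamma> n))
      \<and> limsup (\<lambda>n. ereal (vdist (out_dist W P n) (res_output W n (M n) (\<phi> n)))) \<le> ereal \<delta>
      \<and> limsup (\<lambda>n. ereal (ln (real (M n)) / real n)) \<le> ereal R)"

definition S_res where
  "S_res W c \<Gamma> \<delta> = Inf (ereal ` {R. \<forall>P\<in>S_Gamma c \<Gamma>. r_achievable_for W c \<Gamma> \<delta> P R})"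

definition Rn :: "nat \<Rightarrow> (nat \<Rightarrow> real) set" where "Rn n = space (Xsp n)"

definition vadd :: "nat \<Rightarrow> (nat \<Rightarrow> real) \<Rightarrow> (nat \<Rightarrow> real) \<Rightarrow> (nat \<Rightarrow> real)" where
  "vadd n x h = (\<lambda>i. if i < n then x i + h i else undefined)"

definition enorm :: "nat \<Rightarrow> (nat \<Rightarrow> real) \<Rightarrow> real" where
  "enorm n h = sqrt (\<Sum>i<n. (h i)\<^sup>2)"

definition has_grad :: "nat \<Rightarrow> ((nat \<Rightarrow> real) \<Rightarrow> real) \<Rightarrow> (nat \<Rightarrow> real) \<Rightarrow> (nat \<Rightarrow> real) \<Rightarrow> bool" where
  "has_grad n g G x \<longleftrightarrow> (\<forall>e>0. \<exists>d>0. \<forall>h\<in>Rn n. 0 < enorm n h \<and> enorm n h < d \<longrightarrow>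
       \<bar>g (vadd n x h) - g x - (\<Sum>i<n. G i * h i)\<bar> \<le> e * enorm n h)"

definition has_hessian :: "nat \<Rightarrow> ((nat \<Rightarrow> real) \<Rightarrow> real) \<Rightarrow> ((nat \<Rightarrow> real) \<Rightarrow> nat \<Rightarrow> nat \<Rightarrow> real) \<Rightarrow> bool" where
  "has_hessian n g H \<longleftrightarrow> (\<exists>G. (\<forall>v\<in>Rn n. has_grad n g (G v) v)
      \<and> (\<forall>v\<in>Rn n. \<forall>i<n. has_grad n (\<lambda>w. G w i) (H v i) v))"

definition KLdiv :: "'a measure \<Rightarrow> 'a measure \<Rightarrow> ereal" where
  "KLdiv P Q = (if absolutely_continuous Q P \<and> integrable P (\<lambda>y. ln (enn2real (RN_deriv Q P y)))
      then ereal (\<integral>y. ln (enn2real (RN_deriv Q P y)) \<partial>P) else \<infinity>)"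

definition mnorm :: "nat \<Rightarrow> (nat \<Rightarrow> nat \<Rightarrow> real) \<Rightarrow> real" where
  "mnorm n F = Sup {(\<Sum>i<n. \<Sum>j<n. v i * F i j * v j) / (\<Sum>i<n. (v i)\<^sup>2) | v. v \<in> Rn n \<and> (\<exists>i<n. v i \<noteq> 0)}"

text \<open>max 1 (log s), with log s = -infinity for s <= 0 (s is a sup of norms of PSD Hessians).\<close>
definition log_term :: "real \<Rightarrow> real" where
  "log_term s = (if s \<le> 0 then 1 else max 1 (ln s))"

definition cube :: "nat \<Rightarrow> (nat \<Rightarrow> real) \<Rightarrow> real \<Rightarrow> (nat \<Rightarrow> real) set" where
  "cube n a l = {x \<in> Rn n. \<forall>i<n. a i \<le> x i \<and> x i \<le> a i + l}"

definition A1_A2 ::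
  "(nat \<Rightarrow> (nat \<Rightarrow> real) \<Rightarrow> (nat \<Rightarrow> 'b) measure) \<Rightarrow> (nat \<Rightarrow> (nat \<Rightarrow> real) \<Rightarrow> real) \<Rightarrow> real \<Rightarrow> bool" where
  "A1_A2 W c \<Gamma> \<longleftrightarrow> (\<exists>(a :: nat \<Rightarrow> nat \<Rightarrow> real) (l :: nat \<Rightarrow> real) H.
      \<comment> \<open>(A1)\<close>
      (\<forall>n>0. l n \<ge> 2 \<and> XG c \<Gamma> n \<subseteq> cube n (a n) (l n))
    \<and> limsup (\<lambda>n. ereal (ln (ln (l n)) / real n)) = 0
      \<comment> \<open>(A2): v |-> D(W^n(.|v) || W^n(.|x)) finite and twice differentiable, Hessian H n x\<close>
    \<and> (\<forall>n>0. \<forall>x\<in>cube n (a n) (l n).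
          (\<forall>v\<in>Rn n. KLdiv (W n v) (W n x) < \<infinity>)
        \<and> has_hessian n (\<lambda>v. real_of_ereal (KLdiv (W n v) (W n x))) (H n x))
    \<and> (\<forall>\<^sub>F n in sequentially. bdd_above ((\<lambda>x. mnorm n (H n x x)) ` cube n (a n) (l n)))
    \<and> limsup (\<lambda>n. ereal (ln (log_term (Sup ((\<lambda>x. mnorm n (H n x x)) ` cube n (a n) (l n)))) / real n)) = 0)"

end

theory Submission
  imports Defs "HOL-Real_Asymp.Real_Asymp"
begin

text \<open>
  Since the relative entropy vanishes to second order on the diagonal, its Hessian there controls
  the total variation distance of the outputs at nearby inputs, first locally and then, chaining
  along segments, on the whole cube. Hence a grid whose cardinality is doubly exponential with
  arbitrarily small exponent quantizes the inputs up to a small error in the output distributions.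

  The first inequality is Feinstein's lemma. For the second, the messages of an identification code
  are the graphs of functions which pairwise agree rarely, drawn among the good codewords of a
  transmission code. For the third, approximate the output of each message by a uniformly weighted
  list of inputs and quantize the list: if there are more messages than quantized lists, two messages
  have close outputs, contradicting identifiability. For the fourth, replace the channel by its
  averages over the cells of the quantizer, cut off the densities, and choose codewords one by one
  so that the squared distance from the output density stays below average.
\<close>

subsection \<open>Relative entropy and total variation\<close>

text \<open>The converse for identification is a counting argument, which an uncountable input
  alphabet would defeat. What saves it is the scale: lists of M labels from a set T number |T|^M, so
  ln ln of their number is about ln M + ln ln |T|, and ln |T| may itself grow like exp(\<gamma> n)
  for every \<gamma> > 0. This is the room left by the double logarithms in \<open>A1_A2\<close>.
  The Hessian bounds relative entropy only near its reference point, and relative entropy obeys no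
  triangle inequality; hence it is turned into total variation locally, by a Pinsker bound, before
  chaining. Its finiteness has a second use: it makes output distributions absolutely continuous, so
  that the information density is a true density of the joint distribution. Two features shape the
  details. The cost function is arbitrary, so \<open>XG c \<Gamma> n\<close> need not be measurable
  and enters through almost-everywhere statements. And \<open>ln 0 = 0\<close>, so that points of
  vanishing density, single-message codes and nonpositive rates need attention.\<close>

lemma KLdiv_finiteD:
  assumes "KLdiv P Q < \<infinity>"
  shows "absolutely_continuous Q P"
    "integrable P (\<lambda>y. ln (enn2real (RN_deriv Q P y)))"
    "KLdiv P Q = ereal (\<integral>y. ln (enn2real (RN_deriv Q P y)) \<partial>P)"
  using assms by (auto simp: KLdiv_def split: if_splits)

lemma KLdiv_self:
  assumes "prob_space Q"
  shows "KLdiv Q Q = 0"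
proof -
  interpret prob_space Q by fact
  have 1: "absolutely_continuous Q Q" by (simp add: absolutely_continuous_def)
  have "AE y in Q. 1 = RN_deriv Q Q y"
    by (rule RN_deriv_unique) (auto simp: density_1)
  hence 2: "AE y in Q. ln (enn2real (RN_deriv Q Q y)) = 0"
    by (rule AE_mp) (auto intro!: AE_I2 dest!: sym)
  have "(\<integral>y. ln (enn2real (RN_deriv Q Q y)) \<partial>Q) = (\<integral>y. 0 \<partial>Q)"
    by (rule integral_cong_AE) (use 2 in auto)
  moreover have "integrable Q (\<lambda>y. ln (enn2real (RN_deriv Q Q y)))"
    by (subst integrable_cong_AE[where g = "\<lambda>_. 0"]) (use 2 in auto)
  ultimately show ?thesis using 1 by (simp add: KLdiv_def zero_ereal_def)
qed

text \<open>The Fenchel-Young inequality for f ln f - f, whose convex conjugate is exp: it is ln u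
  \<le> u - 1 at u = exp a / f. The case f = 0 fits because \<open>0 * ln 0 = 0\<close>.\<close>

lemma young_log:
  fixes a f :: real
  assumes "f \<ge> 0"
  shows "f * a - f * ln f \<le> exp a - f"
proof (cases "f = 0")
  case False
  hence f: "f > 0" using assms by simp
  have "ln (exp a / f) \<le> exp a / f - 1"
    by (rule ln_le_minus_one) (use f in simp)
  hence "f * (a - ln f) \<le> f * (exp a / f - 1)"
    using f by (intro mult_left_mono) (auto simp: ln_div)
  thus ?thesis using f by (simp add: algebra_simps)
qed simp

text \<open>A Donsker-Varadhan type bound tested on t times the indicator of B: integrate
  \<open>young_log\<close> over Q with f the density of P. The conjugate term is explicit because
  exp(t 1_B) = 1 + (exp t - 1) 1_B.\<close>

lemma KLdiv_variational:
  assumes "prob_space P" "prob_space Q" "sets P = sets Q" "B \<in> sets Q"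
    and fin: "KLdiv P Q < \<infinity>"
  shows "t * measure P B \<le> real_of_ereal (KLdiv P Q) + (exp t - 1) * measure Q B"
proof -
  interpret P: prob_space P by fact
  interpret Q: prob_space Q by fact
  define f where "f = (\<lambda>y. enn2real (RN_deriv Q P y))"
  have KL: "absolutely_continuous Q P" "integrable P (\<lambda>y. ln (f y))"
    "KLdiv P Q = ereal (\<integral>y. ln (f y) \<partial>P)"
    using KLdiv_finiteD[OF fin] by (simp_all add: f_def)
  have fm[measurable]: "f \<in> borel_measurable Q" by (simp add: f_def)
  have f0: "f y \<ge> 0" for y by (simp add: f_def)
  \<comment> \<open>\<open>KLdiv\<close> sees the density through \<open>enn2real\<close>, which
    sends infinity to 0; almost-everywhere finiteness makes the real-valued f a density of P as
    well.\<close>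
  have "AE y in Q. RN_deriv Q P y \<noteq> \<infinity>"
    by (rule Q.RN_deriv_finite) (use KL assms in \<open>auto intro: P.sigma_finite_measure_axioms\<close>)
  hence "AE y in Q. RN_deriv Q P y = ennreal (f y)"
    by (rule AE_mp) (auto intro!: AE_I2 simp: f_def less_top)
  hence "density Q (RN_deriv Q P) = density Q (\<lambda>y. ennreal (f y))"
    by (intro density_cong) auto
  moreover have "density Q (RN_deriv Q P) = P"
    by (rule Q.density_RN_deriv) (use KL assms in auto)
  ultimately have P: "P = density Q (\<lambda>y. ennreal (f y))" by simp
  have [measurable]: "B \<in> sets Q" by fact
  let ?a = "\<lambda>y. t * indicator B y :: real"
  have intf: "integrable Q (\<lambda>y. f y * g y)" and eqf: "(\<integral>y. g y \<partial>P) = (\<integral>y. f y * g y \<partial>Q)"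
    if "integrable P g" "g \<in> borel_measurable Q" for g :: "_ \<Rightarrow> real"
    using that f0 integrable_real_density[of f Q g] integral_real_density[of f Q g]
    by (auto simp flip: P)
  have lm: "(\<lambda>y. ln (f y)) \<in> borel_measurable Q" by measurable
  have i1: "integrable P ?a" 
    using assms by (intro P.integrable_const_bound[where B="\<bar>t\<bar>"]) (auto simp: indicator_def)
  have j1: "integrable Q (\<lambda>y. f y * ?a y)" "(\<integral>y. ?a y \<partial>P) = (\<integral>y. f y * ?a y \<partial>Q)"
    using intf[OF i1] eqf[OF i1] by auto
  have j2: "integrable Q (\<lambda>y. f y * ln (f y))" "(\<integral>y. ln (f y) \<partial>P) = (\<integral>y. f y * ln (f y) \<partial>Q)"
    using intf[OF KL(2) lm] eqf[OF KL(2) lm] by auto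
  have j3: "integrable Q (\<lambda>y. f y * 1)" "(\<integral>y. 1 \<partial>P) = (\<integral>y. f y * 1 \<partial>Q)"
    using intf[of "\<lambda>_. 1"] eqf[of "\<lambda>_. 1"] by auto
  have j4: "integrable Q (\<lambda>y. exp (?a y))"
    by (intro Q.integrable_const_bound[where B="exp \<bar>t\<bar>"]) (auto simp: indicator_def)
  have e: "exp (?a y) = 1 + (exp t - 1) * indicator B y" for y by (auto simp: indicator_def)
  have "(\<integral>y. ?a y \<partial>P) = t * measure P B" using assms(3,4) by simp
  hence "t * measure P B - (\<integral>y. ln (f y) \<partial>P) = (\<integral>y. f y * ?a y \<partial>Q) - (\<integral>y. f y * ln (f y) \<partial>Q)"
    unfolding j1(2) j2(2) by linarith
  also have "\<dots> = (\<integral>y. f y * ?a y - f y * ln (f y) \<partial>Q)"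
    by (subst Bochner_Integration.integral_diff) (use j1 j2 in auto)
  also have "\<dots> \<le> (\<integral>y. exp (?a y) - f y * 1 \<partial>Q)"
    by (intro integral_mono Bochner_Integration.integrable_diff j1 j2 j3 j4)
       (use young_log[OF f0] in auto)
  also have "\<dots> = (\<integral>y. exp (?a y) \<partial>Q) - (\<integral>y. 1 \<partial>P)"
    by (subst Bochner_Integration.integral_diff) (use j3 j4 in auto)
  also have "(\<integral>y. exp (?a y) \<partial>Q) = 1 + (exp t - 1) * measure Q B"
  proof -
    have "integrable Q (indicat_real B)" using assms(4) by (simp add: integrable_indicator_iff Q.emeasure_eq_measure)
    thus ?thesis unfolding e using assms(4) by (simp add: Q.prob_space)
  qed
  finally show ?thesis using KL(3) by (simp add: P.prob_space)
qed

lemma KLdiv_nonneg: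
  assumes "prob_space P" "prob_space Q" "sets P = sets Q" "KLdiv P Q < \<infinity>"
  shows "0 \<le> real_of_ereal (KLdiv P Q)"
  using KLdiv_variational[OF assms(1-3) sets.empty_sets assms(4), of 0] by simp

text \<open>Pinsker's inequality up to a constant. With t = s in the variational bound, the
  divergence s^2 and the remainder exp s - 1 - s \<le> s^2 balance, and division by s leaves 2 s.
  The remainder estimate is where s \<le> 1 enters.\<close>

lemma KLdiv_imp_prob_diff_le:
  assumes "prob_space P" "prob_space Q" "sets P = sets Q" "B \<in> sets Q"
    and fin: "KLdiv P Q < \<infinity>" and s: "0 < s" "s \<le> 1" "real_of_ereal (KLdiv P Q) \<le> s\<^sup>2"
  shows "\<bar>measure P B - measure Q B\<bar> \<le> 2 * s"
proof -
  interpret P: prob_space P by fact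
  interpret Q: prob_space Q by fact
  have *: "measure P A - measure Q A \<le> 2 * s" if A: "A \<in> sets Q" for A
  proof -
    have "exp s - 1 - s \<le> s\<^sup>2" using exp_bound[of s] s by simp
    hence "(exp s - 1 - s) * measure Q A \<le> s\<^sup>2 * 1"
      using exp_ge_add_one_self[of s] by (intro mult_mono) auto
    with KLdiv_variational[OF assms(1-3) A fin, of s] s(3)
    have "s * (measure P A - measure Q A) \<le> s * (2 * s)"
      by (simp add: algebra_simps power2_eq_square)
    thus ?thesis using s by simp
  qed
  have c: "space Q - B \<in> sets Q" using assms(4) by auto
  have "measure P (space Q - B) = 1 - measure P B"
    using P.prob_compl[of B] assms(3,4) sets_eq_imp_space_eq[OF assms(3)] by simp
  moreover have "measure Q (space Q - B) = 1 - measure Q B"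
    using Q.prob_compl[of B] assms(4) by simp
  ultimately show ?thesis using *[OF assms(4)] *[OF c] by linarith
qed

subsection \<open>Second-order expansion on the diagonal\<close>

text \<open>Extensional outside \<open>{..<n}\<close>, so the point stays in \<open>Rn n\<close> for
  an arbitrary displacement h; parameter 1 plays the role of \<open>vadd\<close>.\<close>

definition vline :: "nat \<Rightarrow> (nat \<Rightarrow> real) \<Rightarrow> (nat \<Rightarrow> real) \<Rightarrow> real \<Rightarrow> nat \<Rightarrow> real" where
  "vline n x h t = (\<lambda>i. if i < n then x i + t * h i else undefined)"

lemma Rn_iff: "x \<in> Rn n \<longleftrightarrow> (\<forall>i. i \<ge> n \<longrightarrow> x i = undefined)"
  by (auto simp: Rn_def Xsp_def space_PiM PiE_def extensional_def)

lemma vline_in_Rn [simp]: "vline n x h t \<in> Rn n"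
  by (simp add: vline_def Rn_iff)

lemma vline_0: "x \<in> Rn n \<Longrightarrow> vline n x h 0 = x"
  by (auto simp: vline_def Rn_iff)

lemma enorm_nonneg [simp]: "enorm n h \<ge> 0"
  by (simp add: enorm_def sum_nonneg)

lemma enorm_sq: "(enorm n h)\<^sup>2 = (\<Sum>i<n. (h i)\<^sup>2)"
  by (simp add: enorm_def sum_nonneg)

lemma enorm_scale:
  assumes "\<And>i. i < n \<Longrightarrow> k i = t * h i"
  shows "enorm n k = \<bar>t\<bar> * enorm n h"
proof -
  have "(\<Sum>i<n. (k i)\<^sup>2) = t\<^sup>2 * (\<Sum>i<n. (h i)\<^sup>2)"
    using assms by (simp add: sum_distrib_left power_mult_distrib)
  thus ?thesis by (simp add: enorm_def real_sqrt_mult)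
qed

lemma abs_le_enorm: "i < n \<Longrightarrow> \<bar>h i\<bar> \<le> enorm n h"
  unfolding enorm_def
  by (rule real_le_rsqrt) (auto intro!: member_le_sum[where f = "\<lambda>i. (h i)\<^sup>2"])

lemma enorm_eq_0: "enorm n h = 0 \<Longrightarrow> i < n \<Longrightarrow> h i = 0"
  using abs_le_enorm[of i n h] by simp

lemma has_gradD:
  assumes "has_grad n g G v" "v \<in> Rn n" "e > 0"
  shows "\<exists>d>0. \<forall>h. enorm n h < d \<longrightarrow>
     \<bar>g (vline n v h 1) - g v - (\<Sum>i<n. G i * h i)\<bar> \<le> e * enorm n h"
proof -
  from assms(1,3) obtain d where d: "d > 0" 
    "\<And>h. h\<in>Rn n \<Longrightarrow> 0 < enorm n h \<Longrightarrow> enorm n h < d \<Longrightarrow>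
       \<bar>g (vadd n v h) - g v - (\<Sum>i<n. G i * h i)\<bar> \<le> e * enorm n h"
    unfolding has_grad_def by blast
  have "\<bar>g (vline n v h 1) - g v - (\<Sum>i<n. G i * h i)\<bar> \<le> e * enorm n h" if "enorm n h < d" for h
  proof (cases "enorm n h = 0")
    case True
    hence h: "h i = 0" if "i < n" for i using enorm_eq_0 that by blast
    hence "vline n v h 1 = v" using assms(2) by (auto simp: vline_def Rn_iff)
    thus ?thesis using h True by simp
  next
    case False
    \<comment> \<open>The line with zero direction at parameter 0 is just h cut off outside the
      index set: an element of \<open>Rn n\<close> with the same norm and the same inner
      products.\<close>
    let ?h = "vline n h (\<lambda>_. 0) 0"
    have [simp]: "vadd n v ?h = vline n v h 1" "enorm n ?h = enorm n h"
      "(\<Sum>i<n. G i * ?h i) = (\<Sum>i<n. G i * h i)"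
      by (auto simp: vadd_def vline_def enorm_def)
    show ?thesis using d(2)[of ?h] False that by (simp add: order.not_eq_order_implies_strict)
  qed
  thus ?thesis using d(1) by blast
qed

lemma has_grad_deriv_vline:
  assumes "has_grad n g G (vline n x h t)"
  shows "((\<lambda>s. g (vline n x h s)) has_real_derivative (\<Sum>i<n. G i * h i)) (at t)"
  unfolding has_field_derivative_def has_derivative_at_alt
proof (intro conjI allI impI)
  fix e :: real assume e: "e > 0"
  \<comment> \<open>The added 1 keeps the quotient positive and well defined when the direction h is
    zero.\<close>
  define e' where "e' = e / (enorm n h + 1)"
  have e': "e' > 0" using e by (simp add: e'_def add_nonneg_pos)
  from has_gradD[OF assms vline_in_Rn e'] obtain d where d: "d > 0"
    "\<And>k. enorm n k < d \<Longrightarrow> \<bar>g (vline n (vline n x h t) k 1) - g (vline n x h t) - (\<Sum>i<n. G i * k i)\<bar> \<le> e' * enorm n k"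
    by blast
  define d' where "d' = d / (enorm n h + 1)"
  have d': "d' > 0" using d by (simp add: d'_def add_nonneg_pos)
  have "norm (g (vline n x h y) - g (vline n x h t) - (\<Sum>i<n. G i * h i) * (y - t)) \<le> e * norm (y - t)"
    if y: "norm (y - t) < d'" for y
  proof -
    define k where "k = (\<lambda>i. (y - t) * h i)"
    have k: "enorm n k = \<bar>y - t\<bar> * enorm n h" by (rule enorm_scale) (simp add: k_def)
    have "\<bar>y - t\<bar> * enorm n h \<le> \<bar>y - t\<bar> * (enorm n h + 1)" by (intro mult_left_mono) auto
    also have "\<dots> < d" using y by (simp add: d'_def pos_less_divide_eq add_nonneg_pos)
    finally have kd: "enorm n k < d" by (simp add: k)
    have [simp]: "vline n (vline n x h t) k 1 = vline n x h y"
      by (auto simp: vline_def k_def algebra_simps)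
    have [simp]: "(\<Sum>i<n. G i * k i) = (\<Sum>i<n. G i * h i) * (y - t)"
      by (simp add: k_def sum_distrib_left mult_ac)
    have "e' * enorm n k \<le> e * \<bar>y - t\<bar>"
    proof -
      have "e' * enorm n h \<le> e" using e
        by (simp add: e'_def divide_le_eq add_nonneg_pos mult_left_mono)
      hence "e' * enorm n h * \<bar>y - t\<bar> \<le> e * \<bar>y - t\<bar>" by (rule mult_right_mono) auto
      thus ?thesis by (simp add: k mult_ac)
    qed
    thus ?thesis using d(2)[OF kd] by simp
  qed
  thus "\<exists>d>0. \<forall>y. norm (y - t) < d \<longrightarrow>
     norm (g (vline n x h y) - g (vline n x h t) - (\<Sum>i<n. G i * h i) * (y - t)) \<le> e * norm (y - t)"
    using d' by blast
qed (auto intro: bounded_linear_mult_right)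

text \<open>Along the line in the direction of the gradient itself the derivative is the squared
  length of the gradient; at a minimum it vanishes.\<close>

lemma has_grad_min_zero:
  assumes "has_grad n g G x" "x \<in> Rn n" "\<And>v. v \<in> Rn n \<Longrightarrow> g x \<le> g v" "i < n"
  shows "G i = 0"
proof -
  have "((\<lambda>s. g (vline n x G s)) has_real_derivative (\<Sum>i<n. G i * G i)) (at 0)"
    by (rule has_grad_deriv_vline) (use assms in \<open>simp add: vline_0\<close>)
  hence "(\<Sum>i<n. G i * G i) = 0"
    by (rule DERIV_local_min[where d = 1]) (use assms in \<open>auto simp: vline_0\<close>)
  thus ?thesis using assms(4) by (simp add: sum_nonneg_eq_0_iff)
qed

lemma quadratic_form_le_mnorm:
  assumes "n > 0" "mnorm n F \<le> K"
  shows "(\<Sum>i<n. \<Sum>j<n. h i * F i j * h j) \<le> K * (enorm n h)\<^sup>2"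
proof (cases "\<forall>i<n. h i = 0")
  case True thus ?thesis by (simp add: enorm_sq)
next
  case False
  let ?S = "{(\<Sum>i<n. \<Sum>j<n. v i * F i j * v j) / (\<Sum>i<n. (v i)\<^sup>2) | v. v \<in> Rn n \<and> (\<exists>i<n. v i \<noteq> 0)}"
  have pos: "(\<Sum>i<n. (v i)\<^sup>2) > 0" if "\<exists>i<n. v i \<noteq> 0" for v :: "nat \<Rightarrow> real"
    using that by (auto intro!: sum_pos2)
  \<comment> \<open>A real \<open>Sup\<close> is an upper bound only of a bounded set; the sum of
    the absolute values of the entries of F bounds all Rayleigh quotients.\<close>
  have "bdd_above ?S"
  proof (rule bdd_aboveI)
    fix r assume "r \<in> ?S"
    then obtain v where v: "r = (\<Sum>i<n. \<Sum>j<n. v i * F i j * v j) / (\<Sum>i<n. (v i)\<^sup>2)" "\<exists>i<n. v i \<noteq> 0" by auto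
    have "(\<Sum>i<n. \<Sum>j<n. v i * F i j * v j) \<le> (\<Sum>i<n. \<Sum>j<n. \<bar>F i j\<bar> * (enorm n v)\<^sup>2)"
    proof (intro sum_mono)
      fix i j assume "i \<in> {..<n}" "j \<in> {..<n}"
      hence "\<bar>v i\<bar> * \<bar>v j\<bar> \<le> enorm n v * enorm n v"
        by (intro mult_mono) (auto intro: abs_le_enorm)
      hence "\<bar>F i j\<bar> * (\<bar>v i\<bar> * \<bar>v j\<bar>) \<le> \<bar>F i j\<bar> * (enorm n v * enorm n v)"
        by (rule mult_left_mono) auto
      moreover have "v i * F i j * v j \<le> \<bar>v i * F i j * v j\<bar>" by simp
      ultimately show "v i * F i j * v j \<le> \<bar>F i j\<bar> * (enorm n v)\<^sup>2"
        by (simp add: abs_mult power2_eq_square mult_ac)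
    qed
    also have "\<dots> = (\<Sum>i<n. \<Sum>j<n. \<bar>F i j\<bar>) * (\<Sum>i<n. (v i)\<^sup>2)"
      by (simp add: enorm_sq sum_distrib_right)
    finally show "r \<le> (\<Sum>i<n. \<Sum>j<n. \<bar>F i j\<bar>)"
      using pos[OF v(2)] by (simp add: v(1) divide_le_eq)
  qed
  moreover have "(\<Sum>i<n. \<Sum>j<n. h i * F i j * h j) / (\<Sum>i<n. (h i)\<^sup>2) \<in> ?S"
    using False by (auto intro!: exI[of _ "vline n h (\<lambda>_. 0) 0"] simp: vline_def[of n h])
       (simp add: vline_def Rn_iff)
  ultimately have "(\<Sum>i<n. \<Sum>j<n. h i * F i j * h j) / (\<Sum>i<n. (h i)\<^sup>2) \<le> mnorm n F"
    unfolding mnorm_def by (intro cSup_upper)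
  also note assms(2)
  finally show ?thesis using pos[of h] False by (auto simp: enorm_sq divide_le_eq)
qed

text \<open>Where g vanishes it is minimal, so its gradient is zero there. The mean value theorem on
  the segment gives an intermediate gradient, and differentiability of the gradient at x turns this
  into the quadratic form of the Hessian at x plus an error.\<close>

lemma hessian_quadratic_bound:
  assumes n: "n > 0" and hess: "has_hessian n g (H :: (nat \<Rightarrow> real) \<Rightarrow> nat \<Rightarrow> nat \<Rightarrow> real)" and x: "x \<in> Rn n" and gx: "g x = 0"
    and g0: "\<And>v. v \<in> Rn n \<Longrightarrow> 0 \<le> g v"
    and K: "mnorm n (H x) \<le> K" "1 \<le> K"
  shows "\<exists>d>0. \<forall>h. enorm n h < d \<longrightarrow> g (vline n x h 1) \<le> 2 * K * (enorm n h)\<^sup>2"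
proof -
  from hess obtain G where G: "\<And>v. v \<in> Rn n \<Longrightarrow> has_grad n g (G v) v"
    "\<And>v i. v \<in> Rn n \<Longrightarrow> i < n \<Longrightarrow> has_grad n (\<lambda>w. G w i) (H v i) v"
    unfolding has_hessian_def by blast
  have Gx: "G x i = 0" if "i < n" for i
    using has_grad_min_zero[OF G(1)[OF x] x _ that] g0 gx by simp
  \<comment> \<open>Each of the n components of the gradient may err by K / n; in total they cost
    another K, hence the factor 2.\<close>
  define e where "e = K / n"
  have e: "e > 0" using K n by (simp add: e_def)
  have "\<forall>i\<in>{..<n}. \<exists>d>0. \<forall>h. enorm n h < d \<longrightarrow>
      \<bar>G (vline n x h 1) i - G x i - (\<Sum>j<n. H x i j * h j)\<bar> \<le> e * enorm n h"
    using has_gradD[OF G(2) x e] x by auto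
  then obtain D where D: "\<And>i. i < n \<Longrightarrow> D i > 0"
    "\<And>i h. i < n \<Longrightarrow> enorm n h < D i \<Longrightarrow>
      \<bar>G (vline n x h 1) i - G x i - (\<Sum>j<n. H x i j * h j)\<bar> \<le> e * enorm n h"
    unfolding bchoice_iff by auto
  define d where "d = Min (D ` {..<n})"
  have d: "d > 0" unfolding d_def using D(1) n by (subst Min_gr_iff) auto
  have dD: "d \<le> D i" if "i < n" for i using that by (auto simp: d_def)
  have "g (vline n x h 1) \<le> 2 * K * (enorm n h)\<^sup>2" if h: "enorm n h < d" for h
  proof -
    let ?f' = "\<lambda>t. \<Sum>i<n. G (vline n x h t) i * h i"
    have "\<exists>z>0. z < 1 \<and> g (vline n x h 1) - g (vline n x h 0) = (1 - 0) * ?f' z"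
      by (rule MVT2) (auto intro!: has_grad_deriv_vline G)
    then obtain z where z: "0 < z" "z < 1" "g (vline n x h 1) = ?f' z"
      using x gx by (auto simp: vline_0)
    define k where "k = (\<lambda>i. z * h i)"
    have k: "enorm n k = z * enorm n h" using enorm_scale[of n k z h] z by (simp add: k_def)
    also have "\<dots> \<le> enorm n h" using z by (simp add: mult_left_le_one_le)
    finally have kd: "enorm n k < d" using h by simp
    have vk: "vline n x k 1 = vline n x h z" by (auto simp: vline_def k_def)
    have "?f' z \<le> (\<Sum>i<n. z * (\<Sum>j<n. h i * H x i j * h j) + e * z * (enorm n h)\<^sup>2)"
    proof (rule sum_mono)
      fix i assume "i \<in> {..<n}"
      hence i: "i < n" by simp
      have "\<bar>G (vline n x h z) i - (\<Sum>j<n. H x i j * k j)\<bar> \<le> e * (z * enorm n h)"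
        using D(2)[OF i, of k] dD[OF i] kd Gx[OF i] by (simp add: vk k)
      hence "\<bar>(G (vline n x h z) i - (\<Sum>j<n. H x i j * k j)) * h i\<bar> \<le> e * (z * enorm n h) * enorm n h"
        unfolding abs_mult using e z abs_le_enorm[OF i, of h] by (intro mult_mono) auto
      hence "G (vline n x h z) i * h i \<le> (\<Sum>j<n. H x i j * k j) * h i + e * (z * enorm n h) * enorm n h"
        by (simp add: algebra_simps abs_le_iff)
      also have "(\<Sum>j<n. H x i j * k j) * h i = z * (\<Sum>j<n. h i * H x i j * h j)"
        by (simp add: k_def sum_distrib_right sum_distrib_left mult_ac)
      finally show "G (vline n x h z) i * h i \<le> z * (\<Sum>j<n. h i * H x i j * h j) + e * z * (enorm n h)\<^sup>2"
        by (simp add: power2_eq_square mult_ac)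
    qed
    also have "\<dots> = z * ((\<Sum>i<n. \<Sum>j<n. h i * H x i j * h j) + n * e * (enorm n h)\<^sup>2)"
      by (simp add: sum.distrib sum_distrib_left[symmetric] algebra_simps)
    also have "\<dots> \<le> z * (K * (enorm n h)\<^sup>2 + n * e * (enorm n h)\<^sup>2)"
      using z quadratic_form_le_mnorm[OF n K(1), of h] by (intro mult_left_mono) auto
    also have "\<dots> = z * (2 * K * (enorm n h)\<^sup>2)" using n by (simp add: e_def)
    also have "\<dots> \<le> 2 * K * (enorm n h)\<^sup>2" using z K by (intro mult_left_le_one_le) auto
    finally show ?thesis using z by simp
  qed
  thus ?thesis using d by blast
qed

subsection \<open>Lipschitz continuity of the channel\<close>

lemma channel_prob_space:
  assumes "general_channel MY W" "n > 0" "x \<in> Rn n"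
  shows "prob_space (W n x)" "sets (W n x) = sets (Ysp MY n)" "space (W n x) = space (Ysp MY n)"
proof -
  have "W n \<in> Xsp n \<rightarrow>\<^sub>M prob_algebra (Ysp MY n)"
    using assms by (simp add: general_channel_def)
  hence "W n x \<in> space (prob_algebra (Ysp MY n))"
    by (rule measurable_space) (use assms(3) in \<open>simp add: Rn_def\<close>)
  thus "prob_space (W n x)" "sets (W n x) = sets (Ysp MY n)" "space (W n x) = space (Ysp MY n)"
    using sets_eq_imp_space_eq[of "W n x" "Ysp MY n"] by (auto simp: space_prob_algebra)
qed

text \<open>The segment between two points is covered by finitely many of the neighbourhoods on which
  the local estimate holds, so the local Lipschitz constant is a global one.\<close>

lemma pointwise_lipschitz_imp_lipschitz:
  fixes f :: "real \<Rightarrow> real"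
  assumes "a \<le> b" "L \<ge> 0"
    and loc: "\<And>t. a \<le> t \<Longrightarrow> t \<le> b \<Longrightarrow> \<exists>d>0. \<forall>s. \<bar>s - t\<bar> < d \<longrightarrow> \<bar>f s - f t\<bar> \<le> L * \<bar>s - t\<bar>"
  shows "\<bar>f b - f a\<bar> \<le> L * (b - a)"
  using assms(1)
proof (induction rule: Bolzano)
  case (trans a b c)
  thus ?case by (simp add: right_diff_distrib)
next
  case (local t)
  then obtain d where d: "d > 0" "\<And>s. \<bar>s - t\<bar> < d \<Longrightarrow> \<bar>f s - f t\<bar> \<le> L * \<bar>s - t\<bar>"
    using loc by blast
  have "\<bar>f v - f u\<bar> \<le> L * (v - u)" if "u \<le> t" "t \<le> v" "v - u < d" for u v
    using d(2)[of u] d(2)[of v] that by (simp add: right_diff_distrib)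
  thus ?case using d(1) by blast
qed

lemma vline_in_cube:
  assumes "x \<in> cube n a l" "v \<in> cube n a l" "0 \<le> t" "t \<le> 1"
  shows "vline n x (\<lambda>i. v i - x i) t \<in> cube n a l"
proof -
  have "a i \<le> x i + t * (v i - x i) \<and> x i + t * (v i - x i) \<le> a i + l" if "i < n" for i
  proof -
    have b: "a i \<le> x i" "x i \<le> a i + l" "a i \<le> v i" "v i \<le> a i + l"
      using assms that by (auto simp: cube_def)
    have e: "x i + t * (v i - x i) = (1 - t) * x i + t * v i" by (simp add: algebra_simps)
    have "(1 - t) * a i + t * a i \<le> (1 - t) * x i + t * v i"
      using assms b by (intro add_mono mult_left_mono) auto
    moreover have "(1 - t) * x i + t * v i \<le> (1 - t) * (a i + l) + t * (a i + l)"
      using assms b by (intro add_mono mult_left_mono) auto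
    ultimately show ?thesis unfolding e by (simp add: algebra_simps)
  qed
  thus ?thesis by (simp add: cube_def) (simp add: vline_def)
qed

text \<open>A quadratic bound on the divergence becomes linear after Pinsker's square root. At each
  u of the segment the divergence is taken relative to \<open>W n u\<close>, with its own Hessian
  \<open>H u u\<close>; the radius of validity depends on u but the constant does not, and this is
  what chaining needs.\<close>

lemma channel_lipschitz:
  assumes ch: "general_channel MY W" and n: "n > 0"
    and KL: "\<And>x v. x \<in> cube n a l \<Longrightarrow> v \<in> Rn n \<Longrightarrow> KLdiv (W n v) (W n x) < \<infinity>"
    and hess: "\<And>x. x \<in> cube n a l \<Longrightarrow>
       has_hessian n (\<lambda>v. real_of_ereal (KLdiv (W n v) (W n x))) (H x)"
    and K: "\<And>x. x \<in> cube n a l \<Longrightarrow> mnorm n (H x x) \<le> K" "1 \<le> K"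
    and x: "x \<in> cube n a l" and v: "v \<in> cube n a l" and B: "B \<in> sets (Ysp MY n)"
  shows "\<bar>measure (W n x) B - measure (W n v) B\<bar> \<le> 2 * sqrt (2 * K) * enorm n (\<lambda>i. v i - x i)"
proof -
  have cR: "u \<in> Rn n" if "u \<in> cube n a l" for u using that by (simp add: cube_def)
  note pr = channel_prob_space[OF ch n]
  define h where "h = (\<lambda>i. v i - x i)"
  let ?f = "\<lambda>t. measure (W n (vline n x h t)) B"
  let ?L = "2 * sqrt (2 * K) * enorm n h"
  have L0: "?L \<ge> 0" using K(2) by simp
  have "\<bar>?f 1 - ?f 0\<bar> \<le> ?L * (1 - 0)"
  proof (rule pointwise_lipschitz_imp_lipschitz[OF _ L0])
    fix t :: real assume t: "0 \<le> t" "t \<le> 1"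
    define u where "u = vline n x h t"
    have u: "u \<in> cube n a l" using vline_in_cube[OF x v t] by (simp add: u_def h_def)
    let ?g = "\<lambda>v. real_of_ereal (KLdiv (W n v) (W n u))"
    have self: "?g u = 0" using pr[OF cR[OF u]] by (simp add: KLdiv_self)
    have nn: "0 \<le> ?g w" if "w \<in> Rn n" for w
      using pr[OF cR[OF u]] pr[OF that] KL[OF u that] by (intro KLdiv_nonneg) auto
    obtain d where d: "d > 0" "\<And>k. enorm n k < d \<Longrightarrow> ?g (vline n u k 1) \<le> 2 * K * (enorm n k)\<^sup>2"
      using hessian_quadratic_bound[OF n hess[OF u] cR[OF u] self nn K(1)[OF u] K(2)] by blast
    \<comment> \<open>Below the radius 1 / sqrt(2 K) the Pinsker bound applies, since it requires
      \<open>?s \<le> 1\<close>.\<close>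
    define r where "r = min d (1 / sqrt (2 * K))"
    have r: "r > 0" using d K(2) by (simp add: r_def)
    have loc: "\<bar>measure (W n (vline n u k 1)) B - measure (W n u) B\<bar> \<le> 2 * sqrt (2 * K) * enorm n k"
      if k: "enorm n k < r" for k
    proof (cases "enorm n k = 0")
      case True
      hence "k i = 0" if "i < n" for i using enorm_eq_0 that by blast
      hence "vline n u k 1 = u" using cR[OF u] by (auto simp: vline_def Rn_iff)
      thus ?thesis using True by simp
    next
      case False
      hence kp: "enorm n k > 0" using enorm_nonneg[of n k] by linarith
      let ?s = "sqrt (2 * K) * enorm n k"
      have "\<bar>measure (W n (vline n u k 1)) B - measure (W n u) B\<bar> \<le> 2 * ?s"
      proof (rule KLdiv_imp_prob_diff_le)
        show "0 < ?s" using kp K(2) by simp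
        show "?s \<le> 1" using k K(2) by (simp add: r_def pos_less_divide_eq mult.commute)
        show "?g (vline n u k 1) \<le> ?s\<^sup>2"
          using d(2)[of k] k K(2) by (simp add: r_def power_mult_distrib)
      qed (use pr[OF cR[OF u]] pr[of "vline n u k 1"] KL[OF u] B in auto)
      thus ?thesis by simp
    qed
    define d' where "d' = r / (enorm n h + 1)"
    have d': "d' > 0" using r by (simp add: d'_def add_nonneg_pos)
    have "\<bar>?f s - ?f t\<bar> \<le> ?L * \<bar>s - t\<bar>" if s: "\<bar>s - t\<bar> < d'" for s
    proof -
      define k where "k = (\<lambda>i. (s - t) * h i)"
      have k: "enorm n k = \<bar>s - t\<bar> * enorm n h" by (rule enorm_scale) (simp add: k_def)
      have "\<bar>s - t\<bar> * enorm n h \<le> \<bar>s - t\<bar> * (enorm n h + 1)" by (intro mult_left_mono) auto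
      also have "\<dots> < r" using s by (simp add: d'_def pos_less_divide_eq add_nonneg_pos)
      finally have "enorm n k < r" by (simp add: k)
      moreover have "vline n u k 1 = vline n x h s"
        by (auto simp: vline_def u_def k_def algebra_simps)
      ultimately show ?thesis using loc[of k] by (simp add: k u_def mult_ac)
    qed
    thus "\<exists>d>0. \<forall>s. \<bar>s - t\<bar> < d \<longrightarrow> \<bar>?f s - ?f t\<bar> \<le> ?L * \<bar>s - t\<bar>" using d' by blast
  qed simp
  moreover have "vline n x h 1 = v" "vline n x h 0 = x"
    using cR[OF x] cR[OF v] by (auto simp: vline_def h_def Rn_iff)
  ultimately show ?thesis by (simp add: h_def abs_minus_commute)
qed

subsection \<open>Quantization of the inputs\<close>

lemma limsup_le_0_eventually:
  assumes "limsup (\<lambda>n. ereal (f n)) = 0" "e > 0"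
  shows "\<forall>\<^sub>F n in sequentially. f n < e"
proof -
  have "limsup (\<lambda>n. ereal (f n)) < ereal e" using assms by (simp add: zero_ereal_def)
  from Limsup_lessD[OF this] show ?thesis by simp
qed

lemma le_exp_of_ln_less:
  fixes u v :: real
  assumes "ln u < v" "u > 0"
  shows "u \<le> exp v"
proof -
  have "exp (ln u) \<le> exp v" using assms(1) by simp
  thus ?thesis using assms(2) by simp
qed

lemma floor_eq_imp_abs_diff_lt:
  fixes u v :: real
  assumes "\<lfloor>u\<rfloor> = \<lfloor>v\<rfloor>"
  shows "\<bar>u - v\<bar> < 1"
  using assms by linarith

lemma enorm_le:
  assumes "\<And>i. i < n \<Longrightarrow> \<bar>h i\<bar> \<le> b" "b \<ge> 0"
  shows "enorm n h \<le> n * b"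
proof -
  have "enorm n h \<le> (\<Sum>i<n. \<bar>h i\<bar>)"
    unfolding enorm_def using L2_set_le_sum_abs[of h "{..<n}"] by (simp add: L2_set_def)
  also have "\<dots> \<le> (\<Sum>i<n. b)" using assms by (intro sum_mono) auto
  finally show ?thesis by simp
qed

definition grid :: "nat \<Rightarrow> (nat \<Rightarrow> real) \<Rightarrow> real \<Rightarrow> (nat \<Rightarrow> real) \<Rightarrow> nat \<Rightarrow> int" where
  "grid n a h x = (\<lambda>i\<in>{..<n}. \<lfloor>(x i - a i) / h\<rfloor>)"

lemma grid_close:
  assumes "grid n a h x = grid n a h v" "h > 0" "i < n"
  shows "\<bar>v i - x i\<bar> \<le> h"
proof -
  have "\<lfloor>(x i - a i) / h\<rfloor> = \<lfloor>(v i - a i) / h\<rfloor>"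
    using fun_cong[OF assms(1), of i] assms(3) by (simp add: grid_def)
  hence "\<bar>(x i - a i) / h - (v i - a i) / h\<bar> < 1" by (rule floor_eq_imp_abs_diff_lt)
  hence "\<bar>(x i - v i) / h\<bar> < 1" by (simp add: diff_divide_distrib)
  hence "\<bar>x i - v i\<bar> < h" using assms(2) by (simp add: abs_divide divide_less_eq)
  thus ?thesis by simp
qed

text \<open>There are m + 1 values per coordinate, not m: the cube is closed, and points of its far
  face have label m.\<close>

lemma grid_mem:
  assumes "x \<in> cube n a l" "l > 0" "m > 0"
  shows "grid n a (l / real m) x \<in> {..<n} \<rightarrow>\<^sub>E {0..int m}"
proof (rule PiE_I)
  fix i assume i: "i \<in> {..<n}"
  hence b: "0 \<le> x i - a i" "x i - a i \<le> l" using assms by (auto simp: cube_def)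
  have "(x i - a i) / (l / real m) \<le> real m"
    using mult_right_mono[OF b(2), of "real m"] assms by (simp add: divide_le_eq mult_ac)
  hence "\<lfloor>(x i - a i) / (l / real m)\<rfloor> \<le> int m" by linarith
  moreover have "0 \<le> (x i - a i) / (l / real m)" using b assms by simp
  ultimately show "grid n a (l / real m) x i \<in> {0..int m}" using i by (simp add: grid_def)
qed (simp add: grid_def)

lemma grid_measurable: "{x \<in> space (Xsp n). grid n a h x = k} \<in> sets (Xsp n)"
proof (cases "k \<in> extensional {..<n}")
  case True
  have "grid n a h x = k \<longleftrightarrow> (\<forall>i\<in>{..<n}. \<lfloor>(x i - a i) / h\<rfloor> = k i)" for x
  proof
    assume *: "\<forall>i\<in>{..<n}. \<lfloor>(x i - a i) / h\<rfloor> = k i"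
    show "grid n a h x = k"
      by (rule extensionalityI[OF _ True]) (use * in \<open>simp_all add: grid_def\<close>)
  qed (auto simp: grid_def)
  hence "{x \<in> space (Xsp n). grid n a h x = k} = {x \<in> space (Xsp n). \<forall>i\<in>{..<n}. \<lfloor>(x i - a i) / h\<rfloor> = k i}"
    by simp
  also have "\<dots> \<in> sets (Xsp n)"
    unfolding Xsp_def by measurable
  finally show ?thesis .
next
  case False
  have "grid n a h x \<noteq> k" for x using False by (auto simp: grid_def)
  thus ?thesis by simp
qed

text \<open>Labels rather than representative points, since X need not contain any grid point.
  Measurability is asked of the cells in the whole space because X itself, the set of admissible
  inputs, may fail to be measurable.\<close>

definition quantizer :: "(nat \<Rightarrow> (nat \<Rightarrow> real) \<Rightarrow> (nat \<Rightarrow> 'b) measure) \<Rightarrow> 'b measure \<Rightarrow> nat \<Rightarrow>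
    (nat \<Rightarrow> real) set \<Rightarrow> real \<Rightarrow> ((nat \<Rightarrow> real) \<Rightarrow> nat \<Rightarrow> int) \<Rightarrow> (nat \<Rightarrow> int) set \<Rightarrow> bool" where
  "quantizer W MY n X \<eta> q T \<longleftrightarrow> finite T \<and> (\<forall>x\<in>X. q x \<in> T) \<and>
     (\<forall>k. {x \<in> space (Xsp n). q x = k} \<in> sets (Xsp n)) \<and>
     (\<forall>x\<in>X. \<forall>v\<in>X. \<forall>B\<in>sets (Ysp MY n). q x = q v \<longrightarrow>
        \<bar>measure (W n x) B - measure (W n v) B\<bar> \<le> \<eta>)"

lemma quantizer_exists:
  fixes K l \<eta> :: real
  assumes ch: "general_channel MY W" and n: "n > 0"
    and KL: "\<And>x v. x \<in> cube n a l \<Longrightarrow> v \<in> Rn n \<Longrightarrow> KLdiv (W n v) (W n x) < \<infinity>"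
    and hess: "\<And>x. x \<in> cube n a l \<Longrightarrow>
       has_hessian n (\<lambda>v. real_of_ereal (KLdiv (W n v) (W n x))) (H x)"
    and K: "\<And>x. x \<in> cube n a l \<Longrightarrow> mnorm n (H x x) \<le> K" "1 \<le> K"
    and l: "l \<ge> 1" and \<eta>: "\<eta> > 0" and X: "X \<subseteq> cube n a l"
  shows "\<exists>q T. quantizer W MY n X \<eta> q T \<and> ln (card T) \<le> n * (ln (4 / \<eta> + 2) + n + ln K + ln l)"
proof -
  define L where "L = 2 * sqrt (2 * K)"
  have L: "L > 0" "L \<le> 4 * K"
  proof -
    have "sqrt (2 * K) \<le> 2 * K" using K(2) by (intro real_le_lsqrt) (auto simp: power2_eq_square)
    thus "L > 0" "L \<le> 4 * K" using K(2) by (auto simp: L_def)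
  qed
  \<comment> \<open>Equal labels mean that the coordinates differ by at most l / m, so the points
    are within n l / m of each other; with the Lipschitz constant L this m makes the outputs differ
    by at most \<eta>.\<close>
  define m where "m = nat \<lceil>L * n * l / \<eta>\<rceil>"
  have m1: "L * n * l / \<eta> \<le> m" unfolding m_def by linarith
  have m2: "m \<le> L * n * l / \<eta> + 1"
  proof -
    have "0 \<le> L * n * l / \<eta>" using L l \<eta> by simp
    thus ?thesis unfolding m_def by linarith
  qed
  have "0 < L * n * l / \<eta>" using L l \<eta> n by simp
  hence mp: "m > 0" using m1 by (cases "m = 0") auto
  define q where "q = grid n a (l / real m)"
  define T :: "(nat \<Rightarrow> int) set" where "T = {..<n} \<rightarrow>\<^sub>E {0..int m}"
  have cT: "card T = (m + 1) ^ n" by (simp add: T_def card_PiE nat_add_distrib)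
  have "quantizer W MY n X \<eta> q T"
    unfolding quantizer_def
  proof (intro conjI ballI allI impI)
    show "finite T" unfolding T_def by (rule finite_PiE) auto
    fix x assume x: "x \<in> X"
    show "q x \<in> T" unfolding q_def T_def using grid_mem x X l mp by (meson less_le_trans subsetD zero_less_one)
    fix v B assume v: "v \<in> X" and B: "B \<in> sets (Ysp MY n)" and e: "q x = q v"
    have "\<bar>measure (W n x) B - measure (W n v) B\<bar> \<le> L * enorm n (\<lambda>i. v i - x i)"
      unfolding L_def
      by (rule channel_lipschitz[where H = H and l = l and a = a]) (fact ch n KL hess K B | rule subsetD[OF X] x v)+
    also have "\<dots> \<le> L * (n * (l / m))"
      using L grid_close[OF e[unfolded q_def]] l mp by (intro mult_left_mono enorm_le) auto
    also have "\<dots> \<le> \<eta>" using m1 \<eta> mp by (simp add: field_simps)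
    finally show "\<bar>measure (W n x) B - measure (W n v) B\<bar> \<le> \<eta>" .
  next
    fix k show "{x \<in> space (Xsp n). q x = k} \<in> sets (Xsp n)" unfolding q_def by (rule grid_measurable)
  qed
  moreover have "ln (card T) \<le> n * (ln (4 / \<eta> + 2) + n + ln K + ln l)"
  proof -
    \<comment> \<open>Absorbs the additive 2 into a product, so that the logarithm splits into a
      sum.\<close>
    have nKl: "1 \<le> n * K * l" using mult_mono[of 1 "n * K" 1 l] mult_mono[of 1 "real n" 1 K] n K l by simp
    have "real m + 1 \<le> L * n * l / \<eta> + 2" using m2 by simp
    also have "L * n * l / \<eta> \<le> (4 * K) * n * l / \<eta>"
      using L l \<eta> by (intro divide_right_mono mult_right_mono) auto
    also have "(4 * K) * n * l / \<eta> + 2 \<le> 4 / \<eta> * (n * K * l) + 2 * (n * K * l)" using nKl by (simp add: mult_ac)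
    also have "\<dots> = (4 / \<eta> + 2) * (n * K * l)" by (simp add: algebra_simps)
    finally have "ln (real m + 1) \<le> ln ((4 / \<eta> + 2) * (n * K * l))" by (intro ln_mono) auto
    also have "\<dots> = ln (4 / \<eta> + 2) + ln n + ln K + ln l"
    proof -
      have "4 / \<eta> + 2 > 0" using \<eta> by (intro add_pos_pos) auto
      thus ?thesis using n K(2) l by (simp add: ln_mult_pos)
    qed
    also have "ln n \<le> n" using ln_bound[of n] n by simp
    finally have "ln (real m + 1) \<le> ln (4 / \<eta> + 2) + n + ln K + ln l" by simp
    hence "n * ln (real m + 1) \<le> n * (ln (4 / \<eta> + 2) + n + ln K + ln l)" by (rule mult_left_mono) auto
    moreover have "ln (card T) = n * ln (real m + 1)" by (simp add: cT ln_realpow add_ac)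
    ultimately show ?thesis by simp
  qed
  ultimately show ?thesis by blast
qed

text \<open>By (A1) and (A2) the logarithms of the edge length and of the Hessian bound are
  eventually at most exp(\<gamma> n / 2). Halving the exponent leaves another factor exp(\<gamma> n
  / 2) to absorb the polynomial factor n.\<close>

lemma A1_A2_quantizer:
  fixes \<gamma> \<eta> :: real
  assumes ch: "general_channel MY W" and "A1_A2 W c \<Gamma>" and \<gamma>: "\<gamma> > 0" and \<eta>: "\<eta> > 0"
  shows "\<forall>\<^sub>F n in sequentially. \<exists>q T. quantizer W MY n (XG c \<Gamma> n) \<eta> q T \<and> ln (card T) \<le> exp (\<gamma> * n)"
proof -
  from assms(2)[unfolded A1_A2_def] obtain a l H where
    lsub: "\<forall>n>0. l n \<ge> 2 \<and> XG c \<Gamma> n \<subseteq> cube n (a n) (l n)"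
    and ll: "limsup (\<lambda>n. ereal (ln (ln (l n)) / real n)) = 0"
    and KLhess: "\<forall>n>0. \<forall>x\<in>cube n (a n) (l n).
          (\<forall>v\<in>Rn n. KLdiv (W n v) (W n x) < \<infinity>)
        \<and> has_hessian n (\<lambda>v. real_of_ereal (KLdiv (W n v) (W n x))) (H n x)"
    and bdd: "\<forall>\<^sub>F n in sequentially. bdd_above ((\<lambda>x. mnorm n (H n x x)) ` cube n (a n) (l n))"
    and lK: "limsup (\<lambda>n. ereal (ln (log_term (Sup ((\<lambda>x. mnorm n (H n x x)) ` cube n (a n) (l n)))) / real n)) = 0"
    by - (elim exE conjE, rule that)
  have l: "l n \<ge> 2" and sub: "XG c \<Gamma> n \<subseteq> cube n (a n) (l n)" if "n > 0" for n
    using lsub that by auto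
  have KL: "KLdiv (W n v) (W n x) < \<infinity>" if "n > 0" "x \<in> cube n (a n) (l n)" "v \<in> Rn n" for n x v
    using KLhess that by blast
  have hess: "has_hessian n (\<lambda>v. real_of_ereal (KLdiv (W n v) (W n x))) (H n x)"
    if "n > 0" "x \<in> cube n (a n) (l n)" for n x
    using KLhess that by blast
  define S where "S n = Sup ((\<lambda>x. mnorm n (H n x x)) ` cube n (a n) (l n))" for n
  have lK': "limsup (\<lambda>n. ereal (ln (log_term (S n)) / real n)) = 0"
    using lK by (simp only: S_def)
  define C where "C = ln (4 / \<eta> + 2)"
  have g2: "\<gamma> / 2 > 0" using \<gamma> by simp
  have "(\<lambda>n. real n * (C + real n + 2 * exp (\<gamma> / 2 * real n)) / exp (\<gamma> * real n)) \<longlonglongrightarrow> 0"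
    using \<gamma> by real_asymp
  hence "\<forall>\<^sub>F n in sequentially. real n * (C + real n + 2 * exp (\<gamma> / 2 * real n)) / exp (\<gamma> * real n) < 1"
    by (rule order_tendstoD) simp
  hence big: "\<forall>\<^sub>F n in sequentially. real n * (C + real n + 2 * exp (\<gamma> / 2 * real n)) \<le> exp (\<gamma> * real n)"
    by eventually_elim (simp add: divide_less_eq)
  show ?thesis
    using limsup_le_0_eventually[OF ll g2] limsup_le_0_eventually[OF lK' g2] bdd big eventually_gt_at_top[of 0]
  proof eventually_elim
    case (elim n)
    note n = elim(5)
    \<comment> \<open>The supremum may lie below 1; raising it to 1 gives ln K \<le>
      \<open>log_term (S n)\<close> in all cases.\<close>
    define K where "K = max 1 (S n)"
    have K: "mnorm n (H n x x) \<le> K" if "x \<in> cube n (a n) (l n)" for x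
      using cSUP_upper[OF that elim(3)] by (simp add: K_def S_def)
    have K1: "1 \<le> K" by (simp add: K_def)
    have l1: "l n \<ge> 1" using l[OF n] by simp
    have "\<exists>q T. quantizer W MY n (XG c \<Gamma> n) \<eta> q T \<and>
        ln (card T) \<le> n * (ln (4 / \<eta> + 2) + n + ln K + ln (l n))"
    proof (rule quantizer_exists[where a = "a n" and l = "l n" and H = "H n" and K = K])
      show "general_channel MY W" "0 < n" by fact+
      show "KLdiv (W n v) (W n x) < \<infinity>" if "x \<in> cube n (a n) (l n)" "v \<in> Rn n" for x v
        by (rule KL[OF n that])
      show "has_hessian n (\<lambda>v. real_of_ereal (KLdiv (W n v) (W n x))) (H n x)"
        if "x \<in> cube n (a n) (l n)" for x
        by (rule hess[OF n that])
      show "mnorm n (H n x x) \<le> K" if "x \<in> cube n (a n) (l n)" for x by (rule K[OF that])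
      show "1 \<le> K" "1 \<le> l n" "0 < \<eta>" "XG c \<Gamma> n \<subseteq> cube n (a n) (l n)" by (fact K1 l1 \<eta> sub[OF n])+
    qed
    then obtain q T where qT: "quantizer W MY n (XG c \<Gamma> n) \<eta> q T"
      "ln (card T) \<le> n * (ln (4 / \<eta> + 2) + n + ln K + ln (l n))" by (elim exE conjE)
    have "ln (ln (l n)) < \<gamma> / 2 * n" using elim(1) n by (simp add: divide_less_eq)
    hence "ln (l n) \<le> exp (\<gamma> / 2 * n)"
      using l[OF n] by (intro le_exp_of_ln_less) auto
    moreover have "ln K \<le> exp (\<gamma> / 2 * n)"
    proof -
      have p: "log_term (S n) \<ge> 1" by (simp add: log_term_def)
      have "ln (log_term (S n)) < \<gamma> / 2 * n" using elim(2) n by (simp add: divide_less_eq)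
      hence "log_term (S n) \<le> exp (\<gamma> / 2 * n)"
        using p by (intro le_exp_of_ln_less) auto
      moreover have "ln K \<le> log_term (S n)"
      proof (cases "1 \<le> S n")
        case True thus ?thesis by (simp add: K_def log_term_def)
      next
        case False thus ?thesis using p by (simp add: K_def)
      qed
      ultimately show ?thesis by (rule order_trans[rotated])
    qed
    ultimately have "ln (4 / \<eta> + 2) + n + ln K + ln (l n) \<le> C + n + 2 * exp (\<gamma> / 2 * n)"
      by (simp add: C_def)
    hence "n * (ln (4 / \<eta> + 2) + n + ln K + ln (l n)) \<le> n * (C + n + 2 * exp (\<gamma> / 2 * n))"
      by (rule mult_left_mono) simp
    with qT(2) have "ln (card T) \<le> n * (C + n + 2 * exp (\<gamma> / 2 * n))"
      by (rule order_trans)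
    also note elim(4)
    finally have "ln (card T) \<le> exp (\<gamma> * n)" .
    with qT(1) show ?case by blast
  qed
qed

subsection \<open>Limits and codes\<close>

lemma limsup_le_iff_eventually:
  "limsup (\<lambda>n. ereal (f n)) \<le> ereal a \<longleftrightarrow> (\<forall>e>0. \<forall>\<^sub>F n in sequentially. f n \<le> a + e)"
proof
  assume L: "limsup (\<lambda>n. ereal (f n)) \<le> ereal a"
  show "\<forall>e>0. \<forall>\<^sub>F n in sequentially. f n \<le> a + e"
  proof (intro allI impI)
    fix e :: real assume "e > 0"
    hence "\<forall>\<^sub>F n in sequentially. ereal (f n) < ereal (a + e)"
      using L[unfolded Limsup_le_iff, rule_format, of "ereal (a + e)"] by simp
    thus "\<forall>\<^sub>F n in sequentially. f n \<le> a + e" by eventually_elim simp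
  qed
next
  assume R: "\<forall>e>0. \<forall>\<^sub>F n in sequentially. f n \<le> a + e"
  show "limsup (\<lambda>n. ereal (f n)) \<le> ereal a"
  proof (rule ereal_le_epsilon2)
    fix e :: real assume "e > 0"
    hence "\<forall>\<^sub>F n in sequentially. ereal (f n) \<le> ereal a + ereal e" using R by simp
    thus "limsup (\<lambda>n. ereal (f n)) \<le> ereal a + ereal e" by (rule Limsup_bounded)
  qed
qed

lemma liminf_ge_iff_eventually:
  "ereal a \<le> liminf (\<lambda>n. ereal (f n)) \<longleftrightarrow> (\<forall>e>0. \<forall>\<^sub>F n in sequentially. a - e \<le> f n)"
proof -
  have "ereal a \<le> liminf (\<lambda>n. ereal (f n)) \<longleftrightarrow> - liminf (\<lambda>n. ereal (f n)) \<le> - ereal a"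
    by (simp only: ereal_minus_le_minus)
  also have "- liminf (\<lambda>n. ereal (f n)) = limsup (\<lambda>n. ereal (- f n))"
    by (simp add: ereal_Limsup_uminus[symmetric])
  also have "- ereal a = ereal (- a)" by simp
  finally show ?thesis unfolding limsup_le_iff_eventually by (simp add: algebra_simps)
qed

lemmas limsup_leD = limsup_le_iff_eventually[THEN iffD1, rule_format]
lemmas liminf_geD = liminf_ge_iff_eventually[THEN iffD1, rule_format]

text \<open>Achievability asks for one sequence of codes, while the constructions give codes for
  each fixed tolerance and all n large enough for it. For each n take a code meeting the smallest
  tolerance 1 / (k + 1), k \<le> n, that is attainable at n; the cap k \<le> n makes the largest
  such k exist.\<close>

lemma eventually_diagonal:
  fixes V :: "nat \<Rightarrow> 'a \<Rightarrow> bool" and A :: "nat \<Rightarrow> real \<Rightarrow> 'a \<Rightarrow> bool"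
  assumes V: "\<And>n. n > 0 \<Longrightarrow> \<exists>\<phi>. V n \<phi>"
    and A: "\<And>e. e > 0 \<Longrightarrow> \<forall>\<^sub>F n in sequentially. \<exists>\<phi>. V n \<phi> \<and> A n e \<phi>"
    and mono: "\<And>n e e' \<phi>. A n e \<phi> \<Longrightarrow> e \<le> e' \<Longrightarrow> A n e' \<phi>"
  shows "\<exists>\<Phi>. (\<forall>n>0. V n (\<Phi> n)) \<and> (\<forall>e>0. \<forall>\<^sub>F n in sequentially. A n e (\<Phi> n))"
proof -
  define K where "K n = {k. k \<le> n \<and> (\<exists>\<phi>. V n \<phi> \<and> A n (1 / real (Suc k)) \<phi>)}" for n
  have finK: "finite (K n)" for n by (simp add: K_def)
  have "\<exists>\<phi>. n > 0 \<longrightarrow> V n \<phi> \<and> (K n \<noteq> {} \<longrightarrow> A n (1 / real (Suc (Max (K n)))) \<phi>)" for n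
  proof (cases "K n = {}")
    case False
    hence "Max (K n) \<in> K n" using finK by (rule Max_in[rotated])
    thus ?thesis unfolding K_def by blast
  qed (use V in auto)
  then obtain \<Phi> where \<Phi>: "\<And>n. n > 0 \<Longrightarrow> V n (\<Phi> n)"
    "\<And>n. n > 0 \<Longrightarrow> K n \<noteq> {} \<Longrightarrow> A n (1 / real (Suc (Max (K n)))) (\<Phi> n)"
    by metis
  have "\<forall>\<^sub>F n in sequentially. A n e (\<Phi> n)" if e: "e > 0" for e
  proof -
    obtain k where k: "1 / real (Suc k) < e" using e nat_approx_posE by blast
    have "\<forall>\<^sub>F n in sequentially. \<exists>\<phi>. V n \<phi> \<and> A n (1 / real (Suc k)) \<phi>" by (rule A) simp
    thus ?thesis using eventually_ge_at_top[of "Suc k"]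
    proof eventually_elim
      case (elim n)
      hence kK: "k \<in> K n" by (auto simp: K_def)
      hence "k \<le> Max (K n)" using finK by (intro Max_ge)
      hence "1 / real (Suc (Max (K n))) \<le> 1 / real (Suc k)" by (intro divide_left_mono) auto
      hence "1 / real (Suc (Max (K n))) \<le> e" using k by linarith
      moreover have "A n (1 / real (Suc (Max (K n)))) (\<Phi> n)" by (rule \<Phi>(2)) (use kK elim(2) in auto)
      ultimately show ?case by (rule mono[rotated])
    qed
  qed
  thus ?thesis using \<Phi>(1) by blast
qed

section \<open>Output distributions of codes and variational distance\<close>

lemma uniform_prob_algebra:
  "(M::nat) \<ge> 1 \<Longrightarrow> uniform_count_measure {1..M} \<in> space (prob_algebra (count_space {1..M}))"
  by (auto simp: space_prob_algebra sets_uniform_count_measure_count_space intro!: prob_space_uniform_count_measure)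

lemma channel_measurable:
  "general_channel MY W \<Longrightarrow> n > 0 \<Longrightarrow> W n \<in> Xsp n \<rightarrow>\<^sub>M prob_algebra (Ysp MY n)"
  by (simp add: general_channel_def)

lemma channel_prob_algebra:
  assumes "general_channel MY W" "n > 0" "x \<in> Rn n"
  shows "W n x \<in> space (prob_algebra (Ysp MY n))"
  using channel_measurable[OF assms(1,2)] by (rule measurable_space) (use assms(3) in \<open>simp add: Rn_def\<close>)

lemma res_output_prob:
  assumes ch: "general_channel MY W" and n: "n > 0" and M: "(M::nat) \<ge> 1" and \<phi>: "\<And>i. i \<in> {1..M} \<Longrightarrow> \<phi> i \<in> Rn n"
  shows "prob_space (res_output W n M \<phi>)" "sets (res_output W n M \<phi>) = sets (Ysp MY n)"
    "B \<in> sets (Ysp MY n) \<Longrightarrow> measure (res_output W n M \<phi>) B = (\<Sum>i=1..M. measure (W n (\<phi> i)) B) / M"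
proof -
  have k: "(\<lambda>i. W n (\<phi> i)) \<in> count_space {1..M} \<rightarrow>\<^sub>M prob_algebra (Ysp MY n)"
    using channel_prob_algebra[OF ch n \<phi>] by auto
  note u = uniform_prob_algebra[OF M]
  show "prob_space (res_output W n M \<phi>)" "sets (res_output W n M \<phi>) = sets (Ysp MY n)"
    unfolding res_output_def using prob_space_bind'[OF u k] sets_bind'[OF u k] by auto
  assume B: "B \<in> sets (Ysp MY n)"
  interpret U: prob_space "uniform_count_measure {1..M}" using u by (simp add: space_prob_algebra)
  have k': "(\<lambda>i. W n (\<phi> i)) \<in> uniform_count_measure {1..M} \<rightarrow>\<^sub>M subprob_algebra (Ysp MY n)"
    using measurable_prob_algebraD[OF k] by (simp add: measurable_cong_sets[OF sets_uniform_count_measure_count_space refl])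
  show "measure (res_output W n M \<phi>) B = (\<Sum>i=1..M. measure (W n (\<phi> i)) B) / M"
    unfolding res_output_def U.measure_bind[OF k' B] by (subst integral_uniform_count_measure) auto
qed

lemma bind_channel_prob:
  assumes ch: "general_channel MY W" and n: "n > 0" and Q: "Q \<in> space (prob_algebra (Xsp n))"
  shows "prob_space (Q \<bind> W n)" "sets (Q \<bind> W n) = sets (Ysp MY n)"
  using prob_space_bind'[OF Q channel_measurable[OF ch n]] sets_bind'[OF Q channel_measurable[OF ch n]] by auto

lemma vdistD:
  assumes "prob_space P" "prob_space P'" "B \<in> sets P"
  shows "2 * \<bar>measure P B - measure P' B\<bar> \<le> vdist P P'"
proof -
  have "\<bar>measure P A - measure P' A\<bar> \<le> 1" for A
    using prob_space.prob_le_1[OF assms(1), of A] prob_space.prob_le_1[OF assms(2), of A]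
      measure_nonneg[of P A] measure_nonneg[of P' A] by linarith
  hence "bdd_above ((\<lambda>B. \<bar>measure P B - measure P' B\<bar>) ` sets P)" by (intro bdd_aboveI2)
  from cSUP_upper[OF assms(3) this] show ?thesis by (simp add: vdist_def)
qed

lemma vdist_le:
  assumes "\<And>B. B \<in> sets P \<Longrightarrow> \<bar>measure P B - measure P' B\<bar> \<le> e"
  shows "vdist P P' \<le> 2 * e"
proof -
  have "(SUP B\<in>sets P. \<bar>measure P B - measure P' B\<bar>) \<le> e"
    by (rule cSUP_least) (use assms in auto)
  thus ?thesis by (simp add: vdist_def)
qed

subsection \<open>Identification versus resolvability\<close>

lemma id_muD:
  assumes "i \<in> {1..N::nat}"
  shows "measure (Q i \<bind> W n) (space (Ysp MY n) - D i) \<le> id_mu MY W n N Q D"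
  unfolding id_mu_def by (rule Max_ge) (use assms in auto)

lemma id_lam_finite:
  "finite ({0} \<union> {measure (Q j \<bind> W n) (D i) | i j. i \<in> {1..N} \<and> j \<in> {1..N::nat} \<and> i \<noteq> j})"
proof -
  have "{measure (Q j \<bind> W n) (D i) | i j. i \<in> {1..N} \<and> j \<in> {1..N} \<and> i \<noteq> j}
     \<subseteq> (\<lambda>(i, j). measure (Q j \<bind> W n) (D i)) ` ({1..N} \<times> {1..N})" by auto
  from finite_subset[OF this] show ?thesis by simp
qed

lemma id_lamD:
  assumes "i \<in> {1..N::nat}" "j \<in> {1..N}" "i \<noteq> j"
  shows "measure (Q j \<bind> W n) (D i) \<le> id_lam W n N Q D"
  unfolding id_lam_def by (rule Max_ge[OF id_lam_finite]) (use assms in auto)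

text \<open>The resolvability codes of the input processes are close to the outputs uniformly over the
  messages: otherwise the messages for which no short code exists would form an input process
  that is not resolvable.\<close>

lemma uniform_resolvability:
  fixes R g e :: real
  assumes code: "\<And>n. n > 0 \<Longrightarrow> idcode MY c \<Gamma> n (N n) (Q n) (D n)"
    and res: "\<forall>P\<in>S_Gamma c \<Gamma>. r_achievable_for W c \<Gamma> \<delta> P R" and e: "e > 0" and g: "g > 0"
  shows "\<forall>\<^sub>F n in sequentially. \<forall>i\<in>{1..N n}. \<exists>M \<phi>. M \<ge> 1 \<and> (\<forall>m\<in>{1..M}. \<phi> m \<in> XG c \<Gamma> n) \<and>
     vdist (Q n i \<bind> W n) (res_output W n M \<phi>) \<le> \<delta> + e \<and> ln (real M) \<le> n * (R + g)"
proof -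
  define good where "good n i \<longleftrightarrow> (\<exists>M \<phi>. M \<ge> 1 \<and> (\<forall>m\<in>{1..M}. \<phi> m \<in> XG c \<Gamma> n) \<and>
     vdist (Q n i \<bind> W n) (res_output W n M \<phi>) \<le> \<delta> + e \<and> ln (real M) \<le> n * (R + g))" for n i
  have N1: "N n \<ge> 1" if "n > 0" for n using code[OF that] by (simp add: idcode_def)
  have "\<exists>i. (n > 0 \<longrightarrow> i \<in> {1..N n}) \<and> ((\<exists>i\<in>{1..N n}. \<not> good n i) \<longrightarrow> \<not> good n i)" for n
  proof (cases "\<exists>i\<in>{1..N n}. \<not> good n i")
    case False
    thus ?thesis using N1[of n] by (intro exI[of _ 1]) auto
  qed blast
  then obtain s where s: "\<And>n. n > 0 \<Longrightarrow> s n \<in> {1..N n}"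
    "\<And>n i. i \<in> {1..N n} \<Longrightarrow> \<not> good n i \<Longrightarrow> \<not> good n (s n)" by metis
  have "(\<lambda>n. Q n (s n)) \<in> S_Gamma c \<Gamma>"
    using code s(1) by (simp add: S_Gamma_def idcode_def)
  with res have "r_achievable_for W c \<Gamma> \<delta> (\<lambda>n. Q n (s n)) R" by blast
  then obtain M \<phi> where M: "\<forall>n>0. M n \<ge> 1 \<and> (\<forall>i\<in>{1..M n}. \<phi> n i \<in> XG c \<Gamma> n)"
    and v: "limsup (\<lambda>n. ereal (vdist (out_dist W (\<lambda>n. Q n (s n)) n) (res_output W n (M n) (\<phi> n)))) \<le> ereal \<delta>"
    and r: "limsup (\<lambda>n. ereal (ln (real (M n)) / real n)) \<le> ereal R"
    unfolding r_achievable_for_def by blast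
  from v have "\<forall>\<^sub>F n in sequentially. vdist (out_dist W (\<lambda>n. Q n (s n)) n) (res_output W n (M n) (\<phi> n)) \<le> \<delta> + e"
    by (rule limsup_leD) (rule e)
  moreover from r have "\<forall>\<^sub>F n in sequentially. ln (real (M n)) / real n \<le> R + g"
    by (rule limsup_leD) (rule g)
  ultimately have "\<forall>\<^sub>F n in sequentially. \<forall>i\<in>{1..N n}. good n i"
    using eventually_gt_at_top[of 0]
  proof eventually_elim
    case (elim n)
    have "ln (real (M n)) \<le> n * (R + g)" using elim(2,3) by (simp add: divide_le_eq mult.commute)
    moreover have "M n \<ge> 1 \<and> (\<forall>i\<in>{1..M n}. \<phi> n i \<in> XG c \<Gamma> n)" using M elim(3) by simp
    ultimately have "good n (s n)" using elim(1) unfolding good_def out_dist_def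
      by (intro exI[of _ "M n"] exI[of _ "\<phi> n"] conjI) simp_all
    show ?case
    proof (intro ballI, rule ccontr)
      fix i assume "i \<in> {1..N n}" "\<not> good n i"
      from s(2)[OF this] show False using \<open>good n (s n)\<close> by simp
    qed
  qed
  thus ?thesis unfolding good_def .
qed

text \<open>Counts quantized lists of length at most E: with m the largest length, there are at most
  m |T|^m of them, where ln m \<le> E and m ln |T| \<le> E t. With t subexponential in n, the double
  logarithm of the bound is governed by ln E, the resolvability rate.\<close>

lemma card_codes_le:
  fixes E t :: real
  assumes T: "finite T" "ln (card T) \<le> t" "T \<noteq> {}" and E: "1 \<le> E" "1 \<le> t"
  shows "finite (SIGMA M:{1..nat \<lfloor>E\<rfloor>}. {1..M} \<rightarrow>\<^sub>E T)"
    "card (SIGMA M:{1..nat \<lfloor>E\<rfloor>}. {1..M} \<rightarrow>\<^sub>E T) \<le> exp (2 * E * t)"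
proof -
  let ?m = "nat \<lfloor>E\<rfloor>"
  have m: "real ?m \<le> E" "1 \<le> ?m" using E by (auto simp: le_nat_floor)
  have fin: "finite ({1..M} \<rightarrow>\<^sub>E T)" for M :: nat using T by (intro finite_PiE) auto
  thus "finite (SIGMA M:{1..?m}. {1..M} \<rightarrow>\<^sub>E T)" by (intro finite_SigmaI) auto
  have c1: "card T \<ge> 1" using T by (simp add: Suc_le_eq card_gt_0_iff)
  have "card (SIGMA M:{1..?m}. {1..M} \<rightarrow>\<^sub>E T) = (\<Sum>M=1..?m. card T ^ M)"
    using fin by (subst card_SigmaI) (auto simp: card_PiE)
  also have "\<dots> \<le> (\<Sum>M=1..?m. card T ^ ?m)"
    using c1 by (intro sum_mono power_increasing) auto
  also have "\<dots> = ?m * card T ^ ?m" by simp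
  finally have "real (card (SIGMA M:{1..?m}. {1..M} \<rightarrow>\<^sub>E T)) \<le> real ?m * real (card T) ^ ?m"
    by (metis of_nat_le_iff of_nat_mult of_nat_power)
  also have "\<dots> = exp (ln ?m + ?m * ln (card T))"
  proof -
    have "real (card T) ^ k = exp (real k * ln (card T))" for k
      using c1 by (simp add: exp_of_nat_mult)
    moreover have "real ?m = exp (ln (real ?m))" using m(2) by (subst exp_ln) linarith+
    ultimately show ?thesis by (simp only: exp_add)
  qed
  also have "\<dots> \<le> exp (2 * E * t)"
  proof -
    have "ln (real ?m) \<le> ?m" using ln_bound[of "real ?m"] m by simp
    hence "ln (real ?m) \<le> E * 1" using m by simp
    also have "\<dots> \<le> E * t" using E by (intro mult_left_mono) auto
    finally have "ln (real ?m) \<le> E * t" .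
    moreover have "?m * ln (card T) \<le> E * t" using m T c1 E by (intro mult_mono) auto
    ultimately show ?thesis by simp
  qed
  finally show "card (SIGMA M:{1..?m}. {1..M} \<rightarrow>\<^sub>E T) \<le> exp (2 * E * t)" .
qed

lemma id_rate_le_res_rate:
  fixes \<mu> lam \<delta> R R' :: real
  assumes ch: "general_channel MY W" and A: "A1_A2 W c \<Gamma>" and sm: "\<delta> < 1 - \<mu> - lam"
    and id: "id_achievable MY W c \<Gamma> \<mu> lam R"
    and res: "\<forall>P\<in>S_Gamma c \<Gamma>. r_achievable_for W c \<Gamma> \<delta> P R'"
  shows "R \<le> R'"
proof (rule ccontr)
  assume "\<not> R \<le> R'"
  \<comment> \<open>A quarter of the gap: the lists number at most exp(exp(ln 2 + n (R' + 2 g))),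
    the messages at least exp(exp(n (R' + 3 g))), and ln 2 < n g separates the two.\<close>
  define g where "g = (R - R') / 4"
  have g: "g > 0" using \<open>\<not> R \<le> R'\<close> by (simp add: g_def)
  \<comment> \<open>The final comparison loses e four times: once each from \<mu> and lam, and twice
    in passing between the two outputs. With 8 e equal to the gap, half of it survives.\<close>
  define e where "e = (1 - \<mu> - lam - \<delta>) / 8"
  have e: "e > 0" using sm by (simp add: e_def)
  from id obtain N Q D where code: "\<And>n. n > 0 \<Longrightarrow> idcode MY c \<Gamma> n (N n) (Q n) (D n)"
    and mu: "limsup (\<lambda>n. ereal (id_mu MY W n (N n) (Q n) (D n))) \<le> ereal \<mu>"
    and la: "limsup (\<lambda>n. ereal (id_lam W n (N n) (Q n) (D n))) \<le> ereal lam"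
    and ra: "liminf (\<lambda>n. ereal (ln (ln (real (N n))) / real n)) \<ge> ereal R"
    unfolding id_achievable_def by blast
  have "\<forall>\<^sub>F n in sequentially. id_mu MY W n (N n) (Q n) (D n) \<le> \<mu> + e"
    by (rule limsup_leD[OF mu e])
  moreover have "\<forall>\<^sub>F n in sequentially. id_lam W n (N n) (Q n) (D n) \<le> lam + e"
    by (rule limsup_leD[OF la e])
  moreover have "\<forall>\<^sub>F n in sequentially. R - g \<le> ln (ln (real (N n))) / real n"
    by (rule liminf_geD[OF ra g])
  moreover have "\<forall>\<^sub>F n in sequentially. \<forall>i\<in>{1..N n}. \<exists>M \<phi>. M \<ge> 1 \<and> (\<forall>m\<in>{1..M}. \<phi> m \<in> XG c \<Gamma> n) \<and>
     vdist (Q n i \<bind> W n) (res_output W n M \<phi>) \<le> \<delta> + e \<and> ln (real M) \<le> n * (R' + g)"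
    by (rule uniform_resolvability[OF _ res e g]) (rule code)
  moreover note A1_A2_quantizer[OF ch A g e]
  moreover have "\<forall>\<^sub>F n in sequentially. ln 2 / g < real n" 
    by real_asymp
  ultimately have "\<forall>\<^sub>F n in sequentially. False" using eventually_gt_at_top[of 0]
  proof eventually_elim
    case (elim n)
    note n = elim(7)
    have ln2: "ln 2 < n * g" using elim(6) g by (simp add: divide_less_eq)
    obtain M \<phi> where M: "\<And>i. i \<in> {1..N n} \<Longrightarrow> M i \<ge> 1" "\<And>i m. i \<in> {1..N n} \<Longrightarrow> m \<in> {1..M i} \<Longrightarrow> \<phi> i m \<in> XG c \<Gamma> n"
      "\<And>i. i \<in> {1..N n} \<Longrightarrow> vdist (Q n i \<bind> W n) (res_output W n (M i) (\<phi> i)) \<le> \<delta> + e"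
      "\<And>i. i \<in> {1..N n} \<Longrightarrow> ln (real (M i)) \<le> n * (R' + g)"
      using bchoice[OF elim(4)] unfolding bchoice_iff by metis
    obtain q T where q: "quantizer W MY n (XG c \<Gamma> n) e q T" "ln (card T) \<le> exp (g * n)"
      using elim(5) by blast
    have N1: "1 \<in> {1..N n}" using code[OF n] by (simp add: idcode_def)
    define E where "E = exp (n * (R' + g))"
    \<comment> \<open>A code has at least one codeword, so R' + g cannot be negative; this makes R -
      g positive below.\<close>
    have R0: "0 \<le> n * (R' + g)" using M(1,4)[OF N1] ln_ge_zero[of "real (M 1)"] by linarith
    hence E1: "1 \<le> E" by (simp add: E_def)
    have ME: "M i \<le> nat \<lfloor>E\<rfloor>" if "i \<in> {1..N n}" for i
    proof -
      have "exp (ln (real (M i))) \<le> E" unfolding E_def using M(4)[OF that] by simp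
      hence "real (M i) \<le> E" using M(1)[OF that] by simp
      thus ?thesis by (simp add: le_nat_floor)
    qed
    \<comment> \<open>The length is recorded with the list, and the list is cut off to its index
      set, so that messages with the same quantized list get the same value.\<close>
    define cw where "cw = (\<lambda>i. (M i, \<lambda>m\<in>{1..M i}. q (\<phi> i m)))"
    let ?C = "SIGMA M:{1..nat \<lfloor>E\<rfloor>}. {1..M} \<rightarrow>\<^sub>E T"
    have T: "finite T" "\<And>x. x \<in> XG c \<Gamma> n \<Longrightarrow> q x \<in> T" using q(1) by (auto simp: quantizer_def)
    have "q (\<phi> 1 1) \<in> T" using M(1,2)[OF N1] T(2) by auto
    hence "T \<noteq> {}" by auto
    note C = card_codes_le[OF T(1) q(2) this E1]
    have egn: "1 \<le> exp (g * n)" using g by simp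
    have sub: "cw ` {1..N n} \<subseteq> ?C"
      using ME M(1,2) T(2) by (auto simp: cw_def)
    have "real (card ?C) \<le> exp (2 * E * exp (g * n))" by (rule C(2)[OF egn])
    also have "\<dots> < real (N n)"
    proof -
      have "R' + g \<ge> 0" using R0 n by (simp add: zero_le_mult_iff)
      hence "0 < R - g" using g unfolding g_def by (simp add: field_simps)
      have "n * (R - g) \<le> ln (ln (real (N n)))" using elim(3) n by (simp add: le_divide_eq mult.commute)
      hence pos: "0 < ln (ln (real (N n)))" using \<open>0 < R - g\<close> n by (smt (verit) mult_pos_pos of_nat_0_less_iff)
      \<comment> \<open>Since \<open>ln 0 = 0\<close>, a positive outer logarithm excludes ln N = 0;
        positivity of ln N is what lets exp undo the outer logarithm.\<close>
      have lnN: "0 < ln (real (N n))"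
      proof (rule ccontr)
        assume "\<not> 0 < ln (real (N n))"
        moreover have "0 \<le> ln (real (N n))" using N1 by auto
        ultimately have "ln (real (N n)) = 0" by linarith
        thus False using pos by simp
      qed
      have "2 * E * exp (g * n) = exp (ln 2 + n * (R' + 2 * g))"
        by (simp add: E_def exp_add[symmetric] distrib_left mult_ac) (simp add: exp_add mult_ac)
      also have "\<dots> < exp (n * (R - g))" using ln2 by (simp add: g_def field_simps)
      also have "\<dots> \<le> exp (ln (ln (real (N n))))" using \<open>n * (R - g) \<le> _\<close> by simp
      also have "\<dots> = ln (real (N n))" using lnN by simp
      finally have "exp (2 * E * exp (g * n)) < exp (ln (real (N n)))"
        by (simp only: exp_less_cancel_iff)
      also have "\<dots> = real (N n)" using N1 by (intro exp_ln) simp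
      finally show ?thesis .
    qed
    finally have "card ?C < card {1..N n}" by simp
    hence "card (cw ` {1..N n}) < card {1..N n}"
      using card_mono[OF C(1)[OF egn] sub] by linarith
    hence "\<not> inj_on cw {1..N n}" by (rule pigeonhole)
    then obtain i j where ij: "i \<in> {1..N n}" "j \<in> {1..N n}" "i \<noteq> j" "cw i = cw j"
      by (auto simp: inj_on_def)
    have Mij: "M i = M j" using ij(4) by (simp add: cw_def)
    have qij: "q (\<phi> i m) = q (\<phi> j m)" if "m \<in> {1..M i}" for m
    proof -
      have "snd (cw i) m = snd (cw j) m" using ij(4) by simp
      thus ?thesis using that Mij by (simp add: cw_def)
    qed
    have XR: "XG c \<Gamma> n \<subseteq> Rn n" by (auto simp: XG_def Rn_def)
    define B where "B = D n i"
    have Q: "Q n k \<in> space (prob_algebra (Xsp n))" and B: "D n k \<in> sets (Ysp MY n)"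
      if "k \<in> {1..N n}" for k using code[OF n] that by (auto simp: idcode_def)
    have B': "B \<in> sets (Ysp MY n)" using B[OF ij(1)] by (simp add: B_def)
    let ?r = "\<lambda>k. res_output W n (M k) (\<phi> k)"
    have \<phi>R: "\<phi> k m \<in> Rn n" if "k \<in> {1..N n}" "m \<in> {1..M k}" for k m
      using M(2)[OF that] XR by blast
    have r: "prob_space (?r k)" "measure (?r k) B = (\<Sum>m=1..M k. measure (W n (\<phi> k m)) B) / M k"
      if k: "k \<in> {1..N n}" for k
      using res_output_prob(1,3)[where \<phi> = "\<phi> k", OF ch n M(1)[OF k] \<phi>R[OF k]] B' by auto
    note b = bind_channel_prob[OF ch n Q]
    \<comment> \<open>\<open>vdist\<close> is twice the largest difference of probabilities, so each
      of the two approximations costs only (\<delta> + e) / 2 on B; together they cost \<delta> + e,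
      which stays below 1 - \<mu> - lam.\<close>
    have v: "\<bar>measure (Q n k \<bind> W n) B - measure (?r k) B\<bar> \<le> (\<delta> + e) / 2" if k: "k \<in> {1..N n}" for k
      using vdistD[where B = B, OF b(1)[OF k] r(1)[OF k]] M(3)[OF k] B' b(2)[OF k] by simp
    have "\<bar>measure (?r i) B - measure (?r j) B\<bar> \<le> e"
    proof -
      have "measure (?r i) B - measure (?r j) B =
          (\<Sum>m=1..M i. measure (W n (\<phi> i m)) B - measure (W n (\<phi> j m)) B) / M i"
        using r(2)[OF ij(1)] r(2)[OF ij(2)]
        by (simp add: Mij sum_subtractf diff_divide_distrib)
      also have "\<bar>\<dots>\<bar> = \<bar>\<Sum>m=1..M i. measure (W n (\<phi> i m)) B - measure (W n (\<phi> j m)) B\<bar> / M i"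
        by simp
      also have "\<bar>\<Sum>m=1..M i. measure (W n (\<phi> i m)) B - measure (W n (\<phi> j m)) B\<bar> \<le> (\<Sum>m=1..M i. e)"
      proof (rule sum_abs[THEN order_trans], rule sum_mono)
        fix m assume m: "m \<in> {1..M i}"
        show "\<bar>measure (W n (\<phi> i m)) B - measure (W n (\<phi> j m)) B\<bar> \<le> e"
          using q(1) M(2)[OF ij(1) m] M(2)[OF ij(2), of m] m Mij qij[OF m] B' unfolding quantizer_def by auto
      qed
      also have "(\<Sum>m=1..M i. e) / M i = e" using M(1)[OF ij(1)] by simp
      finally show ?thesis by (simp add: divide_right_mono)
    qed
    note rij = abs_le_D1[OF this]
    have "measure (Q n i \<bind> W n) B - measure (?r i) B \<le> (\<delta> + e) / 2"
      by (rule abs_le_D1[OF v[OF ij(1)]])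
    moreover have "measure (?r j) B - measure (Q n j \<bind> W n) B \<le> (\<delta> + e) / 2"
      using abs_le_D2[OF v[OF ij(2)]] by simp
    ultimately have "measure (Q n i \<bind> W n) B - measure (Q n j \<bind> W n) B \<le> (\<delta> + e) / 2 + (\<delta> + e) / 2 + e"
      using rij by linarith
    hence "measure (Q n i \<bind> W n) B - measure (Q n j \<bind> W n) B \<le> \<delta> + 2 * e"
      by (simp add: field_simps)
    moreover have "measure (Q n j \<bind> W n) B \<le> lam + e"
      using id_lamD[OF ij(1-3), of "Q n" W n "D n"] elim(2) by (simp add: B_def)
    moreover have "1 - measure (Q n i \<bind> W n) B \<le> \<mu> + e"
    proof -
      have "measure (Q n i \<bind> W n) (space (Ysp MY n) - B) = 1 - measure (Q n i \<bind> W n) B"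
        using prob_space.prob_compl[where A = B, OF b(1)[OF ij(1)]] b(2)[OF ij(1)] B'
          sets_eq_imp_space_eq[OF b(2)[OF ij(1)]] by simp
      thus ?thesis using id_muD[OF ij(1), of "Q n" W n MY "D n"] elim(1) by (simp add: B_def)
    qed
    moreover have "8 * e = 1 - \<mu> - lam - \<delta>" by (simp add: e_def)
    ultimately show False using e by linarith
  qed
  thus False by simp
qed

subsection \<open>The joint distribution of input and output\<close>

text \<open>Admissible inputs are obtained in this way from an almost-everywhere statement, the set
  \<open>XG\<close> being possibly nonmeasurable.\<close>

lemma (in prob_space) AE_imp_ex:
  assumes "AE x in M. Q x"
  shows "\<exists>x\<in>space M. Q x"
proof (rule ccontr)
  assume *: "\<not> (\<exists>x\<in>space M. Q x)"
  have "AE x in M. False" using assms AE_space by eventually_elim (use * in blast)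
  thus False by simp
qed

text \<open>One block length at a time: X and Y stand for the spaces of n-tuples. The assumption
  \<open>dom\<close> is what finite divergences give. Without domination, as for a noiseless channel
  with continuous input, the joint distribution may be singular to the product of its marginals, and
  \<open>RN_deriv\<close> would carry no information.\<close>

locale dominated_channel =
  fixes X :: "'a measure" and Y :: "'b measure" and P :: "'a measure" and W :: "'a \<Rightarrow> 'b measure"
  assumes P: "P \<in> space (prob_algebra X)"
    and W: "W \<in> X \<rightarrow>\<^sub>M prob_algebra Y"
    and dom: "AE x in P. \<forall>v\<in>space X. absolutely_continuous (W x) (W v)"
begin

definition "PY = P \<bind> W"
definition "J = P \<bind> (\<lambda>x. distr (W x) (X \<Otimes>\<^sub>M Y) (\<lambda>y. (x, y)))"
definition "R = P \<Otimes>\<^sub>M PY"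
definition "d z = enn2real (RN_deriv R J z)"

lemma prob_P: "prob_space P" and sets_P [measurable_cong, simp]: "sets P = sets X"
  and space_P [simp]: "space P = space X"
  using P sets_eq_imp_space_eq[of P X] by (auto simp: space_prob_algebra)

sublocale P: prob_space P by (rule prob_P)

lemma W_prob: "x \<in> space X \<Longrightarrow> prob_space (W x)" 
  and sets_W [simp]: "x \<in> space X \<Longrightarrow> sets (W x) = sets Y"
  and space_W [simp]: "x \<in> space X \<Longrightarrow> space (W x) = space Y"
  using measurable_space[OF W, of x] sets_eq_imp_space_eq[of "W x" Y] by (auto simp: space_prob_algebra)

lemma W_sub [measurable]: "W \<in> X \<rightarrow>\<^sub>M subprob_algebra Y"
  using W by (rule measurable_prob_algebraD)

lemma PY_prob: "prob_space PY" and sets_PY [measurable_cong, simp]: "sets PY = sets Y"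
  unfolding PY_def using prob_space_bind'[OF P W] sets_bind'[OF P W] by auto

lemma space_PY [simp]: "space PY = space Y"
  by (rule sets_eq_imp_space_eq) simp

sublocale PY: prob_space PY by (rule PY_prob)

lemma emeasure_PY: "B \<in> sets Y \<Longrightarrow> emeasure PY B = (\<integral>\<^sup>+x. emeasure (W x) B \<partial>P)"
  unfolding PY_def by (rule emeasure_bind_prob_algebra[OF P W])

lemma joint_kernel: "(\<lambda>x. distr (W x) (X \<Otimes>\<^sub>M Y) (\<lambda>y. (x, y))) \<in> X \<rightarrow>\<^sub>M prob_algebra (X \<Otimes>\<^sub>M Y)"
  using W by measurable

lemma J_prob: "prob_space J" and sets_J [measurable_cong, simp]: "sets J = sets (X \<Otimes>\<^sub>M Y)"
  unfolding J_def using prob_space_bind'[OF P joint_kernel] sets_bind'[OF P joint_kernel] by auto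

lemma space_J [simp]: "space J = space (X \<Otimes>\<^sub>M Y)"
  by (rule sets_eq_imp_space_eq) simp

sublocale J: prob_space J by (rule J_prob)

lemma emeasure_J:
  assumes A [measurable]: "A \<in> sets (X \<Otimes>\<^sub>M Y)"
  shows "emeasure J A = (\<integral>\<^sup>+x. emeasure (W x) (Pair x -` A) \<partial>P)"
proof -
  have "emeasure J A = (\<integral>\<^sup>+x. emeasure (distr (W x) (X \<Otimes>\<^sub>M Y) (\<lambda>y. (x, y))) A \<partial>P)"
    unfolding J_def by (rule emeasure_bind_prob_algebra[OF P joint_kernel A])
  also have "\<dots> = (\<integral>\<^sup>+x. emeasure (W x) (Pair x -` A) \<partial>P)"
  proof (rule nn_integral_cong)
    fix x assume "x \<in> space P"
    hence x: "x \<in> space X" by simp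
    have "Pair x \<in> W x \<rightarrow>\<^sub>M X \<Otimes>\<^sub>M Y"
      using measurable_Pair1'[OF x, of Y] by (simp add: measurable_cong_sets[OF sets_W[OF x] refl])
    moreover have "Pair x -` A \<inter> space (W x) = Pair x -` A"
      using sets.sets_into_space[OF A] x by (auto simp: space_pair_measure)
    ultimately show "emeasure (distr (W x) (X \<Otimes>\<^sub>M Y) (\<lambda>y. (x, y))) A = emeasure (W x) (Pair x -` A)"
      by (simp add: emeasure_distr A)
  qed
  finally show ?thesis .
qed

lemma slice_measurable:
  assumes A: "A \<in> sets (X \<Otimes>\<^sub>M Y)"
  shows "(\<lambda>x. measure (W x) (Pair x -` A)) \<in> borel_measurable X"
    "(\<lambda>x. emeasure (W x) (Pair x -` A)) \<in> borel_measurable X"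
proof -
  have e: "emeasure (W x) (Pair x -` A) = emeasure (distr (W x) (X \<Otimes>\<^sub>M Y) (\<lambda>y. (x, y))) A"
    if x: "x \<in> space X" for x
  proof -
    have "Pair x \<in> W x \<rightarrow>\<^sub>M X \<Otimes>\<^sub>M Y"
      using measurable_Pair1'[OF x, of Y] by (simp add: measurable_cong_sets[OF sets_W[OF x] refl])
    moreover have "Pair x -` A \<inter> space (W x) = Pair x -` A"
      using sets.sets_into_space[OF A] x by (auto simp: space_pair_measure)
    ultimately show ?thesis by (simp add: emeasure_distr A)
  qed
  have "(\<lambda>x. emeasure (distr (W x) (X \<Otimes>\<^sub>M Y) (\<lambda>y. (x, y))) A) \<in> borel_measurable X"
    using measurable_emeasure_subprob_algebra[OF A] measurable_prob_algebraD[OF joint_kernel]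
    by (rule measurable_compose[rotated])
  thus 1: "(\<lambda>x. emeasure (W x) (Pair x -` A)) \<in> borel_measurable X"
    by (subst measurable_cong[OF e])
  show "(\<lambda>x. measure (W x) (Pair x -` A)) \<in> borel_measurable X"
    unfolding measure_def using 1 by measurable
qed

lemma slice_sets: "A \<in> sets (X \<Otimes>\<^sub>M Y) \<Longrightarrow> Pair x -` A \<in> sets Y"
  by (rule sets_Pair1)

lemma measure_J:
  assumes A: "A \<in> sets (X \<Otimes>\<^sub>M Y)"
  shows "measure J A = (\<integral>x. measure (W x) (Pair x -` A) \<partial>P)"
    "integrable P (\<lambda>x. measure (W x) (Pair x -` A))"
proof -
  have b: "AE x in P. measure (W x) (Pair x -` A) \<le> 1"
    by (rule AE_I2) (use W_prob prob_space.prob_le_1 in force)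
  show i: "integrable P (\<lambda>x. measure (W x) (Pair x -` A))"
    by (rule P.integrable_const_bound[where B = 1]) (use b slice_measurable[OF A] in auto)
  have "ennreal (measure J A) = (\<integral>\<^sup>+x. ennreal (measure (W x) (Pair x -` A)) \<partial>P)"
    unfolding J.emeasure_eq_measure[symmetric] emeasure_J[OF A]
    by (rule nn_integral_cong) (use W_prob in \<open>auto simp: finite_measure.emeasure_eq_measure prob_space_def\<close>)
  also have "\<dots> = ennreal (\<integral>x. measure (W x) (Pair x -` A) \<partial>P)"
    by (rule nn_integral_eq_integral[OF i]) simp
  finally show "measure J A = (\<integral>x. measure (W x) (Pair x -` A) \<partial>P)"
    by (subst (asm) ennreal_inj) (auto intro!: integral_nonneg_AE)
qed

lemma measure_J_Times:
  assumes A: "A \<in> sets X" and B: "B \<in> sets Y"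
  shows "measure J (A \<times> B) = (\<integral>x. indicator A x * measure (W x) B \<partial>P)"
    "integrable P (\<lambda>x. indicator A x * measure (W x) B)"
proof -
  have e: "measure (W x) (Pair x -` (A \<times> B)) = indicator A x * measure (W x) B" for x
    by (auto simp: indicator_def)
  have "A \<times> B \<in> sets (X \<Otimes>\<^sub>M Y)" using A B by simp
  from measure_J[OF this] show "measure J (A \<times> B) = (\<integral>x. indicator A x * measure (W x) B \<partial>P)"
    "integrable P (\<lambda>x. indicator A x * measure (W x) B)" unfolding e by auto
qed

lemma measure_J_space_Times: "B \<in> sets Y \<Longrightarrow> measure J (space X \<times> B) = measure PY B"
proof -
  assume B: "B \<in> sets Y"
  have "emeasure J (space X \<times> B) = emeasure PY B"
    unfolding emeasure_J[OF pair_measureI[OF sets.top B]] emeasure_PY[OF B]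
    by (rule nn_integral_cong) (auto intro!: arg_cong2[where f = emeasure])
  thus ?thesis by (simp add: measure_def)
qed

lemma measure_J_Times_space: "A \<in> sets X \<Longrightarrow> measure J (A \<times> space Y) = measure P A"
proof -
  assume A: "A \<in> sets X"
  have "measure J (A \<times> space Y) = (\<integral>x. indicator A x * measure (W x) (space Y) \<partial>P)"
    by (rule measure_J_Times) (use A in auto)
  also have "\<dots> = (\<integral>x. indicator A x \<partial>P)"
  proof (rule Bochner_Integration.integral_cong)
    fix x assume "x \<in> space P"
    hence x: "x \<in> space X" by simp
    have "measure (W x) (space Y) = 1" using prob_space.prob_space[OF W_prob[OF x]] x by simp
    thus "indicator A x * measure (W x) (space Y) = indicator A x" by simp
  qed simp
  also have "\<dots> = measure P A" using sets.sets_into_space[OF A] by (simp add: Int_absorb2)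
  finally show ?thesis .
qed

lemma sets_R [measurable_cong, simp]: "sets R = sets (X \<Otimes>\<^sub>M Y)"
  unfolding R_def by (rule sets_pair_measure_cong) simp_all

lemma space_R [simp]: "space R = space (X \<Otimes>\<^sub>M Y)"
  by (rule sets_eq_imp_space_eq) simp

sublocale R: pair_prob_space P PY ..

lemma R_prob: "prob_space R" unfolding R_def by (rule R.prob_space_axioms)

text \<open>If the average output vanishes on B, so does \<open>W x\<close> for almost every x, in
  particular for one that dominates all outputs. The conclusion therefore holds for every v, not
  just almost every one.\<close>

lemma null_PY_imp_null_W:
  assumes "B \<in> sets Y" "emeasure PY B = 0" "v \<in> space X"
  shows "emeasure (W v) B = 0"
proof -
  have "AE x in P. emeasure (W x) B = 0"
    using assms(2) unfolding emeasure_PY[OF assms(1)]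
    by (subst (asm) nn_integral_0_iff_AE) (use assms(1) measurable_emeasure_kernel[OF W_sub] in auto)
  hence "AE x in P. x \<in> space X \<and> emeasure (W x) B = 0 \<and> (\<forall>v\<in>space X. absolutely_continuous (W x) (W v))"
    using dom AE_space[of P] by eventually_elim simp
  from P.AE_imp_ex[OF this] obtain x where x: "x \<in> space X" "emeasure (W x) B = 0"
    "absolutely_continuous (W x) (W v)" using assms(3) by blast
  hence "B \<in> null_sets (W x)" using assms(1) by (auto simp: null_sets_def)
  hence "B \<in> null_sets (W v)" using x(3) by (auto simp: absolutely_continuous_def)
  thus ?thesis by (rule null_setsD1)
qed

text \<open>By Fubini almost every slice of a product null set is null for \<open>PY\<close>, hence
  null for \<open>W x\<close>.\<close>

lemma J_ac: "absolutely_continuous R J"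
  unfolding absolutely_continuous_def
proof
  fix A assume "A \<in> null_sets R"
  hence A: "A \<in> sets (X \<Otimes>\<^sub>M Y)" "emeasure R A = 0" by (auto simp: null_sets_def)
  have A': "A \<in> sets (P \<Otimes>\<^sub>M PY)" using A(1) unfolding R_def[symmetric] by simp
  have "(\<integral>\<^sup>+x. emeasure PY (Pair x -` A) \<partial>P) = 0"
    using A(2) unfolding R_def by (subst (asm) PY.emeasure_pair_measure_alt[OF A'])
  hence "AE x in P. emeasure PY (Pair x -` A) = 0"
    by (subst (asm) nn_integral_0_iff_AE) (use PY.measurable_emeasure_Pair[OF A'] in auto)
  hence "AE x in P. emeasure (W x) (Pair x -` A) = 0"
    using AE_space by eventually_elim (use null_PY_imp_null_W slice_sets[OF A(1)] in auto)
  hence "emeasure J A = 0" unfolding emeasure_J[OF A(1)]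
    by (subst nn_integral_0_iff_AE) (use slice_measurable[OF A(1)] in auto)
  thus "A \<in> null_sets J" using A(1) by (auto simp: null_sets_def)
qed

lemma d_measurable [measurable]: "d \<in> borel_measurable (X \<Otimes>\<^sub>M Y)"
proof -
  have "d \<in> borel_measurable R" unfolding d_def by measurable
  thus ?thesis by (simp add: measurable_cong_sets[OF sets_R refl])
qed

lemma d_nonneg [simp]: "d z \<ge> 0" by (simp add: d_def)

lemma J_density: "J = density R (\<lambda>z. ennreal (d z))"
proof -
  interpret R': prob_space R by (rule R_prob)
  have "AE z in R. RN_deriv R J z \<noteq> \<infinity>"
    by (rule R'.RN_deriv_finite) (use J_ac in \<open>auto intro: J.sigma_finite_measure_axioms\<close>)
  hence "AE z in R. RN_deriv R J z = ennreal (d z)"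
    by eventually_elim (simp add: d_def less_top)
  hence "density R (RN_deriv R J) = density R (\<lambda>z. ennreal (d z))"
    by (intro density_cong) auto
  moreover have "density R (RN_deriv R J) = J"
    by (rule R'.density_RN_deriv) (use J_ac in auto)
  ultimately show ?thesis by simp
qed

lemma d_integrable:
  assumes A [measurable]: "A \<in> sets (X \<Otimes>\<^sub>M Y)"
  shows "integrable R (\<lambda>z. d z * indicator A z)" "(\<integral>z. d z * indicator A z \<partial>R) = measure J A"
proof -
  have "(\<integral>z. indicator A z \<partial>J) = measure J A" using sets.sets_into_space[OF A] by (simp add: Int_absorb2)
  moreover have "(\<integral>z. indicator A z \<partial>J) = (\<integral>z. d z * indicator A z \<partial>R)"
    by (subst J_density, rule integral_real_density) auto
  ultimately show "(\<integral>z. d z * indicator A z \<partial>R) = measure J A" by simp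
  have "integrable J (indicat_real A)" using A by (simp add: integrable_indicator_iff J.emeasure_eq_measure)
  hence "integrable (density R (\<lambda>z. ennreal (d z))) (indicat_real A)"
    by (simp only: J_density[symmetric])
  thus "integrable R (\<lambda>z. d z * indicator A z)"
    by (subst (asm) integrable_real_density) auto
qed

text \<open>As d is the density of \<open>J\<close>, the event carries at most b times its mass
  under the probability measure \<open>R\<close>. So the information density is rarely very
  negative, which later rules out nonpositive rates above \<open>I_over\<close>.\<close>

lemma measure_J_d_le:
  assumes "b \<ge> 0"
  shows "measure J {z \<in> space (X \<Otimes>\<^sub>M Y). d z \<le> b} \<le> b"
proof -
  interpret R': prob_space R by (rule R_prob)
  let ?A = "{z \<in> space (X \<Otimes>\<^sub>M Y). d z \<le> b}"
  have A: "?A \<in> sets (X \<Otimes>\<^sub>M Y)" by measurable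
  have "measure J ?A = (\<integral>z. d z * indicator ?A z \<partial>R)" using d_integrable[OF A] by simp
  also have "\<dots> \<le> (\<integral>z. b \<partial>R)"
    by (intro integral_mono d_integrable[OF A]) (use assms in \<open>auto simp: indicator_def\<close>)
  also have "\<dots> = b" using R'.prob_space by simp
  finally show ?thesis .
qed

end

subsection \<open>Soft covering\<close>

text \<open>Cauchy-Schwarz in the form |f| \<le> f^2 / (2 t) + t / 2, the arithmetic-geometric mean
  inequality with weight t.\<close>

lemma (in prob_space) expectation_abs_le_sqrt:
  fixes f :: "'a \<Rightarrow> real"
  assumes f [measurable]: "f \<in> borel_measurable M" and i2: "integrable M (\<lambda>x. (f x)\<^sup>2)"
    and i1: "integrable M f" and b: "expectation (\<lambda>x. (f x)\<^sup>2) \<le> t\<^sup>2" "t > 0"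
  shows "expectation (\<lambda>x. \<bar>f x\<bar>) \<le> t"
proof -
  have "\<bar>f x\<bar> \<le> (f x)\<^sup>2 / (2 * t) + t / 2" for x
  proof -
    have "0 \<le> (\<bar>f x\<bar> - t)\<^sup>2" by simp
    hence "2 * t * \<bar>f x\<bar> \<le> (f x)\<^sup>2 + t\<^sup>2" by (simp add: power2_diff mult_ac)
    hence "\<bar>f x\<bar> \<le> ((f x)\<^sup>2 + t\<^sup>2) / (2 * t)" using b(2) by (simp add: le_divide_eq mult.commute)
    also have "\<dots> = (f x)\<^sup>2 / (2 * t) + t / 2" using b(2) by (simp add: add_divide_distrib power2_eq_square)
    finally show ?thesis .
  qed
  hence "expectation (\<lambda>x. \<bar>f x\<bar>) \<le> expectation (\<lambda>x. (f x)\<^sup>2 / (2 * t) + t / 2)"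
    by (intro integral_mono) (use i1 i2 in auto)
  also have "\<dots> = expectation (\<lambda>x. (f x)\<^sup>2) / (2 * t) + t / 2"
    using i2 by (simp add: prob_space)
  also have "\<dots> \<le> t\<^sup>2 / (2 * t) + t / 2"
    using b by (intro add_right_mono divide_right_mono) auto
  also have "\<dots> = t" using b(2) by (simp add: power2_eq_square)
  finally show ?thesis .
qed

text \<open>The codewords are chosen one after the other: on average over the next one, the squared
  distance of the partial sum from its mean grows by at most \<open>b\<close>, so some choice does no worse.\<close>

lemma (in prob_space) average_selection:
  fixes p :: "'k \<Rightarrow> real" and g :: "'k \<Rightarrow> 'a \<Rightarrow> real"
  assumes T: "finite T" and p: "\<And>k. k \<in> T \<Longrightarrow> p k \<ge> 0" "sum p T = 1"
    and gm [measurable]: "\<And>k. k \<in> T \<Longrightarrow> g k \<in> borel_measurable M"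
    and gb: "\<And>k x. k \<in> T \<Longrightarrow> 0 \<le> g k x" "\<And>k x. k \<in> T \<Longrightarrow> g k x \<le> b"
    and g1: "\<And>k. k \<in> T \<Longrightarrow> expectation (g k) \<le> 1"
    and h: "h = (\<lambda>x. \<Sum>k\<in>T. p k * g k x)" and b: "b \<ge> 0"
  shows "\<exists>\<kappa>. (\<forall>i\<in>{1..m::nat}. \<kappa> i \<in> T) \<and> expectation (\<lambda>x. (\<Sum>i=1..m. g (\<kappa> i) x - h x)\<^sup>2) \<le> m * b"
proof (induction m)
  case 0 show ?case by simp
next
  case (Suc m)
  then obtain \<kappa> where \<kappa>: "\<And>i. i \<in> {1..m} \<Longrightarrow> \<kappa> i \<in> T"
    "expectation (\<lambda>x. (\<Sum>i=1..m. g (\<kappa> i) x - h x)\<^sup>2) \<le> m * b" by blast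
  define S where "S = (\<lambda>x. \<Sum>i=1..m. g (\<kappa> i) x - h x)"
  have hm [measurable]: "h \<in> borel_measurable M" unfolding h by measurable
  have hb: "0 \<le> h x" "h x \<le> b" for x
  proof -
    show "0 \<le> h x" unfolding h using p gb by (auto intro!: sum_nonneg mult_nonneg_nonneg)
    have "h x \<le> (\<Sum>k\<in>T. p k * b)" unfolding h using p gb by (auto intro!: sum_mono mult_left_mono)
    thus "h x \<le> b" using p(2) by (simp add: sum_distrib_right[symmetric])
  qed
  have Sm [measurable]: "S \<in> borel_measurable M" unfolding S_def using \<kappa>(1) by measurable
  have dif: "\<bar>g k x - h x\<bar> \<le> b" if "k \<in> T" for k x using gb[OF that, of x] hb[of x] by linarith
  have Sb: "\<bar>S x\<bar> \<le> m * b" for x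
  proof -
    have "\<bar>S x\<bar> \<le> (\<Sum>i=1..m. \<bar>g (\<kappa> i) x - h x\<bar>)" unfolding S_def by (rule sum_abs)
    also have "\<dots> \<le> (\<Sum>i=1..m. b)" using dif \<kappa>(1) by (intro sum_mono) auto
    finally show ?thesis by simp
  qed
  have int: "integrable M (\<lambda>x. (S x + g k x - h x)\<^sup>2)" if k: "k \<in> T" for k
  proof (rule integrable_const_bound[where B = "(m * b + b)\<^sup>2"])
    show "AE x in M. norm ((S x + g k x - h x)\<^sup>2) \<le> (m * b + b)\<^sup>2"
    proof (rule AE_I2)
      fix x
      have "\<bar>S x + g k x - h x\<bar> \<le> \<bar>m * b + b\<bar>" using Sb[of x] dif[OF k, of x] by linarith
      thus "norm ((S x + g k x - h x)\<^sup>2) \<le> (m * b + b)\<^sup>2" by (simp add: abs_le_square_iff)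
    qed
  qed (use k in measurable)
  have intS: "integrable M (\<lambda>x. (S x)\<^sup>2)"
  proof (rule integrable_const_bound[where B = "(m * b)\<^sup>2"])
    show "AE x in M. norm ((S x)\<^sup>2) \<le> (m * b)\<^sup>2"
      using Sb b by (intro AE_I2) (simp add: abs_le_square_iff[symmetric])
  qed measurable
  have intg: "integrable M (g k)" if k: "k \<in> T" for k
    by (rule integrable_const_bound[where B = b]) (use k gb in auto)
  have "\<exists>k\<in>T. expectation (\<lambda>x. (S x + g k x - h x)\<^sup>2) \<le> m * b + b"
  proof (rule ccontr)
    assume *: "\<not> (\<exists>k\<in>T. expectation (\<lambda>x. (S x + g k x - h x)\<^sup>2) \<le> m * b + b)"
    \<comment> \<open>A positive weight is needed for the average over k to exceed the bound
      strictly.\<close>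
    obtain k0 where k0: "k0 \<in> T" "p k0 > 0"
    proof (rule ccontr)
      assume "\<not> thesis"
      hence "p k \<le> 0" if "k \<in> T" for k using that \<open>\<And>k0. \<lbrakk>k0 \<in> T; 0 < p k0\<rbrakk> \<Longrightarrow> thesis\<close> by force
      hence "sum p T \<le> 0" by (rule sum_nonpos)
      thus False using p(2) by simp
    qed
    have "m * b + b = (\<Sum>k\<in>T. p k * (m * b + b))" using p(2) by (simp add: sum_distrib_right[symmetric])
    also have "\<dots> < (\<Sum>k\<in>T. p k * expectation (\<lambda>x. (S x + g k x - h x)\<^sup>2))"
    proof (rule sum_strict_mono_ex1[OF T])
      show "\<forall>k\<in>T. p k * (m * b + b) \<le> p k * expectation (\<lambda>x. (S x + g k x - h x)\<^sup>2)"
        using * p(1) by (auto intro!: mult_left_mono simp: not_le less_imp_le)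
      show "\<exists>k\<in>T. p k * (m * b + b) < p k * expectation (\<lambda>x. (S x + g k x - h x)\<^sup>2)"
        using * k0 by (intro bexI[of _ k0] mult_strict_left_mono) (auto simp: not_le)
    qed
    also have "\<dots> = expectation (\<lambda>x. \<Sum>k\<in>T. p k * (S x + g k x - h x)\<^sup>2)"
      using int by (simp add: Bochner_Integration.integral_sum)
    also have "\<dots> \<le> expectation (\<lambda>x. (S x)\<^sup>2 + (\<Sum>k\<in>T. p k * (b * g k x)))"
    proof (rule integral_mono)
      show "integrable M (\<lambda>x. \<Sum>k\<in>T. p k * (S x + g k x - h x)\<^sup>2)" using int by auto
      show "integrable M (\<lambda>x. (S x)\<^sup>2 + (\<Sum>k\<in>T. p k * (b * g k x)))" using intS intg by auto
      fix x
      \<comment> \<open>Because h is the p-average of the g, the cross terms leave S^2 - h^2: the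
        increase is the pointwise variance of g under p, at most b times its mean.\<close>
      have "(\<Sum>k\<in>T. p k * (S x + g k x - h x)\<^sup>2)
          = (\<Sum>k\<in>T. p k * (S x - h x)\<^sup>2 + 2 * (S x - h x) * (p k * g k x) + p k * (g k x)\<^sup>2)"
        by (intro sum.cong refl) (simp add: power2_eq_square algebra_simps)
      also have "\<dots> = (\<Sum>k\<in>T. p k) * (S x - h x)\<^sup>2 + 2 * (S x - h x) * h x + (\<Sum>k\<in>T. p k * (g k x)\<^sup>2)"
        by (simp add: sum.distrib sum_distrib_left sum_distrib_right h)
      also have "\<dots> = (S x)\<^sup>2 - (h x)\<^sup>2 + (\<Sum>k\<in>T. p k * (g k x)\<^sup>2)"
        using p(2) by (simp add: power2_eq_square algebra_simps)
      also have "\<dots> \<le> (S x)\<^sup>2 + (\<Sum>k\<in>T. p k * (b * g k x))"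
      proof -
        have "(\<Sum>k\<in>T. p k * (g k x)\<^sup>2) \<le> (\<Sum>k\<in>T. p k * (b * g k x))"
          using p(1) gb by (intro sum_mono mult_left_mono) (auto simp: power2_eq_square intro!: mult_right_mono)
        thus ?thesis using zero_le_power2[of "h x"] by linarith
      qed
      finally show "(\<Sum>k\<in>T. p k * (S x + g k x - h x)\<^sup>2) \<le> (S x)\<^sup>2 + (\<Sum>k\<in>T. p k * (b * g k x))" .
    qed
    also have "\<dots> = expectation (\<lambda>x. (S x)\<^sup>2) + (\<Sum>k\<in>T. p k * (b * expectation (g k)))"
      using intS intg by (simp add: Bochner_Integration.integral_sum)
    also have "\<dots> \<le> m * b + (\<Sum>k\<in>T. p k * (b * 1))"
      using \<kappa>(2) p(1) g1 b by (intro add_mono sum_mono mult_left_mono) (auto simp: S_def)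
    also have "(\<Sum>k\<in>T. p k * (b * 1)) = b" using p(2) by (simp add: sum_distrib_right[symmetric])
    finally show False by simp
  qed
  then obtain k where k: "k \<in> T" "expectation (\<lambda>x. (S x + g k x - h x)\<^sup>2) \<le> m * b + b" by blast
  have "(\<Sum>i=1..Suc m. g ((\<kappa>(Suc m := k)) i) x - h x) = S x + g k x - h x" for x
    by (simp add: S_def)
  moreover have "\<forall>i\<in>{1..Suc m}. (\<kappa>(Suc m := k)) i \<in> T" using \<kappa>(1) k(1) by auto
  moreover have "real (Suc m) * b = m * b + b" by (simp add: distrib_right)
  ultimately show ?case using k(2) by (intro exI[of _ "\<kappa>(Suc m := k)"]) (simp only: simp_thms)
qed

text \<open>The second moment of the sum, at most m b, is divided by m^2, so the empirical mean is
  within sqrt(b / m) of its target in L1: it suffices that m is large compared with b. Only the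
  lower bound is kept, because the g will be truncated densities, of mass at most 1.\<close>

lemma (in prob_space) soft_covering:
  fixes p :: "'k \<Rightarrow> real" and g :: "'k \<Rightarrow> 'a \<Rightarrow> real"
  assumes T: "finite T" and p: "\<And>k. k \<in> T \<Longrightarrow> p k \<ge> 0" "sum p T = 1"
    and gm [measurable]: "\<And>k. k \<in> T \<Longrightarrow> g k \<in> borel_measurable M"
    and gb: "\<And>k x. k \<in> T \<Longrightarrow> 0 \<le> g k x" "\<And>k x. k \<in> T \<Longrightarrow> g k x \<le> b"
    and g1: "\<And>k. k \<in> T \<Longrightarrow> expectation (g k) \<le> 1"
    and b: "b > 0" and m: "m \<ge> 1"
  shows "\<exists>\<kappa>. (\<forall>i\<in>{1..m::nat}. \<kappa> i \<in> T) \<and> (\<forall>B\<in>sets M.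
      (\<Sum>k\<in>T. p k * expectation (\<lambda>x. g k x * indicator B x)) - sqrt (b / m)
        \<le> (\<Sum>i=1..m. expectation (\<lambda>x. g (\<kappa> i) x * indicator B x)) / m)"
proof -
  define h where "h = (\<lambda>x. \<Sum>k\<in>T. p k * g k x)"
  have "\<exists>\<kappa>. (\<forall>i\<in>{1..m}. \<kappa> i \<in> T) \<and> expectation (\<lambda>x. (\<Sum>i=1..m. g (\<kappa> i) x - h x)\<^sup>2) \<le> m * b"
    by (rule average_selection[OF T p gm gb g1 h_def]) (use b in auto)
  then obtain \<kappa> where \<kappa>: "\<And>i. i \<in> {1..m} \<Longrightarrow> \<kappa> i \<in> T"
    "expectation (\<lambda>x. (\<Sum>i=1..m. g (\<kappa> i) x - h x)\<^sup>2) \<le> m * b"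
    by blast
  define f where "f = (\<lambda>x. (\<Sum>i=1..m. g (\<kappa> i) x - h x) / m)"
  have mp: "real m > 0" using m by simp
  have intg: "integrable M (g k)" if k: "k \<in> T" for k
    by (rule integrable_const_bound[where B = b]) (use k gb in auto)
  have intgB: "integrable M (\<lambda>x. g k x * indicator B x)" if k: "k \<in> T" "B \<in> sets M" for k B
    using intg[OF k(1)] k(2) by (rule integrable_real_mult_indicator[rotated])
  have inth: "integrable M h" unfolding h_def using intg by auto
  have intf: "integrable M f" unfolding f_def
    by (intro Bochner_Integration.integrable_divide Bochner_Integration.integrable_sum
        Bochner_Integration.integrable_diff intg inth \<kappa>(1)) simp_all
  have fm [measurable]: "f \<in> borel_measurable M" using intf by (rule borel_measurable_integrable)
  have hb: "0 \<le> h x" "h x \<le> b" for x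
  proof -
    show "0 \<le> h x" unfolding h_def using p gb by (auto intro!: sum_nonneg mult_nonneg_nonneg)
    have "h x \<le> (\<Sum>k\<in>T. p k * b)" unfolding h_def using p gb by (auto intro!: sum_mono mult_left_mono)
    thus "h x \<le> b" using p(2) by (simp add: sum_distrib_right[symmetric])
  qed
  have fb: "\<bar>f x\<bar> \<le> b" for x
  proof -
    have "\<bar>\<Sum>i=1..m. g (\<kappa> i) x - h x\<bar> \<le> (\<Sum>i=1..m. \<bar>g (\<kappa> i) x - h x\<bar>)" by (rule sum_abs)
    also have "\<dots> \<le> (\<Sum>i=1..m. b)"
    proof (rule sum_mono)
      fix i assume "i \<in> {1..m}"
      from gb[OF \<kappa>(1)[OF this], of x] hb[of x] show "\<bar>g (\<kappa> i) x - h x\<bar> \<le> b" by linarith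
    qed
    finally show ?thesis using mp by (simp add: f_def divide_le_eq mult.commute)
  qed
  have f2: "integrable M (\<lambda>x. (f x)\<^sup>2)"
  proof (rule integrable_const_bound[where B = "b\<^sup>2"])
    show "AE x in M. norm ((f x)\<^sup>2) \<le> b\<^sup>2"
      using fb b by (intro AE_I2) (simp add: abs_le_square_iff[symmetric])
  qed measurable
  have "expectation (\<lambda>x. (f x)\<^sup>2) = expectation (\<lambda>x. (\<Sum>i=1..m. g (\<kappa> i) x - h x)\<^sup>2) / (real m)\<^sup>2"
    by (simp add: f_def power_divide)
  also have "\<dots> \<le> m * b / (real m)\<^sup>2" using \<kappa>(2) by (rule divide_right_mono) simp
  also have "\<dots> = (sqrt (b / m))\<^sup>2" using b mp by (simp add: power2_eq_square)
  finally have "expectation (\<lambda>x. (f x)\<^sup>2) \<le> (sqrt (b / m))\<^sup>2" .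
  hence L1: "expectation (\<lambda>x. \<bar>f x\<bar>) \<le> sqrt (b / m)"
    by (intro expectation_abs_le_sqrt) (use f2 intf b mp in auto)
  have "(\<Sum>k\<in>T. p k * expectation (\<lambda>x. g k x * indicator B x)) - sqrt (b / m)
        \<le> (\<Sum>i=1..m. expectation (\<lambda>x. g (\<kappa> i) x * indicator B x)) / m" if B: "B \<in> sets M" for B
  proof -
    have e1: "(\<Sum>k\<in>T. p k * expectation (\<lambda>x. g k x * indicator B x)) = expectation (\<lambda>x. h x * indicator B x)"
    proof -
      have "expectation (\<lambda>x. h x * indicator B x) = expectation (\<lambda>x. \<Sum>k\<in>T. p k * (g k x * indicator B x))"
        by (simp add: h_def sum_distrib_right mult.assoc)
      also have "\<dots> = (\<Sum>k\<in>T. p k * expectation (\<lambda>x. g k x * indicator B x))"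
        using intgB[OF _ B] by (subst Bochner_Integration.integral_sum) auto
      finally show ?thesis by simp
    qed
    have ihB: "integrable M (\<lambda>x. h x * indicator B x)" and ifB: "integrable M (\<lambda>x. f x * indicator B x)"
      using inth intf B by (auto intro: integrable_real_mult_indicator)
    have "(\<Sum>i=1..m. expectation (\<lambda>x. g (\<kappa> i) x * indicator B x))
        = expectation (\<lambda>x. \<Sum>i=1..m. g (\<kappa> i) x * indicator B x)"
      by (rule Bochner_Integration.integral_sum[symmetric]) (rule intgB[OF \<kappa>(1) B])
    hence "(\<Sum>i=1..m. expectation (\<lambda>x. g (\<kappa> i) x * indicator B x)) / m
        = expectation (\<lambda>x. (\<Sum>i=1..m. g (\<kappa> i) x * indicator B x) / m)"
      by (simp only: integral_divide_zero)
    also have "\<dots> = expectation (\<lambda>x. h x * indicator B x + f x * indicator B x)"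
    proof (rule Bochner_Integration.integral_cong[OF refl])
      fix x
      have "f x = (\<Sum>i=1..m. g (\<kappa> i) x) / m - h x" using mp by (simp add: f_def sum_subtractf diff_divide_distrib)
      thus "(\<Sum>i=1..m. g (\<kappa> i) x * indicator B x) / m = h x * indicator B x + f x * indicator B x"
        by (cases "x \<in> B") simp_all
    qed
    also have "\<dots> = expectation (\<lambda>x. h x * indicator B x) + expectation (\<lambda>x. f x * indicator B x)"
      using ihB ifB by simp
    finally have e2: "(\<Sum>i=1..m. expectation (\<lambda>x. g (\<kappa> i) x * indicator B x)) / m = \<dots>" .
    have "- expectation (\<lambda>x. f x * indicator B x) = expectation (\<lambda>x. - (f x * indicator B x))" by simp
    also have "\<dots> \<le> expectation (\<lambda>x. \<bar>f x\<bar>)"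
      by (rule integral_mono) (use ifB intf in \<open>auto simp: indicator_def\<close>)
    finally show ?thesis unfolding e1 e2 using L1 by linarith
  qed
  thus ?thesis using \<kappa>(1) by blast
qed

context dominated_channel
begin

text \<open>Averaging the truncated density over the cells of a partition on which the channel is nearly
  constant reduces the covering problem to a finite input alphabet. This avoids any appeal to the
  uniqueness of conditional distributions, which may fail for an arbitrary output space.\<close>

lemma cell_covering:
  assumes T: "finite T" "\<And>x. x \<in> A \<Longrightarrow> q x \<in> T" and A: "A \<subseteq> space X" "AE x in P. x \<in> A"
    and cell: "\<And>k. {x \<in> space X. q x = k} \<in> sets X"
    and close: "\<And>x v B. x \<in> A \<Longrightarrow> v \<in> A \<Longrightarrow> B \<in> sets Y \<Longrightarrow> q x = q v \<Longrightarrow>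
        \<bar>measure (W x) B - measure (W v) B\<bar> \<le> \<eta>"
    and b: "b > 0" and M: "(M::nat) \<ge> 1"
  shows "\<exists>\<phi>. (\<forall>i\<in>{1..M}. \<phi> i \<in> A) \<and> (\<forall>B\<in>sets Y.
     \<bar>measure PY B - (\<Sum>i=1..M. measure (W (\<phi> i)) B) / M\<bar>
        \<le> measure J {z \<in> space (X \<Otimes>\<^sub>M Y). d z > b} + sqrt (b / M) + \<eta>)"
proof -
  define c where "c k = {x \<in> space X. q x = k}" for k
  have c [measurable]: "c k \<in> sets X" for k using cell by (simp add: c_def)
  define p where "p k = measure P (c k)" for k
  \<comment> \<open>Null cells are discarded: a cell of positive probability meets the set A of full
    measure and so has a representative in A.\<close>
  define T' where "T' = {k \<in> T. p k > 0}"
  have T': "finite T'" using T(1) by (simp add: T'_def)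
  have pT: "sum p T' = 1"
  proof -
    have "sum p T' = sum p T"
      by (rule sum.mono_neutral_left) (use T(1) in \<open>auto simp: T'_def p_def zero_less_measure_iff\<close>)
    also have "\<dots> = measure P (\<Union>k\<in>T. c k)" unfolding p_def
      by (rule P.finite_measure_finite_Union[symmetric]) (use T(1) c in \<open>auto simp: disjoint_family_on_def c_def\<close>)
    also have "\<dots> = 1"
    proof (subst P.prob_eq_1)
      show "(\<Union>k\<in>T. c k) \<in> P.events" using T(1) by auto
      show "AE x in P. x \<in> (\<Union>k\<in>T. c k)"
        using A(2) AE_space by eventually_elim (use T(2) in \<open>auto simp: c_def\<close>)
    qed
    finally show ?thesis .
  qed
  have "\<exists>x\<in>A. q x = k" if k: "k \<in> T'" for k
  proof (rule ccontr)
    assume n: "\<not> (\<exists>x\<in>A. q x = k)"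
    have "AE x in P. x \<notin> c k" using A(2) by eventually_elim (use n in \<open>auto simp: c_def\<close>)
    hence "p k = 0" unfolding p_def using c by (subst P.prob_eq_0) auto
    thus False using k by (simp add: T'_def)
  qed
  then obtain rep where rep: "\<And>k. k \<in> T' \<Longrightarrow> rep k \<in> A" "\<And>k. k \<in> T' \<Longrightarrow> q (rep k) = k" by metis
  define G where "G = {z \<in> space (X \<Otimes>\<^sub>M Y). d z \<le> b}"
  have G [measurable]: "G \<in> sets (X \<Otimes>\<^sub>M Y)" unfolding G_def by measurable
  define f where "f k z = d z * indicator ((c k \<times> space Y) \<inter> G) z" for k z
  have f_meas [measurable]: "f k \<in> borel_measurable (X \<Otimes>\<^sub>M Y)" for k
  proof -
    have "(c k \<times> space Y) \<inter> G \<in> sets (X \<Otimes>\<^sub>M Y)" by measurable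
    thus ?thesis unfolding f_def by measurable
  qed
  have f_bound: "0 \<le> f k z" "f k z \<le> b" "f k (x, y) \<le> b * indicator (c k) x" for k z x y
    using b by (auto simp: f_def G_def indicator_def)
  \<comment> \<open>The truncated density averaged over a cell: a sub-density with respect to
    \<open>PY\<close> of the output given that the input lies in the cell, bounded by b as the
    covering lemma requires.\<close>
  define g where "g k y = (\<integral>x. f k (x, y) \<partial>P) / p k" for k y
  have f_int: "integrable P (\<lambda>x. f k (x, y))" if "y \<in> space Y" for k y
  proof (rule P.integrable_const_bound[where B = b])
    show "(\<lambda>x. f k (x, y)) \<in> borel_measurable P"
      using measurable_compose[OF measurable_Pair2'[OF that, of X] f_meas[of k]]
      by (simp add: measurable_cong_sets[OF sets_P refl])
  qed (use f_bound in auto)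
  have gm: "g k \<in> borel_measurable PY" for k unfolding g_def by measurable
  have g0: "0 \<le> g k y" for k y
    unfolding g_def using f_bound by (auto simp: p_def intro!: divide_nonneg_nonneg integral_nonneg_AE)
  have gb: "g k y \<le> b" for k y
  proof (cases "integrable P (\<lambda>x. f k (x, y))")
    case True
    have "(\<integral>x. f k (x, y) \<partial>P) \<le> (\<integral>x. b * indicator (c k) x \<partial>P)"
      by (rule integral_mono[OF True]) (use f_bound in \<open>auto simp: P.emeasure_eq_measure\<close>)
    also have "\<dots> = b * p k" using sets.sets_into_space[OF c[of k]] by (simp add: p_def Int_absorb2)
    finally show ?thesis using b by (cases "p k = 0") (auto simp: g_def divide_le_eq p_def zero_less_measure_iff)
  next
    \<comment> \<open>Only possible for y outside the space, where the integral is 0 by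
      default.\<close>
    case False
    thus ?thesis using b by (simp add: g_def not_integrable_integral_eq)
  qed
  have gB: "p k * (\<integral>y. g k y * indicator B y \<partial>PY) = measure J ((c k \<times> B) \<inter> G)"
    if k: "k \<in> T'" and B: "B \<in> sets Y" for k B
  proof -
    have BS: "B \<subseteq> space Y" using sets.sets_into_space[OF B] .
    have S: "(c k \<times> B) \<inter> G \<in> sets (X \<Otimes>\<^sub>M Y)" using B by measurable
    have pk: "p k > 0" using k by (simp add: T'_def)
    have e: "f k (x, y) * indicator B y = d (x, y) * indicator ((c k \<times> B) \<inter> G) (x, y)" for x y
      using BS by (auto simp: f_def indicator_def)
    have "p k * (\<integral>y. g k y * indicator B y \<partial>PY) = (\<integral>y. p k * (g k y * indicator B y) \<partial>PY)" by simp
    also have "\<dots> = (\<integral>y. (\<integral>x. d (x, y) * indicator ((c k \<times> B) \<inter> G) (x, y) \<partial>P) \<partial>PY)"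
    proof (rule Bochner_Integration.integral_cong[OF refl])
      fix y
      have "p k * (g k y * indicator B y) = (\<integral>x. f k (x, y) \<partial>P) * indicator B y" using pk by (simp add: g_def)
      also have "\<dots> = (\<integral>x. f k (x, y) * indicator B y \<partial>P)" by simp
      finally show "p k * (g k y * indicator B y) = (\<integral>x. d (x, y) * indicator ((c k \<times> B) \<inter> G) (x, y) \<partial>P)"
        unfolding e .
    qed
    also have "\<dots> = (\<integral>z. d z * indicator ((c k \<times> B) \<inter> G) z \<partial>R)"
      using R.integral_snd[of "\<lambda>x y. d (x, y) * indicator ((c k \<times> B) \<inter> G) (x, y)"] d_integrable(1)[OF S]
      by (simp add: case_prod_beta' R_def)
    also have "\<dots> = measure J ((c k \<times> B) \<inter> G)" by (rule d_integrable[OF S])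
    finally show ?thesis .
  qed
  have gW: "(\<integral>y. g k y * indicator B y \<partial>PY) \<le> measure (W (rep k)) B + \<eta>" if k: "k \<in> T'" and B: "B \<in> sets Y" for k B
  proof -
    have pk: "p k > 0" using k by (simp add: T'_def)
    \<comment> \<open>Dropping the truncation only adds mass; what remains averages
      \<open>W x\<close> over the cell, where it differs from \<open>W (rep k)\<close> by at most
      \<eta>.\<close>
    have "p k * (\<integral>y. g k y * indicator B y \<partial>PY) \<le> measure J (c k \<times> B)"
      unfolding gB[OF k B] using B by (intro J.finite_measure_mono) auto
    also have "\<dots> = (\<integral>x. indicator (c k) x * measure (W x) B \<partial>P)" by (rule measure_J_Times[OF c B])
    also have "\<dots> \<le> (\<integral>x. indicator (c k) x * (measure (W (rep k)) B + \<eta>) \<partial>P)"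
    proof (rule integral_mono_AE[OF measure_J_Times(2)[OF c B]])
      show "integrable P (\<lambda>x. indicator (c k) x * (measure (W (rep k)) B + \<eta>))"
        by (intro integrable_mult_left) (simp add: P.emeasure_eq_measure)
      show "AE x in P. indicator (c k) x * measure (W x) B \<le> indicator (c k) x * (measure (W (rep k)) B + \<eta>)"
        using A(2)
      proof eventually_elim
        case (elim x)
        show ?case using close[OF elim rep(1)[OF k] B] rep(2)[OF k]
          by (auto simp: indicator_def c_def)
      qed
    qed
    also have "\<dots> = p k * (measure (W (rep k)) B + \<eta>)"
      using sets.sets_into_space[OF c[of k]] by (simp add: p_def Int_absorb2)
    finally show ?thesis using pk by simp
  qed
  have g1: "(\<integral>y. g k y \<partial>PY) \<le> 1" if k: "k \<in> T'" for k
  proof -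
    have pk: "p k > 0" using k by (simp add: T'_def)
    have "p k * (\<integral>y. g k y * indicator (space Y) y \<partial>PY) \<le> measure J (c k \<times> space Y)"
      unfolding gB[OF k sets.top] by (intro J.finite_measure_mono) auto
    also have "\<dots> = p k * 1" unfolding p_def using measure_J_Times_space[OF c] by simp
    also have "(\<integral>y. g k y * indicator (space Y) y \<partial>PY) = (\<integral>y. g k y \<partial>PY)"
      by (rule Bochner_Integration.integral_cong) auto
    finally show ?thesis using pk by simp
  qed
  \<comment> \<open>What the cells lose of \<open>PY\<close> is the mass cut off at b; the discarded
    cells are null.\<close>
  have tot: "measure PY B - measure J {z \<in> space (X \<Otimes>\<^sub>M Y). d z > b}
      \<le> (\<Sum>k\<in>T'. p k * (\<integral>y. g k y * indicator B y \<partial>PY))" if B: "B \<in> sets Y" for B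
  proof -
    define N where "N = space X - (\<Union>k\<in>T'. c k)"
    have N: "N \<in> sets X" unfolding N_def by (intro sets.Diff sets.top sets.finite_UN T' c)
    have "measure P (\<Union>k\<in>T'. c k) = sum p T'" unfolding p_def
      by (rule P.finite_measure_finite_Union) (use T' c in \<open>auto simp: disjoint_family_on_def c_def\<close>)
    moreover have "(\<Union>k\<in>T'. c k) \<in> P.events" using T' c by (simp add: sets.finite_UN)
    ultimately have "measure P N = 0" unfolding N_def using P.prob_compl[of "\<Union>k\<in>T'. c k"] pT by simp
    hence JN: "measure J (N \<times> space Y) = 0" using measure_J_Times_space[OF N] by simp
    let ?G' = "{z \<in> space (X \<Otimes>\<^sub>M Y). d z > b}"
    let ?U = "\<Union>k\<in>T'. (c k \<times> B) \<inter> G"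
    have G': "?G' \<in> sets (X \<Otimes>\<^sub>M Y)" by measurable
    have U: "?U \<in> sets (X \<Otimes>\<^sub>M Y)" using T' B by (intro sets.finite_UN) auto
    have "measure PY B = measure J (space X \<times> B)" by (rule measure_J_space_Times[OF B, symmetric])
    also have "\<dots> \<le> measure J (?U \<union> (?G' \<union> N \<times> space Y))"
    proof (rule J.finite_measure_mono)
      show "space X \<times> B \<subseteq> ?U \<union> (?G' \<union> N \<times> space Y)"
        using sets.sets_into_space[OF B] by (auto simp: N_def G_def space_pair_measure)
      show "?U \<union> (?G' \<union> N \<times> space Y) \<in> J.events" using U G' N by auto
    qed
    also have "\<dots> \<le> measure J ?U + (measure J ?G' + measure J (N \<times> space Y))"
      by (rule order_trans[OF measure_Un_le add_left_mono[OF measure_Un_le]])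
        (use U G' N in auto)
    also have "measure J ?U \<le> (\<Sum>k\<in>T'. measure J ((c k \<times> B) \<inter> G))"
      by (rule measure_UNION_le) (use T' B in auto)
    also have "\<dots> = (\<Sum>k\<in>T'. p k * (\<integral>y. g k y * indicator B y \<partial>PY))"
      by (rule sum.cong) (use gB B in auto)
    finally show ?thesis using JN by simp
  qed
  have "\<exists>\<kappa>. (\<forall>i\<in>{1..M}. \<kappa> i \<in> T') \<and> (\<forall>B\<in>sets PY.
      (\<Sum>k\<in>T'. p k * (\<integral>x. g k x * indicator B x \<partial>PY)) - sqrt (b / M)
        \<le> (\<Sum>i=1..M. (\<integral>x. g (\<kappa> i) x * indicator B x \<partial>PY)) / M)"
    by (rule PY.soft_covering) (use T' pT gm g0 gb g1 b M in \<open>auto simp: T'_def\<close>)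
  then obtain \<kappa> where \<kappa>0: "(\<forall>i\<in>{1..M}. \<kappa> i \<in> T') \<and> (\<forall>B\<in>sets PY.
      (\<Sum>k\<in>T'. p k * (\<integral>x. g k x * indicator B x \<partial>PY)) - sqrt (b / M)
        \<le> (\<Sum>i=1..M. (\<integral>x. g (\<kappa> i) x * indicator B x \<partial>PY)) / M)" ..
  have \<kappa>: "\<And>i. i \<in> {1..M} \<Longrightarrow> \<kappa> i \<in> T'"
    "\<And>B. B \<in> sets Y \<Longrightarrow> (\<Sum>k\<in>T'. p k * (\<integral>x. g k x * indicator B x \<partial>PY)) - sqrt (b / M)
        \<le> (\<Sum>i=1..M. (\<integral>x. g (\<kappa> i) x * indicator B x \<partial>PY)) / M"
    using \<kappa>0 by simp_all
  define avg where "avg B = (\<Sum>i=1..M. measure (W (rep (\<kappa> i))) B) / M" for B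
  let ?err = "measure J {z \<in> space (X \<Otimes>\<^sub>M Y). d z > b} + sqrt (b / M) + \<eta>"
  have one: "measure PY B - avg B \<le> ?err" if B: "B \<in> sets Y" for B
  proof -
    have "(\<Sum>i=1..M. (\<integral>x. g (\<kappa> i) x * indicator B x \<partial>PY)) / M \<le> (\<Sum>i=1..M. measure (W (rep (\<kappa> i))) B + \<eta>) / M"
      by (intro divide_right_mono sum_mono gW \<kappa>(1) B) auto
    also have "\<dots> = avg B + \<eta>" using M by (simp add: avg_def sum.distrib add_divide_distrib)
    finally show ?thesis using \<kappa>(2)[OF B] tot[OF B] by linarith
  qed
  have repX: "rep (\<kappa> i) \<in> space X" if "i \<in> {1..M}" for i using rep(1)[OF \<kappa>(1)[OF that]] A(1) by auto
  \<comment> \<open>Both are probabilities, so the one-sided bound on the complement of B is the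
    reverse bound on B.\<close>
  have "\<bar>measure PY B - avg B\<bar> \<le> ?err" if B: "B \<in> sets Y" for B
  proof -
    have "avg (space Y - B) = (\<Sum>i=1..M. 1 - measure (W (rep (\<kappa> i))) B) / M"
      unfolding avg_def
    proof (intro arg_cong2[where f = "(/)"] sum.cong refl)
      fix i assume i: "i \<in> {1..M}"
      show "measure (W (rep (\<kappa> i))) (space Y - B) = 1 - measure (W (rep (\<kappa> i))) B"
        using prob_space.prob_compl[OF W_prob[OF repX[OF i]], of B] repX[OF i] B by simp
    qed
    also have "\<dots> = 1 - avg B" using M by (simp add: avg_def sum_subtractf diff_divide_distrib)
    finally have "avg (space Y - B) = 1 - avg B" .
    moreover have "measure PY (space Y - B) = 1 - measure PY B" using PY.prob_compl[of B] B by simp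
    ultimately show ?thesis using one[OF B] one[of "space Y - B"] B by auto
  qed
  thus ?thesis using rep(1) \<kappa>(1) unfolding avg_def by (intro exI[of _ "\<lambda>i. rep (\<kappa> i)"]) auto
qed

end

subsection \<open>Resolvability versus information density\<close>

text \<open>Finiteness of the divergence includes absolute continuity, and (A2) asks it for
  reference points x in the cube and all v: the asymmetric form of domination in the locale.\<close>

lemma dominated_channel_of_A1_A2:
  assumes ch: "general_channel MY W" and A: "A1_A2 W c \<Gamma>" and P: "P \<in> S_Gamma c \<Gamma>" and n: "n > 0"
  shows "dominated_channel (Xsp n) (Ysp MY n) (P n) (W n)"
proof
  show "P n \<in> space (prob_algebra (Xsp n))" using P n by (simp add: S_Gamma_def)
  show "W n \<in> Xsp n \<rightarrow>\<^sub>M prob_algebra (Ysp MY n)" by (rule channel_measurable[OF ch n])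
  from A[unfolded A1_A2_def] obtain a l H where
    lsub: "\<forall>n>0. l n \<ge> (2::real) \<and> XG c \<Gamma> n \<subseteq> cube n (a n) (l n)"
    and KL: "\<forall>n>0. \<forall>x\<in>cube n (a n) (l n).
          (\<forall>v\<in>Rn n. KLdiv (W n v) (W n x) < \<infinity>)
        \<and> has_hessian n (\<lambda>v. real_of_ereal (KLdiv (W n v) (W n x))) (H n x)"
    by - (elim exE conjE, rule that)
  have "AE x in P n. x \<in> XG c \<Gamma> n" using P n by (simp add: S_Gamma_def)
  thus "AE x in P n. \<forall>v\<in>space (Xsp n). absolutely_continuous (W n x) (W n v)"
  proof eventually_elim
    case (elim x)
    hence x: "x \<in> cube n (a n) (l n)" using lsub n by auto
    show ?case
    proof
      fix v assume "v \<in> space (Xsp n)"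
      hence "KLdiv (W n v) (W n x) < \<infinity>" using KL n x by (simp add: Rn_def)
      thus "absolutely_continuous (W n x) (W n v)" by (rule KLdiv_finiteD)
    qed
  qed
qed

lemma joint_eq:
  assumes "dominated_channel (Xsp n) (Ysp MY n) (P n) (W n)"
  shows "out_dist W P n = dominated_channel.PY (P n) (W n)"
    "joint MY W P n = dominated_channel.J (Xsp n) (Ysp MY n) (P n) (W n)"
    "idens MY W P n z = ln (dominated_channel.d (Xsp n) (Ysp MY n) (P n) (W n) z) / real n"
proof -
  interpret D: dominated_channel "Xsp n" "Ysp MY n" "P n" "W n" by fact
  show 1: "out_dist W P n = D.PY" by (simp add: out_dist_def D.PY_def)
  show 2: "joint MY W P n = D.J" by (simp add: joint_def D.J_def)
  show "idens MY W P n z = ln (D.d z) / real n" by (simp add: idens_def 1 2 D.d_def D.R_def)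
qed

text \<open>Only an inclusion of events: where the density is 0, \<open>ln 0 = 0\<close> puts
  \<open>idens\<close> at 0, possibly above a negative \<beta>, although d does not exceed exp(n
  \<beta>).\<close>

lemma measure_d_gt_le:
  assumes dom: "dominated_channel (Xsp n) (Ysp MY n) (P n) (W n)" and n: "n > 0"
  defines "J \<equiv> dominated_channel.J (Xsp n) (Ysp MY n) (P n) (W n)"
    and "d \<equiv> dominated_channel.d (Xsp n) (Ysp MY n) (P n) (W n)"
  shows "measure J {z \<in> space (Xsp n \<Otimes>\<^sub>M Ysp MY n). d z > exp (n * \<beta>)}
      \<le> measure (joint MY W P n) {z \<in> space (joint MY W P n). idens MY W P n z > \<beta>}"
proof -
  interpret D: dominated_channel "Xsp n" "Ysp MY n" "P n" "W n" by fact
  note eqs = joint_eq[where n = n and MY = MY and P = P and W = W, OF dom]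
  have *: "\<beta> < ln (D.d z) / n" if "exp (n * \<beta>) < D.d z" for z
  proof -
    have "0 < D.d z" using that exp_gt_zero[of "n * \<beta>"] by linarith
    hence "n * \<beta> < ln (D.d z)" using that by (subst ln_exp[symmetric], subst ln_less_cancel_iff) auto
    thus ?thesis using n by (simp add: less_divide_eq mult.commute)
  qed
  have "measure D.J {z \<in> space (Xsp n \<Otimes>\<^sub>M Ysp MY n). D.d z > exp (n * \<beta>)}
      \<le> measure D.J {z \<in> space (Xsp n \<Otimes>\<^sub>M Ysp MY n). \<beta> < ln (D.d z) / n}"
    by (rule D.J.finite_measure_mono) (use * in auto)
  thus ?thesis unfolding eqs J_def d_def by simp
qed

lemma exists_resolvability_code:
  assumes ch: "general_channel MY W" and n: "n > 0"
    and dom: "dominated_channel (Xsp n) (Ysp MY n) (P n) (W n)"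
    and AE: "AE x in P n. x \<in> XG c \<Gamma> n" and q: "quantizer W MY n (XG c \<Gamma> n) \<eta> q T" and M: "(M::nat) \<ge> 1"
  shows "\<exists>\<phi>. (\<forall>i\<in>{1..M}. \<phi> i \<in> XG c \<Gamma> n) \<and> vdist (out_dist W P n) (res_output W n M \<phi>) \<le>
     2 * (measure (joint MY W P n) {z \<in> space (joint MY W P n). idens MY W P n z > \<beta>} + sqrt (exp (n * \<beta>) / M) + \<eta>)"
proof -
  interpret D: dominated_channel "Xsp n" "Ysp MY n" "P n" "W n" by fact
  have XR: "XG c \<Gamma> n \<subseteq> space (Xsp n)" by (auto simp: XG_def)
  have "\<exists>\<phi>. (\<forall>i\<in>{1..M}. \<phi> i \<in> XG c \<Gamma> n) \<and> (\<forall>B\<in>sets (Ysp MY n).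
     \<bar>measure D.PY B - (\<Sum>i=1..M. measure (W n (\<phi> i)) B) / M\<bar>
        \<le> measure D.J {z \<in> space (Xsp n \<Otimes>\<^sub>M Ysp MY n). D.d z > exp (n * \<beta>)} + sqrt (exp (n * \<beta>) / M) + \<eta>)"
    by (rule D.cell_covering[where T = T and q = q]) (use q XR AE M in \<open>auto simp: quantizer_def\<close>)
  then obtain \<phi> where \<phi>: "\<And>i. i \<in> {1..M} \<Longrightarrow> \<phi> i \<in> XG c \<Gamma> n" and cov: "\<And>B. B \<in> sets (Ysp MY n) \<Longrightarrow>
     \<bar>measure D.PY B - (\<Sum>i=1..M. measure (W n (\<phi> i)) B) / M\<bar>
        \<le> measure D.J {z \<in> space (Xsp n \<Otimes>\<^sub>M Ysp MY n). D.d z > exp (n * \<beta>)} + sqrt (exp (n * \<beta>) / M) + \<eta>"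
    by blast
  have "\<phi> i \<in> Rn n" if "i \<in> {1..M}" for i using \<phi>[OF that] XR by (auto simp: Rn_def)
  note r = res_output_prob(3)[where \<phi> = \<phi>, OF ch n M this]
  have "vdist (out_dist W P n) (res_output W n M \<phi>) \<le>
     2 * (measure (joint MY W P n) {z \<in> space (joint MY W P n). idens MY W P n z > \<beta>} + sqrt (exp (n * \<beta>) / M) + \<eta>)"
  proof (rule vdist_le)
    fix B assume "B \<in> sets (out_dist W P n)"
    hence B: "B \<in> sets (Ysp MY n)" by (simp add: joint_eq(1)[where n = n and MY = MY and P = P and W = W, OF dom])
    have rB: "measure (res_output W n M \<phi>) B = (\<Sum>i=1..M. measure (W n (\<phi> i)) B) / M"
      by (rule r[OF _ B])
    show "\<bar>measure (out_dist W P n) B - measure (res_output W n M \<phi>) B\<bar> \<le>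
       measure (joint MY W P n) {z \<in> space (joint MY W P n). idens MY W P n z > \<beta>} + sqrt (exp (n * \<beta>) / M) + \<eta>"
      using cov[OF B] rB measure_d_gt_le[where n = n and MY = MY and P = P and W = W and \<beta> = \<beta>, OF dom n] unfolding joint_eq(1)[where n = n and MY = MY and P = P and W = W, OF dom] by linarith
  qed
  thus ?thesis using \<phi> by blast
qed

lemma r_achievable_of_I_over_less:
  fixes R \<delta> :: real
  assumes ch: "general_channel MY W" and A: "A1_A2 W c \<Gamma>" and P: "P \<in> S_Gamma c \<Gamma>" and \<delta>: "\<delta> \<ge> 0"
    and less: "I_over MY W P < ereal R"
  shows "r_achievable_for W c \<Gamma> \<delta> P R"
proof -
  define u where "u \<beta> n = measure (joint MY W P n) {z \<in> space (joint MY W P n). idens MY W P n z > \<beta>}" for \<beta> n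
  from less obtain \<beta> where \<beta>: "\<beta> < R" "u \<beta> \<longlonglongrightarrow> 0"
    unfolding I_over_def p_limsup_def Inf_less_iff u_def by auto
  have dom: "dominated_channel (Xsp n) (Ysp MY n) (P n) (W n)" if "n > 0" for n
    by (rule dominated_channel_of_A1_A2[OF ch A P that])
  have AE: "AE x in P n. x \<in> XG c \<Gamma> n" if "n > 0" for n using P that by (simp add: S_Gamma_def)
  \<comment> \<open>The density is at most exp(n \<beta>) with probability at most exp(n \<beta>),
    and larger with probability at most u; for \<beta> < 0 both would tend to 0.\<close>
  have mass: "1 \<le> exp (n * \<beta>) + u \<beta> n" if n: "n > 0" for n
  proof -
    interpret D: dominated_channel "Xsp n" "Ysp MY n" "P n" "W n" by (rule dom[OF n])
    let ?A = "{z \<in> space (Xsp n \<Otimes>\<^sub>M Ysp MY n). D.d z \<le> exp (n * \<beta>)}"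
    let ?B = "{z \<in> space (Xsp n \<Otimes>\<^sub>M Ysp MY n). D.d z > exp (n * \<beta>)}"
    have AB: "?A \<in> D.J.events" "?B \<in> D.J.events" by measurable
    have "1 = measure D.J (space (Xsp n \<Otimes>\<^sub>M Ysp MY n))" using D.J.prob_space by simp
    also have "space (Xsp n \<Otimes>\<^sub>M Ysp MY n) = ?A \<union> ?B" by auto
    also have "measure D.J (?A \<union> ?B) \<le> measure D.J ?A + measure D.J ?B"
      by (rule measure_Un_le[OF AB])
    also have "measure D.J ?A \<le> exp (n * \<beta>)" by (rule D.measure_J_d_le) simp
    also have "measure D.J ?B \<le> u \<beta> n" unfolding u_def by (rule measure_d_gt_le[where n = n and MY = MY and P = P and W = W and \<beta> = \<beta>, OF dom[OF n] n])
    finally show ?thesis by simp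
  qed
  \<comment> \<open>A code has at least one codeword, so no negative rate is achievable; it has to
    be shown that no nonpositive R lies above \<open>I_over\<close>.\<close>
  have R: "R > 0"
  proof (rule ccontr)
    assume "\<not> R > 0"
    hence "\<beta> < 0" using \<beta> by simp
    hence "(\<lambda>n. exp (real n * \<beta>)) \<longlonglongrightarrow> 0" by real_asymp
    from tendsto_add[OF this \<beta>(2)] have "(\<lambda>n. exp (real n * \<beta>) + u \<beta> n) \<longlonglongrightarrow> 0" by simp
    hence "\<forall>\<^sub>F n in sequentially. exp (real n * \<beta>) + u \<beta> n < 1" by (rule order_tendstoD) simp
    hence "\<forall>\<^sub>F n in sequentially. False" using eventually_gt_at_top[of 0]
    proof eventually_elim
      case (elim n)
      thus ?case using mass[of n] by simp
    qed
    thus False by simp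
  qed
  \<comment> \<open>Rounding down respects the rate; since R > 0 it loses at most a factor 2, which
    the exponential gap between \<beta> and R absorbs.\<close>
  define M where "M n = nat \<lfloor>exp (real n * R)\<rfloor>" for n
  have M: "M n \<ge> 1" "M n \<le> exp (n * R)" "exp (n * R) / 2 \<le> M n" for n
  proof -
    have "1 \<le> exp (n * R)" using R by simp
    hence 1: "1 \<le> \<lfloor>exp (n * R)\<rfloor>" by linarith
    thus "M n \<ge> 1" unfolding M_def by linarith
    have e: "real (M n) = of_int \<lfloor>exp (n * R)\<rfloor>" using 1 by (simp add: M_def)
    show "M n \<le> exp (n * R)" unfolding e by linarith
    show "exp (n * R) / 2 \<le> M n" unfolding e using 1 by linarith
  qed
  have sq: "sqrt (exp (n * \<beta>) / M n) \<le> sqrt (2 * exp (n * (\<beta> - R)))" for n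
  proof (rule real_sqrt_le_mono)
    have "exp (n * \<beta>) / M n \<le> exp (n * \<beta>) / (exp (n * R) / 2)"
      using M(1,3)[of n] by (intro divide_left_mono) (auto intro!: mult_pos_pos)
    thus "exp (n * \<beta>) / M n \<le> 2 * exp (n * (\<beta> - R))" by (simp add: exp_diff right_diff_distrib mult.commute)
  qed
  have "(\<lambda>n. sqrt (2 * exp (real n * (\<beta> - R)))) \<longlonglongrightarrow> sqrt (2 * 0)"
    by (intro tendsto_real_sqrt tendsto_mult tendsto_const) (use \<beta>(1) in real_asymp)
  hence sq0: "(\<lambda>n. sqrt (2 * exp (real n * (\<beta> - R)))) \<longlonglongrightarrow> 0" by simp
  have "\<exists>\<Phi>. (\<forall>n>0. (\<forall>i\<in>{1..M n}. \<Phi> n i \<in> XG c \<Gamma> n)) \<and>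
     (\<forall>e>0. \<forall>\<^sub>F n in sequentially. vdist (out_dist W P n) (res_output W n (M n) (\<Phi> n)) \<le> e)"
  proof (rule eventually_diagonal)
    fix n :: nat assume n: "n > 0"
    interpret D: dominated_channel "Xsp n" "Ysp MY n" "P n" "W n" by (rule dom[OF n])
    from D.P.AE_imp_ex[OF AE[OF n]] obtain x where "x \<in> XG c \<Gamma> n" by blast
    thus "\<exists>\<phi>. \<forall>i\<in>{1..M n}. \<phi> i \<in> XG c \<Gamma> n" by (intro exI[of _ "\<lambda>_. x"]) simp
  next
    fix e :: real assume e: "e > 0"
    \<comment> \<open>Three errors of at most \<eta>, doubled by \<open>vdist\<close>, make 6 \<eta>
      \<le> e.\<close>
    define \<eta> where "\<eta> = e / 8"
    have \<eta>: "\<eta> > 0" using e by (simp add: \<eta>_def)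
    have "\<forall>\<^sub>F n in sequentially. u \<beta> n < \<eta>" by (rule order_tendstoD(2)[OF \<beta>(2) \<eta>])
    moreover have "\<forall>\<^sub>F n in sequentially. sqrt (2 * exp (real n * (\<beta> - R))) < \<eta>"
      by (rule order_tendstoD(2)[OF sq0 \<eta>])
    moreover note A1_A2_quantizer[OF ch A zero_less_one \<eta>] eventually_gt_at_top[of 0]
    ultimately show "\<forall>\<^sub>F n in sequentially. \<exists>\<phi>. (\<forall>i\<in>{1..M n}. \<phi> i \<in> XG c \<Gamma> n) \<and>
        vdist (out_dist W P n) (res_output W n (M n) \<phi>) \<le> e"
    proof eventually_elim
      case (elim n)
      obtain q T where q: "quantizer W MY n (XG c \<Gamma> n) \<eta> q T" using elim(3) by blast
      obtain \<phi> where \<phi>: "\<forall>i\<in>{1..M n}. \<phi> i \<in> XG c \<Gamma> n"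
        "vdist (out_dist W P n) (res_output W n (M n) \<phi>) \<le> 2 * (u \<beta> n + sqrt (exp (n * \<beta>) / M n) + \<eta>)"
        using exists_resolvability_code[where n = n and MY = MY and P = P and W = W and \<beta> = \<beta>, OF ch elim(4) dom[OF elim(4)] AE[OF elim(4)] q M(1)]
        unfolding u_def by blast
      have "2 * (u \<beta> n + sqrt (exp (n * \<beta>) / M n) + \<eta>) \<le> 2 * (\<eta> + \<eta> + \<eta>)"
        by (intro mult_left_mono add_mono less_imp_le[OF elim(1)]
            order_trans[OF sq less_imp_le[OF elim(2)]] order_refl) simp
      also have "\<dots> \<le> e" using e by (simp add: \<eta>_def)
      finally show ?case using \<phi> by (intro exI[of _ \<phi>]) linarith
    qed
  qed linarith
  then obtain \<Phi> where \<Phi>: "\<And>n. n > 0 \<Longrightarrow> \<forall>i\<in>{1..M n}. \<Phi> n i \<in> XG c \<Gamma> n"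
    "\<And>e. e > 0 \<Longrightarrow> \<forall>\<^sub>F n in sequentially. vdist (out_dist W P n) (res_output W n (M n) (\<Phi> n)) \<le> e"
    by blast
  have "limsup (\<lambda>n. ereal (vdist (out_dist W P n) (res_output W n (M n) (\<Phi> n)))) \<le> ereal \<delta>"
    unfolding limsup_le_iff_eventually
  proof (intro allI impI)
    fix e :: real assume e: "e > 0"
    show "\<forall>\<^sub>F n in sequentially. vdist (out_dist W P n) (res_output W n (M n) (\<Phi> n)) \<le> \<delta> + e"
      using \<Phi>(2)[OF e] by eventually_elim (use \<delta> in linarith)
  qed
  moreover have "limsup (\<lambda>n. ereal (ln (real (M n)) / real n)) \<le> ereal R"
  proof (rule Limsup_bounded)
    show "\<forall>\<^sub>F n in sequentially. ereal (ln (real (M n)) / real n) \<le> ereal R"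
      using eventually_gt_at_top[of 0]
    proof eventually_elim
      case (elim n)
      have "ln (real (M n)) \<le> ln (exp (n * R))" using M(1,2)[of n] by (intro ln_mono) auto
      thus ?case using elim by (simp add: divide_le_eq mult.commute)
    qed
  qed
  ultimately show ?thesis unfolding r_achievable_for_def
    by (intro exI[of _ M] exI[of _ \<Phi>] conjI) (use M(1) \<Phi>(1) in auto)
qed

subsection \<open>Information density versus transmission\<close>

context dominated_channel
begin

text \<open>The inner integral is a density with respect to \<open>P\<close> of the first marginal
  of \<open>J\<close>, which is \<open>P\<close> itself; densities are unique. This stands in for
  identifying d(x, _) with the density of \<open>W x\<close>.\<close>

lemma AE_nn_integral_d: "AE x in P. (\<integral>\<^sup>+y. ennreal (d (x, y)) \<partial>PY) = 1"
proof -
  let ?F = "\<lambda>x. \<integral>\<^sup>+y. ennreal (d (x, y)) \<partial>PY"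
  have F: "?F \<in> borel_measurable P" by measurable
  have "density P ?F = density P (\<lambda>_. 1)"
  proof (rule measure_eqI)
    fix C assume "C \<in> sets (density P ?F)"
    hence C: "C \<in> sets X" by simp
    have CY: "C \<times> space Y \<in> sets (X \<Otimes>\<^sub>M Y)" using C by simp
    have "emeasure (density P ?F) C = (\<integral>\<^sup>+x. ?F x * indicator C x \<partial>P)"
      using C F by (subst emeasure_density) auto
    also have "\<dots> = (\<integral>\<^sup>+x. \<integral>\<^sup>+y. ennreal (d (x, y)) * indicator (C \<times> space Y) (x, y) \<partial>PY \<partial>P)"
    proof (rule nn_integral_cong)
      fix x assume x: "x \<in> space P"
      show "?F x * indicator C x = (\<integral>\<^sup>+y. ennreal (d (x, y)) * indicator (C \<times> space Y) (x, y) \<partial>PY)"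
        by (cases "x \<in> C") (auto intro!: nn_integral_cong simp: indicator_def)
    qed
    also have "\<dots> = (\<integral>\<^sup>+z. ennreal (d z) * indicator (C \<times> space Y) z \<partial>R)"
    proof -
      have "(\<lambda>z. ennreal (d z) * indicator (C \<times> space Y) z) \<in> borel_measurable (X \<Otimes>\<^sub>M Y)"
        using CY by measurable
      hence "(\<lambda>z. ennreal (d z) * indicator (C \<times> space Y) z) \<in> borel_measurable (P \<Otimes>\<^sub>M PY)"
        by (simp add: measurable_cong_sets[OF sets_R[unfolded R_def] refl])
      from PY.nn_integral_fst[OF this] show ?thesis by (simp add: R_def)
    qed
    also have "\<dots> = emeasure (density R (\<lambda>z. ennreal (d z))) (C \<times> space Y)"
      using CY by (subst emeasure_density) auto
    also have "\<dots> = emeasure J (C \<times> space Y)" by (simp only: J_density[symmetric])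
    also have "\<dots> = emeasure P C"
      unfolding J.emeasure_eq_measure P.emeasure_eq_measure measure_J_Times_space[OF C] ..
    also have "\<dots> = emeasure (density P (\<lambda>_. 1)) C" by (simp add: density_1)
    finally show "emeasure (density P ?F) C = emeasure (density P (\<lambda>_. 1)) C" .
  qed simp
  thus ?thesis using F by (intro P.density_unique) auto
qed

text \<open>Markov's inequality on the slice, for the function d(x, _) of mean 1.\<close>

lemma AE_PY_slice_le:
  assumes a: "a > 0"
  shows "AE x in P. measure PY (Pair x -` {z \<in> space (X \<Otimes>\<^sub>M Y). a \<le> d z}) \<le> 1 / a"
  using AE_nn_integral_d AE_space
proof eventually_elim
  case (elim x)
  let ?B = "{z \<in> space (X \<Otimes>\<^sub>M Y). a \<le> d z}"
  have "?B \<in> sets (X \<Otimes>\<^sub>M Y)" by measurable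
  hence S: "Pair x -` ?B \<in> sets Y" by (rule slice_sets)
  have "ennreal a * emeasure PY (Pair x -` ?B) = (\<integral>\<^sup>+y. ennreal a * indicator (Pair x -` ?B) y \<partial>PY)"
    using S by (subst nn_integral_cmult_indicator) auto
  also have "\<dots> \<le> (\<integral>\<^sup>+y. ennreal (d (x, y)) \<partial>PY)"
    by (intro nn_integral_mono) (auto simp: indicator_def intro!: ennreal_leI)
  also have "\<dots> = 1" using elim by simp
  finally have "ennreal (a * measure PY (Pair x -` ?B)) \<le> ennreal 1"
    using a by (simp add: PY.emeasure_eq_measure ennreal_mult)
  hence "a * measure PY (Pair x -` ?B) \<le> 1" by (subst (asm) ennreal_le_iff) auto
  thus ?case using a by (simp add: le_divide_eq mult.commute)
qed

text \<open>Feinstein's maximal code construction: as long as the decoding sets chosen so far have small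
  total output probability, an average input still yields an admissible new pair.\<close>

lemma feinstein:
  assumes A: "AE x in P. x \<in> A" and a: "a > 0"
    and \<theta>: "measure J {z \<in> space (X \<Otimes>\<^sub>M Y). d z < a} + m / a < \<theta>"
    and k: "k \<le> (m::nat)"
  shows "\<exists>x D. (\<forall>i\<in>{1..k}. x i \<in> A \<inter> space X \<and> D i \<in> sets Y \<and> 1 - \<theta> \<le> measure (W (x i)) (D i)
      \<and> measure PY (D i) \<le> 1 / a) \<and> disjoint_family_on D {1..k}"
  using k
proof (induction k)
  case 0 show ?case by (simp add: disjoint_family_on_def)
next
  case (Suc k)
  hence km: "k \<le> m" by simp
  from Suc.IH[OF km] obtain x D where xD0:
    "(\<forall>i\<in>{1..k}. x i \<in> A \<inter> space X \<and> D i \<in> sets Y \<and> 1 - \<theta> \<le> measure (W (x i)) (D i)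
      \<and> measure PY (D i) \<le> 1 / a) \<and> disjoint_family_on D {1..k}" by (elim exE)
  have xD: "\<And>i. i \<in> {1..k} \<Longrightarrow> x i \<in> A \<inter> space X"
    "\<And>i. i \<in> {1..k} \<Longrightarrow> D i \<in> sets Y" "\<And>i. i \<in> {1..k} \<Longrightarrow> 1 - \<theta> \<le> measure (W (x i)) (D i)"
    "\<And>i. i \<in> {1..k} \<Longrightarrow> measure PY (D i) \<le> 1 / a" "disjoint_family_on D {1..k}"
    using xD0 by simp_all
  define U where "U = (\<Union>i\<in>{1..k}. D i)"
  have U: "U \<in> sets Y" unfolding U_def using xD(2) by auto
  define B where "B = {z \<in> space (X \<Otimes>\<^sub>M Y). a \<le> d z}"
  have B [measurable]: "B \<in> sets (X \<Otimes>\<^sub>M Y)" unfolding B_def by measurable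
  define C where "C = B \<inter> (space X \<times> (space Y - U))"
  have C: "C \<in> sets (X \<Otimes>\<^sub>M Y)" unfolding C_def using U by measurable
  have slC: "Pair v -` C = Pair v -` B - U" if "v \<in> space X" for v
    using that by (auto simp: C_def B_def space_pair_measure)
  have PU: "measure PY U \<le> k / a"
  proof -
    have "measure PY U \<le> (\<Sum>i\<in>{1..k}. measure PY (D i))"
      unfolding U_def by (rule measure_UNION_le) (use xD(2) in auto)
    also have "\<dots> \<le> (\<Sum>i\<in>{1..k}. 1 / a)" by (rule sum_mono) (rule xD(4))
    finally show ?thesis by simp
  qed
  \<comment> \<open>C misses only points of small density and points whose output is already used;
    together they have probability less than \<theta>.\<close>
  have big: "1 - \<theta> < measure J C"
  proof -
    let ?G = "{z \<in> space (X \<Otimes>\<^sub>M Y). d z < a}"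
    have G: "?G \<in> J.events" by measurable
    have XU: "space X \<times> U \<in> J.events" using U by simp
    have "1 = measure J (space (X \<Otimes>\<^sub>M Y))" using J.prob_space by simp
    also have "\<dots> \<le> measure J (C \<union> (?G \<union> space X \<times> U))"
      by (rule J.finite_measure_mono) (use C G XU in \<open>auto simp: C_def B_def space_pair_measure\<close>)
    also have "\<dots> \<le> measure J C + (measure J ?G + measure J (space X \<times> U))"
      by (rule order_trans[OF measure_Un_le add_left_mono[OF measure_Un_le]]) (use C G XU in auto)
    also have "measure J (space X \<times> U) = measure PY U" by (rule measure_J_space_Times[OF U])
    finally have "1 \<le> measure J C + measure J ?G + k / a" using PU by linarith
    moreover have "k / a \<le> m / a" using a km by (simp add: divide_right_mono)
    ultimately show ?thesis using \<theta> by linarith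
  qed
  have "\<exists>v\<in>space X. v \<in> A \<and> measure PY (Pair v -` B) \<le> 1 / a \<and> 1 - \<theta> \<le> measure (W v) (Pair v -` B - U)"
  proof (rule ccontr)
    assume *: "\<not> ?thesis"
    have "measure J C = (\<integral>v. measure (W v) (Pair v -` C) \<partial>P)" by (rule measure_J[OF C])
    also have "\<dots> \<le> (\<integral>v. 1 - \<theta> \<partial>P)"
    proof (rule integral_mono_AE[OF measure_J(2)[OF C]])
      show "AE v in P. measure (W v) (Pair v -` C) \<le> 1 - \<theta>"
        using A AE_PY_slice_le[OF a, folded B_def] AE_space
      proof eventually_elim
        case (elim v)
        hence "v \<in> space X" by simp
        hence "\<not> (1 - \<theta> \<le> measure (W v) (Pair v -` B - U))" using * elim by blast
        thus ?case using slC[OF \<open>v \<in> space X\<close>] by simp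
      qed
    qed simp
    also have "\<dots> = 1 - \<theta>" using P.prob_space by simp
    finally show False using big by simp
  qed
  then obtain v where v: "v \<in> space X" "v \<in> A" "measure PY (Pair v -` B) \<le> 1 / a"
    "1 - \<theta> \<le> measure (W v) (Pair v -` B - U)" by blast
  define E where "E = Pair v -` B - U"
  have Bv: "Pair v -` B \<in> sets Y" using B by (rule slice_sets)
  have E: "E \<in> sets Y" unfolding E_def using Bv U by auto
  have "measure PY E \<le> measure PY (Pair v -` B)"
    by (rule PY.finite_measure_mono) (use Bv in \<open>auto simp: E_def\<close>)
  hence PE: "measure PY E \<le> 1 / a" using v(3) by linarith
  let ?x = "x(Suc k := v)" and ?D = "D(Suc k := E)"
  have "?x i \<in> A \<inter> space X \<and> ?D i \<in> sets Y \<and> 1 - \<theta> \<le> measure (W (?x i)) (?D i) \<and> measure PY (?D i) \<le> 1 / a"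
    if i: "i \<in> {1..Suc k}" for i
  proof (cases "i = Suc k")
    case True
    thus ?thesis using v E PE by (simp add: E_def)
  next
    case False
    hence "i \<in> {1..k}" using i by auto
    thus ?thesis using xD False by simp
  qed
  moreover have "disjoint_family_on ?D {1..Suc k}"
    unfolding disjoint_family_on_def
  proof (intro ballI impI)
    fix i j assume ij: "i \<in> {1..Suc k}" "j \<in> {1..Suc k}" "i \<noteq> j"
    have DE: "D l \<inter> E = {}" if "l \<in> {1..k}" for l using that by (auto simp: E_def U_def)
    show "?D i \<inter> ?D j = {}"
    proof (cases "i = Suc k \<or> j = Suc k")
      case True
      thus ?thesis using DE[of i] DE[of j] ij by auto
    next
      case False
      hence "i \<in> {1..k}" "j \<in> {1..k}" using ij by auto
      thus ?thesis using xD(5) ij(3) False by (simp add: disjoint_family_on_def)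
    qed
  qed
  ultimately show ?case by blast
qed

end

text \<open>Here \<alpha> > 0 matters: where the density is 0, \<open>ln 0 = 0\<close> puts
  \<open>idens\<close> at 0, which is then below \<alpha>. Nonpositive \<alpha> will be handled by
  one-message codes.\<close>

lemma measure_d_less_le:
  assumes dom: "dominated_channel (Xsp n) (Ysp MY n) (P n) (W n)" and n: "n > 0" and \<alpha>: "\<alpha> > 0"
  defines "J \<equiv> dominated_channel.J (Xsp n) (Ysp MY n) (P n) (W n)"
    and "d \<equiv> dominated_channel.d (Xsp n) (Ysp MY n) (P n) (W n)"
  shows "measure J {z \<in> space (Xsp n \<Otimes>\<^sub>M Ysp MY n). d z < exp (n * \<alpha>)}
      \<le> measure (joint MY W P n) {z \<in> space (joint MY W P n). idens MY W P n z < \<alpha>}"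
proof -
  interpret D: dominated_channel "Xsp n" "Ysp MY n" "P n" "W n" by fact
  note eqs = joint_eq[where n = n and MY = MY and P = P and W = W, OF dom]
  have *: "ln (D.d z) / n < \<alpha>" if "D.d z < exp (n * \<alpha>)" for z
  proof (cases "D.d z = 0")
    case False
    hence "0 < D.d z" using D.d_nonneg[of z] by linarith
    hence "ln (D.d z) < n * \<alpha>" using that by (subst ln_exp[symmetric], subst ln_less_cancel_iff) auto
    thus ?thesis using n by (simp add: divide_less_eq mult.commute)
  qed (use \<alpha> in simp)
  have "measure D.J {z \<in> space (Xsp n \<Otimes>\<^sub>M Ysp MY n). D.d z < exp (n * \<alpha>)}
      \<le> measure D.J {z \<in> space (Xsp n \<Otimes>\<^sub>M Ysp MY n). ln (D.d z) / n < \<alpha>}"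
    by (rule D.J.finite_measure_mono) (use * in auto)
  thus ?thesis unfolding eqs J_def d_def by simp
qed

lemma tcode_of_disjoint_sets:
  assumes ch: "general_channel MY W" and n: "n > 0" and M: "M \<ge> 1"
    and x: "\<And>i. i \<in> {1..M} \<Longrightarrow> x i \<in> XG c \<Gamma> n" and D: "\<And>i. i \<in> {1..M} \<Longrightarrow> D i \<in> sets (Ysp MY n)"
    and disj: "disjoint_family_on D {1..M}"
    and err: "\<And>i. i \<in> {1..M} \<Longrightarrow> 1 - \<theta> \<le> measure (W n (x i)) (D i)"
  shows "\<exists>dec. tcode MY c \<Gamma> n M x dec \<and> terr MY W n M x dec \<le> \<theta>"
proof -
  \<comment> \<open>Outputs in none of the sets are decoded as message 1; this only enlarges its
    decoding set and cannot raise the error.\<close>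
  define dec where "dec y = (if \<exists>i\<in>{1..M}. y \<in> D i then THE i. i \<in> {1..M} \<and> y \<in> D i else 1)" for y
  have dec_eq: "dec y = i" if "i \<in> {1..M}" "y \<in> D i" for y i
  proof -
    have "(THE i. i \<in> {1..M} \<and> y \<in> D i) = i"
    proof (rule the_equality)
      fix j assume j: "j \<in> {1..M} \<and> y \<in> D j"
      show "j = i"
      proof (rule ccontr)
        assume "j \<noteq> i"
        hence "D j \<inter> D i = {}" using disj j that(1) unfolding disjoint_family_on_def by blast
        thus False using j that(2) by blast
      qed
    qed (use that in simp)
    thus ?thesis using that by (auto simp: dec_def)
  qed
  have dec_in: "dec y \<in> {1..M}" for y
  proof (cases "\<exists>i\<in>{1..M}. y \<in> D i")
    case True thus ?thesis using dec_eq by metis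
  next
    case False thus ?thesis using M by (simp add: dec_def)
  qed
  have DS: "D i \<subseteq> space (Ysp MY n)" if "i \<in> {1..M}" for i using sets.sets_into_space[OF D[OF that]] .
  have dec_sets: "{y \<in> space (Ysp MY n). dec y = i} \<in> sets (Ysp MY n)" if i: "i \<in> {1..M}" for i
  proof -
    let ?U = "\<Union>j\<in>{1..M}. D j"
    have U: "?U \<in> sets (Ysp MY n)" using D by (intro sets.finite_UN) auto
    have dec1: "dec y = 1" if "y \<notin> ?U" for y using that by (auto simp: dec_def)
    have inD: "y \<in> D i" if "y \<in> ?U" "dec y = i" for y using that dec_eq by blast
    have eq: "{y \<in> space (Ysp MY n). dec y = i} = D i \<union> (if i = 1 then space (Ysp MY n) - ?U else {})"
      (is "?L = ?R")
    proof
      show "?L \<subseteq> ?R"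
      proof
        fix y assume "y \<in> ?L"
        hence y: "y \<in> space (Ysp MY n)" "dec y = i" by auto
        show "y \<in> ?R"
        proof (cases "y \<in> ?U")
          case True thus ?thesis using inD y by blast
        next
          case False thus ?thesis using dec1[OF False] y by simp
        qed
      qed
      show "?R \<subseteq> ?L" using dec_eq[OF i] DS[OF i] dec1 by (auto split: if_splits)
    qed
    have "(if i = 1 then space (Ysp MY n) - ?U else {}) \<in> sets (Ysp MY n)"
      using sets.Diff[OF sets.top U] by simp
    from sets.Un[OF D[OF i] this] show ?thesis unfolding eq .
  qed
  have "tcode MY c \<Gamma> n M x dec" unfolding tcode_def using M x dec_in dec_sets by blast
  moreover have "terr MY W n M x dec \<le> \<theta>"
  proof -
    have "measure (W n (x i)) (space (Ysp MY n) - {y \<in> space (Ysp MY n). dec y = i}) \<le> \<theta>" if i: "i \<in> {1..M}" for i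
    proof -
      have xR: "x i \<in> Rn n" using x[OF i] by (auto simp: XG_def Rn_def)
      interpret Wx: prob_space "W n (x i)" by (rule channel_prob_space[OF ch n xR])
      note s = channel_prob_space(2,3)[OF ch n xR]
      have "measure (W n (x i)) (space (Ysp MY n) - {y \<in> space (Ysp MY n). dec y = i})
          \<le> measure (W n (x i)) (space (Ysp MY n) - D i)"
        by (rule Wx.finite_measure_mono) (use dec_eq[OF i] DS[OF i] D[OF i] s in auto)
      also have "\<dots> = 1 - measure (W n (x i)) (D i)" using Wx.prob_compl[of "D i"] D[OF i] s by simp
      finally show ?thesis using err[OF i] by linarith
    qed
    hence "(\<Sum>i=1..M. measure (W n (x i)) (space (Ysp MY n) - {y \<in> space (Ysp MY n). dec y = i})) \<le> (\<Sum>i=1..M. \<theta>)"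
      by (rule sum_mono)
    thus ?thesis using M by (simp add: terr_def divide_le_eq mult.commute)
  qed
  ultimately show ?thesis by blast
qed

lemma trivial_tcode:
  assumes "x \<in> XG c \<Gamma> n" "M \<ge> 1"
  shows "tcode MY c \<Gamma> n M (\<lambda>_. x) (\<lambda>_. 1)"
  unfolding tcode_def using assms by auto

lemma t_achievable_of_less_I_under:
  fixes R \<epsilon> :: real
  assumes ch: "general_channel MY W" and A: "A1_A2 W c \<Gamma>" and P: "P \<in> S_Gamma c \<Gamma>" and \<epsilon>: "\<epsilon> \<ge> 0"
    and less: "ereal R < I_under MY W P"
  shows "t_achievable MY W c \<Gamma> \<epsilon> R"
proof -
  define u where "u \<alpha> n = measure (joint MY W P n) {z \<in> space (joint MY W P n). idens MY W P n z < \<alpha>}" for \<alpha> n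
  from less obtain \<alpha> where \<alpha>: "R < \<alpha>" "u \<alpha> \<longlonglongrightarrow> 0"
    unfolding I_under_def p_liminf_def less_Sup_iff u_def by auto
  have dom: "dominated_channel (Xsp n) (Ysp MY n) (P n) (W n)" if "n > 0" for n
    by (rule dominated_channel_of_A1_A2[OF ch A P that])
  have AE: "AE x in P n. x \<in> XG c \<Gamma> n" if "n > 0" for n using P that by (simp add: S_Gamma_def)
  have ne: "\<exists>x. x \<in> XG c \<Gamma> n" if n: "n > 0" for n
  proof -
    interpret D: dominated_channel "Xsp n" "Ysp MY n" "P n" "W n" by (rule dom[OF n])
    from D.P.AE_imp_ex[OF AE[OF n]] show ?thesis by blast
  qed
  \<comment> \<open>Rounding up reaches the rate and gives at least one message even for negative R;
    the excess 1 is negligible against exp(n \<alpha>) when \<alpha> > 0.\<close>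
  define M where "M n = nat \<lceil>exp (real n * R)\<rceil>" for n
  have M: "M n \<ge> 1" "exp (n * R) \<le> M n" "M n \<le> exp (n * R) + 1" for n
  proof -
    have 1: "1 \<le> \<lceil>exp (n * R)\<rceil>" by (simp add: one_le_ceiling)
    thus "M n \<ge> 1" unfolding M_def by linarith
    have e: "real (M n) = of_int \<lceil>exp (n * R)\<rceil>" using 1 by (simp add: M_def)
    show "exp (n * R) \<le> M n" "M n \<le> exp (n * R) + 1" unfolding e by linarith+
  qed
  have "\<exists>\<Phi>. (\<forall>n>0. tcode MY c \<Gamma> n (M n) (fst (\<Phi> n)) (snd (\<Phi> n))) \<and>
     (\<forall>e>0. \<forall>\<^sub>F n in sequentially. terr MY W n (M n) (fst (\<Phi> n)) (snd (\<Phi> n)) \<le> e)"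
  proof (rule eventually_diagonal)
    fix n :: nat assume "n > 0"
    with ne obtain x where "x \<in> XG c \<Gamma> n" by blast
    from trivial_tcode[OF this M(1)] have "tcode MY c \<Gamma> n (M n) (fst (\<lambda>_. x, \<lambda>_. 1)) (snd (\<lambda>_. x, \<lambda>_. 1))" by simp
    thus "\<exists>\<phi>. tcode MY c \<Gamma> n (M n) (fst \<phi>) (snd \<phi>)" by blast
  next
    fix e :: real assume e: "e > 0"
    show "\<forall>\<^sub>F n in sequentially. \<exists>\<phi>. tcode MY c \<Gamma> n (M n) (fst \<phi>) (snd \<phi>) \<and> terr MY W n (M n) (fst \<phi>) (snd \<phi>) \<le> e"
    proof (cases "\<alpha> > 0")
      case True
      have "(\<lambda>n. (exp (real n * R) + 1) / exp (real n * \<alpha>)) \<longlonglongrightarrow> 0"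
      proof -
        have "(\<lambda>n. exp (real n * (R - \<alpha>)) + exp (real n * (- \<alpha>))) \<longlonglongrightarrow> 0 + 0"
          by (intro tendsto_add) (use \<alpha> True in real_asymp)+
        thus ?thesis by (simp add: add_divide_distrib exp_diff right_diff_distrib exp_minus inverse_eq_divide)
      qed
      hence "\<forall>\<^sub>F n in sequentially. (exp (real n * R) + 1) / exp (real n * \<alpha>) < e / 2"
        by (rule order_tendstoD) (use e in simp)
      moreover have "\<forall>\<^sub>F n in sequentially. u \<alpha> n < e / 2"
        by (rule order_tendstoD(2)[OF \<alpha>(2)]) (use e in simp)
      ultimately show ?thesis using eventually_gt_at_top[of 0]
      proof eventually_elim
        case (elim n)
        interpret D: dominated_channel "Xsp n" "Ysp MY n" "P n" "W n" by (rule dom[OF elim(3)])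
        have "M n / exp (n * \<alpha>) \<le> (exp (n * R) + 1) / exp (n * \<alpha>)"
          by (rule divide_right_mono[OF M(3)]) simp
        hence "D.J.prob {z \<in> space (Xsp n \<Otimes>\<^sub>M Ysp MY n). D.d z < exp (n * \<alpha>)} + M n / exp (n * \<alpha>) < e"
          using measure_d_less_le[where n = n and MY = MY and P = P and W = W and \<alpha> = \<alpha>, OF dom[OF elim(3)] elim(3) True] elim(1,2)
          unfolding u_def by linarith
        from D.feinstein[OF AE[OF elim(3)] exp_gt_zero this order_refl]
        obtain x D where xD0: "(\<forall>i\<in>{1..M n}. x i \<in> XG c \<Gamma> n \<inter> space (Xsp n) \<and> D i \<in> sets (Ysp MY n)
          \<and> 1 - e \<le> measure (W n (x i)) (D i) \<and> measure D.PY (D i) \<le> 1 / exp (n * \<alpha>)) \<and> disjoint_family_on D {1..M n}"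
          by (elim exE)
        have xD: "\<And>i. i \<in> {1..M n} \<Longrightarrow> x i \<in> XG c \<Gamma> n" "\<And>i. i \<in> {1..M n} \<Longrightarrow> D i \<in> sets (Ysp MY n)"
          "\<And>i. i \<in> {1..M n} \<Longrightarrow> 1 - e \<le> measure (W n (x i)) (D i)" "disjoint_family_on D {1..M n}"
          using xD0 by simp_all
        from tcode_of_disjoint_sets[OF ch elim(3) M(1) xD(1,2,4,3)] obtain dec
          where "tcode MY c \<Gamma> n (M n) x dec" "terr MY W n (M n) x dec \<le> e" by blast
        thus ?case by (intro exI[of _ "(x, dec)"]) simp
      qed
    next
      \<comment> \<open>Then R < 0, the code has a single message, and decoding cannot fail.\<close>
      case False
      show ?thesis using eventually_gt_at_top[of 0]
      proof eventually_elim
        case (elim n)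
        obtain x where x: "x \<in> XG c \<Gamma> n" using ne[OF elim] by blast
        have "real n * R \<le> 0" using False \<alpha>(1) by (simp add: mult_nonneg_nonpos)
        hence "exp (n * R) \<le> 1" by simp
        hence "\<lceil>exp (n * R)\<rceil> \<le> 1" by (simp add: ceiling_le_one)
        hence "M n = 1" using M(1)[of n] unfolding M_def by linarith
        hence "terr MY W n (M n) (\<lambda>_. x) (\<lambda>_. 1) = 0" by (simp add: terr_def)
        thus ?case using trivial_tcode[OF x M(1)] e by (intro exI[of _ "(\<lambda>_. x, \<lambda>_. 1)"]) simp
      qed
    qed
  qed linarith
  then obtain \<Phi> where \<Phi>: "\<And>n. n > 0 \<Longrightarrow> tcode MY c \<Gamma> n (M n) (fst (\<Phi> n)) (snd (\<Phi> n))"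
    "\<And>e. e > 0 \<Longrightarrow> \<forall>\<^sub>F n in sequentially. terr MY W n (M n) (fst (\<Phi> n)) (snd (\<Phi> n)) \<le> e"
    by blast
  have "limsup (\<lambda>n. ereal (terr MY W n (M n) (fst (\<Phi> n)) (snd (\<Phi> n)))) \<le> ereal \<epsilon>"
    unfolding limsup_le_iff_eventually
  proof (intro allI impI)
    fix e :: real assume e: "e > 0"
    show "\<forall>\<^sub>F n in sequentially. terr MY W n (M n) (fst (\<Phi> n)) (snd (\<Phi> n)) \<le> \<epsilon> + e"
      using \<Phi>(2)[OF e] by eventually_elim (use \<epsilon> in linarith)
  qed
  moreover have "ereal R \<le> liminf (\<lambda>n. ereal (ln (real (M n)) / real n))"
  proof (rule Liminf_bounded)
    show "\<forall>\<^sub>F n in sequentially. ereal R \<le> ereal (ln (real (M n)) / real n)"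
      using eventually_gt_at_top[of 0]
    proof eventually_elim
      case (elim n)
      have "ln (exp (n * R)) \<le> ln (real (M n))" using M(1,2)[of n] by (intro ln_mono) auto
      thus ?case using elim by (simp add: le_divide_eq mult.commute)
    qed
  qed
  ultimately show ?thesis unfolding t_achievable_def
    by (intro exI[of _ M] exI[of _ "\<lambda>n. fst (\<Phi> n)"] exI[of _ "\<lambda>n. snd (\<Phi> n)"] conjI) (use \<Phi>(1) in auto)
qed

subsection \<open>Transmission versus identification\<close>

text \<open>Union bound over sets S of r places of agreement: there are at most 2^q of them, and
  outside S the function f is free, with b values at each of q - r places.\<close>

lemma card_agreeing_functions_le:
  assumes r: "r \<le> q"
  shows "card {f \<in> {..<q} \<rightarrow>\<^sub>E {..<b::nat}. r \<le> card {a \<in> {..<q}. f a = g a}} \<le> 2 ^ q * b ^ (q - r)"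
proof -
  define V where "V S = Pi\<^sub>E {..<q} (\<lambda>a. if a \<in> S then {g a} else {..<b})" for S
  let ?I = "{S. S \<subseteq> {..<q} \<and> card S = r}"
  have finI: "finite ?I" by (rule finite_subset[of _ "Pow {..<q}"]) auto
  have cI: "card ?I \<le> 2 ^ q"
    using card_mono[of "Pow {..<q}" ?I] by (auto simp: card_Pow)
  have cV: "card (V S) = b ^ (q - r)" if S: "S \<in> ?I" for S
  proof -
    have "card (V S) = (\<Prod>a<q. if a \<in> S then 1 else b)"
      unfolding V_def by (subst card_PiE) (auto intro!: prod.cong)
    also have "\<dots> = b ^ card ({..<q} \<inter> - S)" by (subst prod.If_cases) (auto simp: Collect_neg_eq)
    also have "{..<q} \<inter> - S = {..<q} - S" by auto
    also have "card ({..<q} - S) = q - r" using S by (subst card_Diff_subset) (auto intro: finite_subset)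
    finally show ?thesis .
  qed
  have finV: "finite (V S)" for S unfolding V_def by (rule finite_PiE) auto
  have "{f \<in> {..<q} \<rightarrow>\<^sub>E {..<b}. r \<le> card {a \<in> {..<q}. f a = g a}} \<subseteq> (\<Union>S\<in>?I. V S)"
  proof
    fix f assume f: "f \<in> {f \<in> {..<q} \<rightarrow>\<^sub>E {..<b}. r \<le> card {a \<in> {..<q}. f a = g a}}"
    then obtain S where S: "S \<subseteq> {a \<in> {..<q}. f a = g a}" "card S = r"
      using obtain_subset_with_card_n[of r "{a \<in> {..<q}. f a = g a}"] by auto
    have "f \<in> V S" using f S(1) by (auto simp: V_def PiE_iff)
    thus "f \<in> (\<Union>S\<in>?I. V S)" using S by auto
  qed
  hence "card {f \<in> {..<q} \<rightarrow>\<^sub>E {..<b}. r \<le> card {a \<in> {..<q}. f a = g a}} \<le> card (\<Union>S\<in>?I. V S)"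
    by (rule card_mono[rotated]) (use finI finV in auto)
  also have "\<dots> \<le> (\<Sum>S\<in>?I. card (V S))" by (rule card_UN_le[OF finI])
  also have "\<dots> = (\<Sum>S\<in>?I. b ^ (q - r))" by (rule sum.cong[OF refl]) (rule cV)
  also have "\<dots> = card ?I * b ^ (q - r)" by simp
  also have "\<dots> \<le> 2 ^ q * b ^ (q - r)" using cI by simp
  finally show ?thesis .
qed

text \<open>A Gilbert--Varshamov argument: the agreement neighbourhoods of a maximal separated family
  cover all functions. The graphs of the functions serve as the codeword sets of the messages.\<close>

lemma separated_functions:
  fixes s r :: nat
  assumes s: "s \<ge> 1" and r: "r \<ge> 1"
  shows "\<exists>F \<subseteq> {..<s * r} \<rightarrow>\<^sub>E {..<6 ^ s :: nat}. 3 ^ (s * r) \<le> card F \<and>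
     (\<forall>f\<in>F. \<forall>g\<in>F. f \<noteq> g \<longrightarrow> card {a \<in> {..<s * r}. f a = g a} < r)"
proof -
  define q where "q = s * r"
  \<comment> \<open>The base is 6 = 2 * 3: of b^r = 6^q the factor 2^q pays for the choice of the
    places of agreement, and 3^q is left as the size of the family. As 3 exceeds Euler's number, the
    logarithm of this size is at least q.\<close>
  define b :: nat where "b = 6 ^ s"
  define \<Omega> where "\<Omega> = {..<q} \<rightarrow>\<^sub>E {..<b}"
  have fin\<Omega>: "finite \<Omega>" unfolding \<Omega>_def by (rule finite_PiE) auto
  have rq: "r \<le> q" using mult_le_mono1[OF s, of r] unfolding q_def by (simp only: mult_1)
  define sep where "sep = (\<lambda>F. \<forall>f\<in>F. \<forall>g\<in>F. f \<noteq> g \<longrightarrow> card {a \<in> {..<q}. f a = (g a :: nat)} < r)"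
  have fins: "finite {F. F \<subseteq> \<Omega> \<and> sep F}" by (rule finite_subset[of _ "Pow \<Omega>"]) (use fin\<Omega> in auto)
  have "{} \<in> {F. F \<subseteq> \<Omega> \<and> sep F}" by (simp add: sep_def)
  hence "{F. F \<subseteq> \<Omega> \<and> sep F} \<noteq> {}" by (metis empty_iff)
  from finite_has_maximal[OF fins this]
  obtain F where F0: "F \<in> {F. F \<subseteq> \<Omega> \<and> sep F}" "\<forall>F'\<in>{F. F \<subseteq> \<Omega> \<and> sep F}. F \<subseteq> F' \<longrightarrow> F = F'"
    by (elim bexE)
  have F: "F \<subseteq> \<Omega>" "sep F" using F0(1) by simp_all
  have mx: "F = F'" if "F' \<subseteq> \<Omega>" "sep F'" "F \<subseteq> F'" for F'
    using F0(2) that by simp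
  have finF: "finite F" using F(1) fin\<Omega> by (rule finite_subset)
  let ?N = "\<lambda>g. {f \<in> \<Omega>. r \<le> card {a \<in> {..<q}. f a = g a}}"
  have "\<Omega> \<subseteq> (\<Union>g\<in>F. ?N g)"
  proof
    fix f assume f: "f \<in> \<Omega>"
    show "f \<in> (\<Union>g\<in>F. ?N g)"
    proof (cases "f \<in> F")
      case True
      have "r \<le> card {a \<in> {..<q}. f a = f a}" using rq by simp
      thus ?thesis using f True by blast
    next
      case False
      show ?thesis
      proof (rule ccontr)
        assume "f \<notin> (\<Union>g\<in>F. ?N g)"
        hence *: "card {a \<in> {..<q}. f a = g a} < r" if "g \<in> F" for g using f that by (auto simp: not_le)
        have **: "card {a \<in> {..<q}. g a = f a} < r" if "g \<in> F" for g
          using *[OF that] by (simp only: eq_commute)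
        have "sep (insert f F)" using F(2) * ** unfolding sep_def by blast
        hence "F = insert f F" using F(1) f by (intro mx) auto
        thus False using False by blast
      qed
    qed
  qed
  hence "card \<Omega> \<le> card (\<Union>g\<in>F. ?N g)" by (rule card_mono[rotated]) (use finF fin\<Omega> in auto)
  also have "\<dots> \<le> (\<Sum>g\<in>F. card (?N g))" by (rule card_UN_le[OF finF])
  also have "\<dots> \<le> (\<Sum>g\<in>F. 2 ^ q * b ^ (q - r))"
    unfolding \<Omega>_def by (rule sum_mono) (rule card_agreeing_functions_le[OF rq])
  also have "\<dots> = card F * 2 ^ q * b ^ (q - r)" by simp
  also have "card \<Omega> = b ^ q" by (simp add: \<Omega>_def card_PiE)
  also have "b ^ q = b ^ r * b ^ (q - r)" using rq by (simp flip: power_add)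
  finally have "b ^ r \<le> card F * 2 ^ q" by (simp add: b_def)
  moreover have "b ^ r = 3 ^ q * 2 ^ q" by (simp add: b_def q_def flip: power_mult power_mult_distrib)
  ultimately have "3 ^ q \<le> card F" by simp
  thus ?thesis using F unfolding sep_def \<Omega>_def q_def b_def by blast
qed

lemma singleton_sets_Xsp: "x \<in> Rn n \<Longrightarrow> {x} \<in> sets (Xsp n)"
proof -
  assume x: "x \<in> Rn n"
  have "Pi\<^sub>E {..<n} (\<lambda>i. {x i}) \<in> sets (Xsp n)" unfolding Xsp_def by (rule sets_PiM_I_finite) auto
  moreover have "x \<in> extensional {..<n}" using x by (simp add: Rn_iff extensional_def)
  ultimately show ?thesis by (simp add: PiE_singleton)
qed

section \<open>Identification codes from transmission codes\<close>

lemma uniform_input: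
  assumes ch: "general_channel MY W" and n: "n > 0" and q: "(q::nat) > 0"
    and z: "\<And>a. a < q \<Longrightarrow> z a \<in> XG c \<Gamma> n"
  defines "Q \<equiv> distr (uniform_count_measure {..<q}) (Xsp n) z"
  shows "Q \<in> space (prob_algebra (Xsp n))" "AE x in Q. x \<in> XG c \<Gamma> n"
    "B \<in> sets (Ysp MY n) \<Longrightarrow> measure (Q \<bind> W n) B = (\<Sum>a<q. measure (W n (z a)) B) / q"
proof -
  let ?U = "uniform_count_measure {..<q}"
  have zR: "z a \<in> Rn n" if "a < q" for a using z[OF that] by (auto simp: XG_def Rn_def)
  have ne: "{..<q} \<noteq> {}" using q by auto
  interpret U: prob_space ?U by (rule prob_space_uniform_count_measure) (use ne in auto)
  have zm: "z \<in> ?U \<rightarrow>\<^sub>M Xsp n"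
    using zR by (subst measurable_cong_sets[OF sets_uniform_count_measure_count_space refl]) (auto simp: Rn_def)
  show "Q \<in> space (prob_algebra (Xsp n))"
    unfolding Q_def using U.prob_space_distr[OF zm] by (simp add: space_prob_algebra)
  let ?Z = "z ` {..<q}"
  have Z: "?Z \<in> sets (Xsp n)"
  proof -
    have "?Z = (\<Union>a<q. {z a})" by auto
    also have "\<dots> \<in> sets (Xsp n)" using singleton_sets_Xsp[OF zR] by (intro sets.finite_UN) auto
    finally show ?thesis .
  qed
  \<comment> \<open>Through the finite, hence measurable, set of codewords, since the admissible set
    need not be measurable.\<close>
  have "AE x in Q. x \<in> ?Z" unfolding Q_def
    by (subst AE_distr_iff[OF zm]) (use Z in \<open>auto simp: space_uniform_count_measure\<close>)
  thus "AE x in Q. x \<in> XG c \<Gamma> n" by eventually_elim (use z in auto)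
  assume B: "B \<in> sets (Ysp MY n)"
  have Wm: "W n \<in> Xsp n \<rightarrow>\<^sub>M subprob_algebra (Ysp MY n)"
    using channel_measurable[OF ch n] by (rule measurable_prob_algebraD)
  have "Q \<bind> W n = ?U \<bind> (\<lambda>a. W n (z a))"
    unfolding Q_def by (rule bind_distr[OF zm Wm]) (use ne in \<open>simp add: space_uniform_count_measure\<close>)
  hence "measure (Q \<bind> W n) B = (\<integral>a. measure (W n (z a)) B \<partial>?U)"
    using U.measure_bind[OF measurable_compose[OF zm Wm] B] by simp
  thus "measure (Q \<bind> W n) B = (\<Sum>a<q. measure (W n (z a)) B) / q"
    by (simp add: integral_uniform_count_measure)
qed

lemma id_mu_le:
  assumes "(N::nat) \<ge> 1" "\<And>i. i \<in> {1..N} \<Longrightarrow> measure (Q i \<bind> W n) (space (Ysp MY n) - D i) \<le> t"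
  shows "id_mu MY W n N Q D \<le> t"
  unfolding id_mu_def by (rule Max.boundedI) (use assms in auto)

lemma id_lam_le:
  assumes "\<And>i j. i \<in> {1..N::nat} \<Longrightarrow> j \<in> {1..N} \<Longrightarrow> i \<noteq> j \<Longrightarrow> measure (Q j \<bind> W n) (D i) \<le> t" "0 \<le> t"
  shows "id_lam W n N Q D \<le> t"
  unfolding id_lam_def by (rule Max.boundedI[OF id_lam_finite]) (use assms in auto)

text \<open>Markov's inequality on the messages: a fraction of at most (\<epsilon> + \<eta> / 2) /
  (\<epsilon> + \<eta>) has error above \<epsilon> + \<eta>. The constant fraction that remains
  costs no rate. Identification needs individual error bounds, as it uses arbitrary selections of
  codewords.\<close>

lemma expurgation:
  fixes e :: "nat \<Rightarrow> real"
  assumes M: "M \<ge> 1" and e: "\<And>m. m \<in> {1..M} \<Longrightarrow> e m \<ge> 0" and av: "(\<Sum>m=1..M. e m) / M \<le> \<epsilon> + \<eta> / 2"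
    and pos: "\<eta> > 0" "\<epsilon> \<ge> 0"
  shows "\<eta> / 2 / (\<epsilon> + \<eta>) * M \<le> card {m \<in> {1..M}. e m \<le> \<epsilon> + \<eta>}"
proof -
  let ?K = "{m \<in> {1..M}. e m \<le> \<epsilon> + \<eta>}"
  have "(M - card ?K) * (\<epsilon> + \<eta>) = (\<Sum>m\<in>{1..M} - ?K. \<epsilon> + \<eta>)"
    by (subst sum_constant, subst card_Diff_subset) auto
  also have "\<dots> \<le> (\<Sum>m\<in>{1..M} - ?K. e m)" by (rule sum_mono) auto
  also have "\<dots> \<le> (\<Sum>m=1..M. e m)" by (rule sum_mono2) (use e in auto)
  also have "\<dots> \<le> M * (\<epsilon> + \<eta> / 2)" using av M by (simp add: divide_le_eq mult.commute)
  finally have *: "real (M - card ?K) * (\<epsilon> + \<eta>) \<le> M * (\<epsilon> + \<eta> / 2)" .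
  have "card ?K \<le> card {1..M}" by (rule card_mono) auto
  hence "card ?K \<le> M" by simp
  hence "(M - real (card ?K)) * (\<epsilon> + \<eta>) \<le> M * (\<epsilon> + \<eta> / 2)" using * by (simp add: of_nat_diff)
  hence *: "\<eta> / 2 * M \<le> card ?K * (\<epsilon> + \<eta>)" by (simp add: algebra_simps)
  have "0 < \<epsilon> + \<eta>" using pos by linarith
  from iffD2[OF pos_divide_le_eq[OF this] *] show ?thesis by simp
qed

text \<open>The good codewords fill a table of q columns with b entries each. A message is a choice
  of one entry per column; it sends one of these q codewords at random and accepts whatever is
  decoded into its list. A wrong message is accepted through a common codeword, in fewer than r of
  the q = s r columns, a fraction of at most \<eta>, or through a decoding error.\<close>

lemma exists_idcode:
  fixes \<epsilon> \<eta> :: real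
  assumes ch: "general_channel MY W" and n: "n > 0" and tc: "tcode MY c \<Gamma> n M enc dec"
    and err: "terr MY W n M enc dec \<le> \<epsilon> + \<eta> / 2" and pos: "\<eta> > 0" "\<epsilon> \<ge> 0"
    and s: "s \<ge> 1" "1 / real s \<le> \<eta>" and large: "real s * 6 ^ s \<le> \<eta> / 2 / (\<epsilon> + \<eta>) * M"
  shows "\<exists>N Q D. idcode MY c \<Gamma> n N Q D \<and> id_mu MY W n N Q D \<le> \<epsilon> + \<eta> \<and> id_lam W n N Q D \<le> \<epsilon> + 2 * \<eta> \<and>
     ln (\<eta> / 2 / (\<epsilon> + \<eta>) / (2 * 6 ^ s) * M) \<le> ln (ln (real N))"
proof -
  define E where "E m = {y \<in> space (Ysp MY n). dec y = m}" for m
  define e where "e m = measure (W n (enc m)) (space (Ysp MY n) - E m)" for m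
  define K where "K = {m \<in> {1..M}. e m \<le> \<epsilon> + \<eta>}"
  have M: "M \<ge> 1" and encX: "\<And>m. m \<in> {1..M} \<Longrightarrow> enc m \<in> XG c \<Gamma> n"
    and E: "\<And>m. m \<in> {1..M} \<Longrightarrow> E m \<in> sets (Ysp MY n)"
    using tc unfolding tcode_def E_def by auto
  have cK: "\<eta> / 2 / (\<epsilon> + \<eta>) * M \<le> card K"
    unfolding K_def by (rule expurgation[OF M]) (use err pos in \<open>auto simp: terr_def e_def E_def\<close>)
  define b :: nat where "b = 6 ^ s"
  \<comment> \<open>The table has s r columns of b entries, so this is the largest r for which it
    fits into K.\<close>
  define r where "r = card K div (s * b)"
  define q where "q = s * r"
  have sb: "s * b > 0" using s by (simp add: b_def)
  have "real (s * b) \<le> card K" using large cK by (simp add: b_def)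
  hence "s * b \<le> card K" by (simp only: of_nat_le_iff)
  hence r1: "r \<ge> 1" unfolding r_def using sb by (simp add: Suc_le_eq div_greater_zero_iff)
  have q1: "q > 0" using r1 s by (simp add: q_def)
  have "q * b \<le> card K"
  proof -
    have "q * b = card K div (s * b) * (s * b)" by (simp add: q_def r_def mult_ac)
    also have "\<dots> \<le> card K" by (rule div_times_less_eq_dividend)
    finally show ?thesis .
  qed
  hence "card ({..<q} \<times> {..<b}) \<le> card K" by simp
  then obtain \<iota> where \<iota>: "\<iota> ` ({..<q} \<times> {..<b}) \<subseteq> K" "inj_on \<iota> ({..<q} \<times> {..<b})"
    using card_le_inj[of "{..<q} \<times> {..<b}" K] by (auto simp: K_def)
  obtain F where F: "F \<subseteq> {..<q} \<rightarrow>\<^sub>E {..<b}" "3 ^ q \<le> card F"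
    "\<And>f g. f \<in> F \<Longrightarrow> g \<in> F \<Longrightarrow> f \<noteq> g \<Longrightarrow> card {a \<in> {..<q}. f a = g a} < r"
    using separated_functions[OF s(1) r1] unfolding q_def b_def by blast
  have finF: "finite F" using F(1) by (rule finite_subset) (auto intro: finite_PiE)
  define N where "N = card F"
  obtain h where h: "bij_betw h {1..N} F" using ex_bij_betw_nat_finite_1[OF finF] unfolding N_def by blast
  have hF: "h i \<in> F" if "i \<in> {1..N}" for i using h that by (auto simp: bij_betw_def)
  have hb: "h i a < b" if "i \<in> {1..N}" "a < q" for i a using hF[OF that(1)] F(1) that(2) by (auto simp: PiE_iff)
  have N3: "3 ^ q \<le> N" using F(2) by (simp add: N_def)
  have N1: "N \<ge> 1" using N3 by (metis One_nat_def Suc_leI le_trans zero_less_numeral zero_less_power)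
  define w where "w i a = \<iota> (a, h i a)" for i a
  have wK: "w i a \<in> K" if "i \<in> {1..N}" "a < q" for i a using \<iota>(1) hb[OF that] that(2) by (auto simp: w_def)
  have wM: "w i a \<in> {1..M}" if "i \<in> {1..N}" "a < q" for i a using wK[OF that] by (simp add: K_def)
  have we: "e (w i a) \<le> \<epsilon> + \<eta>" if "i \<in> {1..N}" "a < q" for i a using wK[OF that] by (simp add: K_def)
  have winj: "a = a' \<and> h i a = h j a'" if "w i a = w j a'" "i \<in> {1..N}" "j \<in> {1..N}" "a < q" "a' < q" for i j a a'
    using \<iota>(2) that hb[of i a] hb[of j a'] unfolding w_def inj_on_def by fastforce
  define Q where "Q i = distr (uniform_count_measure {..<q}) (Xsp n) (\<lambda>a. enc (w i a))" for i
  define D where "D i = (\<Union>a<q. E (w i a))" for i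
  have zX: "enc (w i a) \<in> XG c \<Gamma> n" if "i \<in> {1..N}" "a < q" for i a using encX wM that by blast
  have U: "Q i \<in> space (prob_algebra (Xsp n))" "AE x in Q i. x \<in> XG c \<Gamma> n"
    "\<And>B. B \<in> sets (Ysp MY n) \<Longrightarrow> measure (Q i \<bind> W n) B = (\<Sum>a<q. measure (W n (enc (w i a))) B) / q"
    if i: "i \<in> {1..N}" for i
    unfolding Q_def using uniform_input[where z = "\<lambda>a. enc (w i a)", OF ch n q1 zX[OF i]] by simp_all
  have D: "D i \<in> sets (Ysp MY n)" if "i \<in> {1..N}" for i
    unfolding D_def using E wM that by (intro sets.finite_UN) auto
  have pr: "prob_space (W n (enc (w i a)))" "sets (W n (enc (w i a))) = sets (Ysp MY n)" 
    if "i \<in> {1..N}" "a < q" for i a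
  proof -
    have "enc (w i a) \<in> Rn n" using zX[OF that] by (auto simp: XG_def Rn_def)
    thus "prob_space (W n (enc (w i a)))" "sets (W n (enc (w i a))) = sets (Ysp MY n)" 
      using channel_prob_space[OF ch n] by auto
  qed
  have "idcode MY c \<Gamma> n N Q D" unfolding idcode_def using N1 U(1,2) D by simp
  moreover have "id_mu MY W n N Q D \<le> \<epsilon> + \<eta>"
  proof (rule id_mu_le[OF N1])
    fix i assume i: "i \<in> {1..N}"
    have c: "space (Ysp MY n) - D i \<in> sets (Ysp MY n)" using D[OF i] by auto
    have "(\<Sum>a<q. measure (W n (enc (w i a))) (space (Ysp MY n) - D i)) \<le> (\<Sum>a<q. \<epsilon> + \<eta>)"
    proof (rule sum_mono)
      fix a assume "a \<in> {..<q}"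
      hence a: "a < q" by simp
      interpret Wa: prob_space "W n (enc (w i a))" by (rule pr[OF i a])
      have "measure (W n (enc (w i a))) (space (Ysp MY n) - D i) \<le> e (w i a)" unfolding e_def
        by (rule Wa.finite_measure_mono) (use a E[OF wM[OF i a]] pr(2)[OF i a] in \<open>auto simp: D_def\<close>)
      thus "measure (W n (enc (w i a))) (space (Ysp MY n) - D i) \<le> \<epsilon> + \<eta>" using we[OF i a] by linarith
    qed
    thus "measure (Q i \<bind> W n) (space (Ysp MY n) - D i) \<le> \<epsilon> + \<eta>"
      unfolding U(3)[OF i c] using q1 by (simp add: divide_le_eq mult.commute)
  qed
  moreover have "id_lam W n N Q D \<le> \<epsilon> + 2 * \<eta>"
  proof (rule id_lam_le)
    fix i j assume ij: "i \<in> {1..N}" "j \<in> {1..N}" "i \<noteq> j"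
    let ?A = "{a \<in> {..<q}. h i a = h j a}"
    have "h i \<noteq> h j" using inj_onD[OF bij_betw_imp_inj_on[OF h] _ ij(1,2)] ij(3) by blast
    hence cA: "card ?A < r" using F(3) hF ij by blast
    have "(\<Sum>a<q. measure (W n (enc (w j a))) (D i)) \<le> (\<Sum>a<q. (if h i a = h j a then 1 else 0) + (\<epsilon> + \<eta>))"
    proof (rule sum_mono)
      fix a assume "a \<in> {..<q}"
      hence a: "a < q" by simp
      interpret Wa: prob_space "W n (enc (w j a))" by (rule pr[OF ij(2) a])
      show "measure (W n (enc (w j a))) (D i) \<le> (if h i a = h j a then 1 else 0) + (\<epsilon> + \<eta>)"
      proof (cases "h i a = h j a")
        case True thus ?thesis using pos by (intro order_trans[OF Wa.prob_le_1]) simp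
      next
        case False
        \<comment> \<open>Entries of different columns are different codewords, so a coincidence
          could occur only within column a, where it is excluded.\<close>
        have ne: "w i a' \<noteq> w j a" if "a' < q" for a' using winj[of i a' j a] False ij that a by auto
        have "D i \<subseteq> space (Ysp MY n) - E (w j a)"
        proof
          fix y assume "y \<in> D i"
          then obtain a' where a': "a' < q" "y \<in> E (w i a')" by (auto simp: D_def)
          with ne[OF a'(1)] show "y \<in> space (Ysp MY n) - E (w j a)" by (simp add: E_def)
        qed
        hence "measure (W n (enc (w j a))) (D i) \<le> e (w j a)" unfolding e_def
          by (rule Wa.finite_measure_mono) (use E[OF wM[OF ij(2) a]] pr(2)[OF ij(2) a] in auto)
        thus ?thesis using we[OF ij(2) a] False by simp
      qed
    qed
    also have "\<dots> = card ?A + q * (\<epsilon> + \<eta>)" by (simp add: sum.distrib sum.If_cases Int_def)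
    also have "real (card ?A) \<le> q * \<eta>"
    proof -
      have "real (card ?A) \<le> r" using cA by simp
      also have "\<dots> = q * (1 / s)" using s by (simp add: q_def)
      also have "\<dots> \<le> q * \<eta>" using s(2) by (rule mult_left_mono) simp
      finally show ?thesis .
    qed
    finally have "(\<Sum>a<q. measure (W n (enc (w j a))) (D i)) \<le> q * (\<epsilon> + 2 * \<eta>)" by (simp add: algebra_simps)
    thus "measure (Q j \<bind> W n) (D i) \<le> \<epsilon> + 2 * \<eta>"
      unfolding U(3)[OF ij(2) D[OF ij(1)]] using q1 by (simp add: divide_le_eq mult.commute)
  qed (use pos in simp)
  moreover have "ln (\<eta> / 2 / (\<epsilon> + \<eta>) / (2 * 6 ^ s) * M) \<le> ln (ln (real N))"
  proof (rule ln_mono)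
    show "0 < \<eta> / 2 / (\<epsilon> + \<eta>) / (2 * 6 ^ s) * M" using pos M by simp
    \<comment> \<open>Rounding r down costs at most a factor 2, because r \<ge> 1; so q, and with it
      ln N, is at least a constant multiple of M.\<close>
    have "card K < (r + 1) * (s * b)" unfolding r_def using sb
      by (metis Suc_eq_plus1 dividend_less_div_times mult.commute mult_Suc add.commute)
    also have "\<dots> \<le> (2 * r) * (s * b)" using r1 by (intro mult_right_mono) auto
    finally have "card K \<le> q * (2 * b)" by (simp add: q_def mult_ac)
    hence "real (card K) \<le> real (q * (2 * b))" by (simp only: of_nat_le_iff)
    also have "\<dots> = real q * (2 * 6 ^ s)" by (simp add: b_def)
    finally have "real (card K) \<le> real q * (2 * 6 ^ s)" .
    with cK have "\<eta> / 2 / (\<epsilon> + \<eta>) * M \<le> real q * (2 * 6 ^ s)" by (rule order_trans)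
    hence "\<eta> / 2 / (\<epsilon> + \<eta>) * M / (2 * 6 ^ s) \<le> q" by (subst pos_divide_le_eq) auto
    moreover have "real q \<le> ln (real N)"
    proof -
      have "exp (real q) = exp 1 ^ q" by (simp flip: exp_of_nat_mult)
      also have "\<dots> \<le> 3 ^ q" using exp_le by (intro power_mono) auto
      also have "(3::real) ^ q = real (3 ^ q)" by simp
      also have "\<dots> \<le> N" using N3 by (simp only: of_nat_le_iff)
      finally show ?thesis using N1 by (subst ln_ge_iff) auto
    qed
    ultimately show "\<eta> / 2 / (\<epsilon> + \<eta>) / (2 * 6 ^ s) * M \<le> ln (real N)" by simp
  qed
  ultimately show ?thesis by blast
qed

lemma trivial_idcode:
  assumes ch: "general_channel MY W" and n: "n > 0" and x: "x \<in> XG c \<Gamma> n"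
  shows "\<exists>Q D. idcode MY c \<Gamma> n 1 Q D \<and> id_mu MY W n 1 Q D \<le> 0 \<and> id_lam W n 1 Q D \<le> 0"
proof -
  let ?Q = "\<lambda>_::nat. distr (uniform_count_measure {..<1::nat}) (Xsp n) (\<lambda>_. x)"
  let ?D = "\<lambda>_::nat. space (Ysp MY n)"
  have "idcode MY c \<Gamma> n 1 ?Q ?D"
    unfolding idcode_def using uniform_input(1,2)[OF ch n zero_less_one x] by auto
  moreover have "id_mu MY W n 1 ?Q ?D \<le> 0" by (rule id_mu_le) auto
  moreover have "id_lam W n 1 ?Q ?D \<le> 0" by (rule id_lam_le) auto
  ultimately show ?thesis by blast
qed

lemma id_achievable_of_t_achievable:
  fixes R \<epsilon> \<mu> lam :: real
  assumes ch: "general_channel MY W" and \<epsilon>: "\<epsilon> \<ge> 0" "\<epsilon> \<le> \<mu>" "\<epsilon> \<le> lam" and t: "t_achievable MY W c \<Gamma> \<epsilon> R"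
  shows "id_achievable MY W c \<Gamma> \<mu> lam R"
proof -
  from t obtain M enc dec where tc: "\<And>n. n > 0 \<Longrightarrow> tcode MY c \<Gamma> n (M n) (enc n) (dec n)"
    and er: "limsup (\<lambda>n. ereal (terr MY W n (M n) (enc n) (dec n))) \<le> ereal \<epsilon>"
    and ra: "ereal R \<le> liminf (\<lambda>n. ereal (ln (real (M n)) / real n))"
    unfolding t_achievable_def by blast
  have ne: "\<exists>x. x \<in> XG c \<Gamma> n" if "n > 0" for n
  proof -
    have "M n \<ge> 1" "\<forall>i\<in>{1..M n}. enc n i \<in> XG c \<Gamma> n" using tc[OF that] by (simp_all add: tcode_def)
    hence "enc n 1 \<in> XG c \<Gamma> n" by simp
    thus ?thesis by (intro exI[of _ "enc n 1"])
  qed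
  define V where "V n \<phi> = (case \<phi> of (N, Q, D) \<Rightarrow> idcode MY c \<Gamma> n N Q D)" for n \<phi>
  define A where "A n e \<phi> = (case \<phi> of (N, Q, D) \<Rightarrow> id_mu MY W n N Q D \<le> \<mu> + e \<and> id_lam W n N Q D \<le> lam + e \<and>
     R - e \<le> ln (ln (real N)) / real n)" for n :: nat and e \<phi>
  \<comment> \<open>A single message that always accepts. As \<open>ln (ln 1)\<close> evaluates to
    0, it settles every R \<le> 0, and it supplies a code for the small n at which the construction
    does not yet apply.\<close>
  have triv: "\<exists>\<phi>. V n \<phi> \<and> (R \<le> 0 \<longrightarrow> A n e \<phi>)" if n: "n > 0" and e: "e > 0" for n and e :: real
  proof -
    obtain x where "x \<in> XG c \<Gamma> n" using ne[OF n] by blast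
    from trivial_idcode[OF ch n this] obtain Q D where QD: "idcode MY c \<Gamma> n 1 Q D"
      "id_mu MY W n 1 Q D \<le> 0" "id_lam W n 1 Q D \<le> 0" by blast
    have "V n (1, Q, D)" using QD by (simp add: V_def)
    moreover have "R \<le> 0 \<Longrightarrow> A n e (1, Q, D)" using QD(2,3) \<epsilon> e by (simp add: A_def)
    ultimately show ?thesis by blast
  qed
  have "\<exists>\<Phi>. (\<forall>n>0. V n (\<Phi> n)) \<and> (\<forall>e>0. \<forall>\<^sub>F n in sequentially. A n e (\<Phi> n))"
  proof (rule eventually_diagonal)
    show "\<exists>\<phi>. V n \<phi>" if "n > 0" for n using triv[OF that zero_less_one] by blast
    show "A n e' \<phi>" if "A n e \<phi>" "e \<le> e'" for n e e' \<phi>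
      using that by (auto simp: A_def split: prod.splits)
    fix e :: real assume e: "e > 0"
    show "\<forall>\<^sub>F n in sequentially. \<exists>\<phi>. V n \<phi> \<and> A n e \<phi>"
    proof (cases "R \<le> 0")
      case True
      show ?thesis using eventually_gt_at_top[of 0]
        by eventually_elim (use triv[OF _ e] True in blast)
    next
      case False
      define \<eta> where "\<eta> = e / 2"
      have \<eta>: "\<eta> > 0" using e by (simp add: \<eta>_def)
      \<comment> \<open>Besides g \<le> e / 2, this keeps R - g positive, so that M n grows
        exponentially and passes the threshold s 6^s / C, which does not depend on n.\<close>
      define g where "g = min (e / 2) (R / 2)"
      have g: "g > 0" "g \<le> e / 2" "R - g > 0" using e False by (auto simp: g_def)
      obtain k where k: "1 / real (Suc k) < \<eta>" using \<eta> nat_approx_posE by blast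
      define s where "s = Suc k"
      have s: "s \<ge> 1" "1 / real s \<le> \<eta>" using k by (simp_all add: s_def)
      define C where "C = \<eta> / 2 / (\<epsilon> + \<eta>)"
      have C: "C > 0" using \<eta> \<epsilon> by (simp add: C_def)
      have C': "C / (2 * 6 ^ s) > 0" using C by simp
      \<comment> \<open>The parameter s is fixed by \<eta>, so the constant factor lost in ln N
        disappears at the scale 1 / n.\<close>
      have "(\<lambda>n. ln (C / (2 * 6 ^ s)) / real n) \<longlonglongrightarrow> 0" by real_asymp
      hence "\<forall>\<^sub>F n in sequentially. - (e / 2) < ln (C / (2 * 6 ^ s)) / real n"
        by (rule order_tendstoD) (use e in simp)
      moreover have "\<forall>\<^sub>F n in sequentially. terr MY W n (M n) (enc n) (dec n) \<le> \<epsilon> + \<eta> / 2"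
        by (rule limsup_leD[OF er]) (use \<eta> in simp)
      moreover have "\<forall>\<^sub>F n in sequentially. R - g \<le> ln (real (M n)) / real n"
        by (rule liminf_geD[OF ra g(1)])
      moreover have "\<forall>\<^sub>F n in sequentially. real s * 6 ^ s / C \<le> exp (real n * (R - g))"
      proof -
        have "filterlim (\<lambda>n. exp (real n * (R - g))) at_top sequentially" using g(3) by real_asymp
        thus ?thesis by (simp add: filterlim_at_top)
      qed
      ultimately show ?thesis using eventually_gt_at_top[of 0]
      proof eventually_elim
        case (elim n)
        note n = elim(5)
        have M1: "M n \<ge> 1" using tc[OF n] by (simp add: tcode_def)
        have lM: "n * (R - g) \<le> ln (real (M n))" using elim(3) n by (simp add: le_divide_eq mult.commute)
        hence "exp (n * (R - g)) \<le> M n" using M1 by (subst (asm) ln_ge_iff) auto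
        hence "real s * 6 ^ s / C \<le> M n" using elim(4) by linarith
        hence "real s * 6 ^ s \<le> C * M n" using C by (simp add: divide_le_eq mult.commute)
        hence "real s * 6 ^ s \<le> \<eta> / 2 / (\<epsilon> + \<eta>) * M n" unfolding C_def .
        from exists_idcode[OF ch n tc[OF n] elim(2) \<eta> \<epsilon>(1) s this]
        obtain N Q D where ND: "idcode MY c \<Gamma> n N Q D" "id_mu MY W n N Q D \<le> \<epsilon> + \<eta>"
          "id_lam W n N Q D \<le> \<epsilon> + 2 * \<eta>" "ln (C / (2 * 6 ^ s) * M n) \<le> ln (ln (real N))"
          unfolding C_def by blast
        have "ln (C / (2 * 6 ^ s)) / n + ln (real (M n)) / n = ln (C / (2 * 6 ^ s) * M n) / n"
          using C' M1 by (simp only: ln_mult_pos add_divide_distrib of_nat_0_less_iff)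
        also have "\<dots> \<le> ln (ln (real N)) / n" using ND(4) by (rule divide_right_mono) simp
        finally have "R - e \<le> ln (ln (real N)) / n" using elim(1,3) g(2) by linarith
        moreover have "id_mu MY W n N Q D \<le> \<mu> + e" using ND(2) \<epsilon>(2) e by (simp add: \<eta>_def)
        moreover have "id_lam W n N Q D \<le> lam + e" using ND(3) \<epsilon>(3) by (simp add: \<eta>_def)
        ultimately show ?case using ND(1) by (intro exI[of _ "(N, Q, D)"]) (simp add: V_def A_def)
      qed
    qed
  qed
  then obtain \<Phi> where \<Phi>: "\<And>n. n > 0 \<Longrightarrow> V n (\<Phi> n)" "\<And>e. e > 0 \<Longrightarrow> \<forall>\<^sub>F n in sequentially. A n e (\<Phi> n)" by blast
  define N where "N n = fst (\<Phi> n)" for n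
  define Q where "Q n = fst (snd (\<Phi> n))" for n
  define D where "D n = snd (snd (\<Phi> n))" for n
  have V': "idcode MY c \<Gamma> n (N n) (Q n) (D n)" if "n > 0" for n
    using \<Phi>(1)[OF that] by (simp add: V_def N_def Q_def D_def case_prod_beta)
  have A': "\<forall>\<^sub>F n in sequentially. id_mu MY W n (N n) (Q n) (D n) \<le> \<mu> + e \<and>
      id_lam W n (N n) (Q n) (D n) \<le> lam + e \<and> R - e \<le> ln (ln (real (N n))) / real n" if "e > 0" for e
    using \<Phi>(2)[OF that] by (simp add: A_def N_def Q_def D_def case_prod_beta)
  have "limsup (\<lambda>n. ereal (id_mu MY W n (N n) (Q n) (D n))) \<le> ereal \<mu>"
    unfolding limsup_le_iff_eventually by (intro allI impI, rule eventually_mono[OF A']) auto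
  moreover have "limsup (\<lambda>n. ereal (id_lam W n (N n) (Q n) (D n))) \<le> ereal lam"
    unfolding limsup_le_iff_eventually by (intro allI impI, rule eventually_mono[OF A']) auto
  moreover have "ereal R \<le> liminf (\<lambda>n. ereal (ln (ln (real (N n))) / real n))"
    unfolding liminf_ge_iff_eventually by (intro allI impI, rule eventually_mono[OF A']) auto
  ultimately show ?thesis unfolding id_achievable_def using V' by blast
qed

section \<open>From achievable rates to their suprema and infima\<close>

theorem theorem6p1:
  fixes MY :: "'b measure"
    and W :: "nat \<Rightarrow> (nat \<Rightarrow> real) \<Rightarrow> (nat \<Rightarrow> 'b) measure"
    and c :: "nat \<Rightarrow> (nat \<Rightarrow> real) \<Rightarrow> real"
    and \<Gamma> \<epsilon> \<delta> \<mu> lam :: real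
  assumes "general_channel MY W"
    and "A1_A2 W c \<Gamma>"
    and "\<epsilon> \<ge> 0" and "\<delta> \<ge> 0" and "\<mu> \<ge> 0" and "lam \<ge> 0"
    and "\<epsilon> \<le> \<mu>" and "\<epsilon> \<le> lam" and "\<delta> < 1 - \<mu> - lam"
  shows "(SUP P\<in>S_Gamma c \<Gamma>. I_under MY W P) \<le> C_s MY W c \<Gamma> \<epsilon>
       \<and> C_s MY W c \<Gamma> \<epsilon> \<le> D_id MY W c \<Gamma> \<mu> lam
       \<and> D_id MY W c \<Gamma> \<mu> lam \<le> S_res W c \<Gamma> \<delta>
       \<and> S_res W c \<Gamma> \<delta> \<le> (SUP P\<in>S_Gamma c \<Gamma>. I_over MY W P)"
proof (intro conjI)
  show "(SUP P\<in>S_Gamma c \<Gamma>. I_under MY W P) \<le> C_s MY W c \<Gamma> \<epsilon>"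
  proof (rule SUP_least, rule ereal_le_real)
    fix P assume P: "P \<in> S_Gamma c \<Gamma>"
    fix R assume "C_s MY W c \<Gamma> \<epsilon> \<le> ereal R"
    show "I_under MY W P \<le> ereal R"
    proof (rule ccontr)
      assume "\<not> I_under MY W P \<le> ereal R"
      hence "ereal R < I_under MY W P" by simp
      \<comment> \<open>\<open>I_under\<close> may be infinite and need not itself be achievable; a
        real rate strictly below it is.\<close>
      then obtain R' where R': "ereal R < ereal R'" "ereal R' < I_under MY W P"
        using ereal_dense2 by blast
      have "t_achievable MY W c \<Gamma> \<epsilon> R'"
        by (rule t_achievable_of_less_I_under[OF assms(1,2) P assms(3) R'(2)])
      hence "ereal R' \<le> C_s MY W c \<Gamma> \<epsilon>" unfolding C_s_def by (intro Sup_upper) simp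
      also note \<open>C_s MY W c \<Gamma> \<epsilon> \<le> ereal R\<close>
      finally show False using R'(1) by simp
    qed
  qed
  show "C_s MY W c \<Gamma> \<epsilon> \<le> D_id MY W c \<Gamma> \<mu> lam"
    unfolding C_s_def D_id_def
    by (rule Sup_subset_mono, rule image_mono)
      (use id_achievable_of_t_achievable[OF assms(1,3,7,8)] in blast)
  show "D_id MY W c \<Gamma> \<mu> lam \<le> S_res W c \<Gamma> \<delta>"
    unfolding D_id_def S_res_def
  proof (rule Sup_least, rule Inf_greatest)
    fix x y assume "x \<in> ereal ` {R. id_achievable MY W c \<Gamma> \<mu> lam R}"
      and "y \<in> ereal ` {R. \<forall>P\<in>S_Gamma c \<Gamma>. r_achievable_for W c \<Gamma> \<delta> P R}"
    then obtain R R' where "x = ereal R" "y = ereal R'" "id_achievable MY W c \<Gamma> \<mu> lam R"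
      "\<forall>P\<in>S_Gamma c \<Gamma>. r_achievable_for W c \<Gamma> \<delta> P R'" by (elim imageE CollectE)
    with id_rate_le_res_rate[OF assms(1,2,9)] show "x \<le> y" by simp
  qed
  show "S_res W c \<Gamma> \<delta> \<le> (SUP P\<in>S_Gamma c \<Gamma>. I_over MY W P)"
  proof (rule ccontr)
    assume "\<not> ?thesis"
    hence "(SUP P\<in>S_Gamma c \<Gamma>. I_over MY W P) < S_res W c \<Gamma> \<delta>" by simp
    \<comment> \<open>One real rate strictly above all the \<open>I_over\<close> serves every input
      process at once, as \<open>S_res\<close> demands.\<close>
    then obtain R where R: "(SUP P\<in>S_Gamma c \<Gamma>. I_over MY W P) < ereal R" "ereal R < S_res W c \<Gamma> \<delta>"
      using ereal_dense2 by blast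
    have "r_achievable_for W c \<Gamma> \<delta> P R" if P: "P \<in> S_Gamma c \<Gamma>" for P
    proof (rule r_achievable_of_I_over_less[OF assms(1,2) P assms(4)])
      have "I_over MY W P \<le> (SUP P\<in>S_Gamma c \<Gamma>. I_over MY W P)" by (rule SUP_upper[OF P])
      thus "I_over MY W P < ereal R" using R(1) by (rule order_le_less_trans)
    qed
    hence "S_res W c \<Gamma> \<delta> \<le> ereal R" unfolding S_res_def by (intro Inf_lower) blast
    thus False using R(2) by simp
  qed
qed

end
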